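(* Let $k$ be a field of characteristic zero and let $V,W,W'$ be finite-dimensional $k$-vector spaces with $\dim W,\dim W'\ge\dim V$. Let $P$ be the object on $Z^+\times Z^-$ obtained by descent from the restriction of $\widehat Q$ to $U^+\times U^-$ (see context). Then there is an isomorphism $$P\cong\mathcal O_{Z^+\times_{Z_0}Z^-}.$$
   Context: $d=\dim V$. $G=\mathrm{GL}(V)$ acts on $Z=\mathrm{Hom}(V,W)\times\mathrm{Hom}(W',V)$ by $g\cdot(\varphi,\vartheta)=(\varphi g^{-1},g\vartheta)$. $U^+\subset Z$ (resp. $U^-\subset Z$) is the open set where $\varphi$ (resp. $\vartheta$) has rank $d$; $Z^\pm=[U^\pm/G]$; $Z_0=\mathrm{Spec}(k[Z]^G)$. Let $\mathbf Q_Z=\mathrm{Hom}(V,W)\times\mathrm{Hom}(W',V)\times\mathrm{End}(V)\ni(\varphi,\vartheta,c)$ with maps $p(\varphi,\vartheta,c)=(\varphi,c\vartheta)$ and $s(\varphi,\vartheta,c)=(\varphi c,\vartheta)$ to $Z$, and $G\times G$-action $(g_1,g_2)\cdot(\varphi,\vartheta,c)=(\varphi g_1^{-1},g_2\vartheta,g_1cg_2^{-1})$; $\widehat Q=(p,s)_*\mathcal O_{\mathbf Q_Z}$ is a $G\times G$-equivariant sheaf on $Z\times Z$. $\mathcal O_{Z^+\times_{Z_0}Z^-}$ denotes the pushforward to $Z^+\times Z^-$ of the structure sheaf of the closed subscheme $Z^+\times_{Z_0}Z^-$. *)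

theory Defs
  imports Complex_Main "HOL-Library.FuncSet" "HOL-Algebra.QuotRing" "HOL-Algebra.Module"
begin

section \<open>Affine schemes and their structure sheaves\<close>

definition Spec :: "('a, 'm) ring_scheme \<Rightarrow> 'a set set" where
  "Spec R = {p. primeideal p R}"

definition zopen :: "('a, 'm) ring_scheme \<Rightarrow> 'a set set \<Rightarrow> bool" where
  "zopen R U \<longleftrightarrow> (\<exists>E \<subseteq> carrier R. U = {p \<in> Spec R. \<not> E \<subseteq> p})"

text \<open>The germ at \<open>p\<close> of the fraction \<open>a / s\<close>, as an equivalence class of pairs
  (numerator, denominator); these classes are the elements of the local ring \<open>R\<^sub>p\<close>.\<close>

definition germ :: "('a, 'm) ring_scheme \<Rightarrow> 'a set \<Rightarrow> 'a \<Rightarrow> 'a \<Rightarrow> ('a \<times> 'a) set" where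
  "germ R p a s = {(b, t). b \<in> carrier R \<and> t \<in> carrier R - p \<and>
     (\<exists>u \<in> carrier R - p. u \<otimes>\<^bsub>R\<^esub> (a \<otimes>\<^bsub>R\<^esub> t) = u \<otimes>\<^bsub>R\<^esub> (b \<otimes>\<^bsub>R\<^esub> s))}"

text \<open>In the next three definitions all members of the union coincide when the arguments are
  germs, so the union is the class of the sum, the product and the image, respectively.\<close>

definition germ_add ::
    "('a, 'm) ring_scheme \<Rightarrow> 'a set \<Rightarrow> ('a \<times> 'a) set \<Rightarrow> ('a \<times> 'a) set \<Rightarrow> ('a \<times> 'a) set" where
  "germ_add R p x y = (\<Union>(a, s)\<in>x. \<Union>(b, t)\<in>y.
     germ R p ((a \<otimes>\<^bsub>R\<^esub> t) \<oplus>\<^bsub>R\<^esub> (b \<otimes>\<^bsub>R\<^esub> s)) (s \<otimes>\<^bsub>R\<^esub> t))"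

definition germ_mult ::
    "('a, 'm) ring_scheme \<Rightarrow> 'a set \<Rightarrow> ('a \<times> 'a) set \<Rightarrow> ('a \<times> 'a) set \<Rightarrow> ('a \<times> 'a) set" where
  "germ_mult R p x y = (\<Union>(a, s)\<in>x. \<Union>(b, t)\<in>y. germ R p (a \<otimes>\<^bsub>R\<^esub> b) (s \<otimes>\<^bsub>R\<^esub> t))"

definition germ_map ::
    "('b, 'n) ring_scheme \<Rightarrow> ('a \<Rightarrow> 'b) \<Rightarrow> 'b set \<Rightarrow> ('a \<times> 'a) set \<Rightarrow> ('b \<times> 'b) set" where
  "germ_map S h q x = (\<Union>(a, s)\<in>x. germ S q (h a) (h s))"

type_synonym 'a loc_section = "'a set \<Rightarrow> ('a \<times> 'a) set"

definition Osec :: "('a, 'm) ring_scheme \<Rightarrow> 'a set set \<Rightarrow> 'a loc_section ring" where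
  "Osec R U = \<lparr>
     carrier = {\<sigma> \<in> extensional U. \<forall>p\<in>U. \<exists>V. zopen R V \<and> p \<in> V \<and> V \<subseteq> U \<and>
       (\<exists>a \<in> carrier R. \<exists>s \<in> carrier R. \<forall>q\<in>V. s \<notin> q \<and> \<sigma> q = germ R q a s)},
     mult = (\<lambda>\<sigma> \<tau>. \<lambda>p\<in>U. germ_mult R p (\<sigma> p) (\<tau> p)),
     one = (\<lambda>p\<in>U. germ R p \<one>\<^bsub>R\<^esub> \<one>\<^bsub>R\<^esub>),
     zero = (\<lambda>p\<in>U. germ R p \<zero>\<^bsub>R\<^esub> \<one>\<^bsub>R\<^esub>),
     add = (\<lambda>\<sigma> \<tau>. \<lambda>p\<in>U. germ_add R p (\<sigma> p) (\<tau> p))\<rparr>"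

text \<open>A ring homomorphism \<open>h : R \<rightarrow> S\<close> gives \<open>Spec S \<rightarrow> Spec R\<close>: the map on points, the
  preimage of an open set, and the map \<open>O(U) \<rightarrow> O(preimage of U)\<close> on sections.\<close>

definition spec_map :: "('a, 'm) ring_scheme \<Rightarrow> ('a \<Rightarrow> 'b) \<Rightarrow> 'b set \<Rightarrow> 'a set" where
  "spec_map R h q = {a \<in> carrier R. h a \<in> q}"

definition spec_preim ::
    "('a, 'm) ring_scheme \<Rightarrow> ('b, 'n) ring_scheme \<Rightarrow> ('a \<Rightarrow> 'b) \<Rightarrow> 'a set set \<Rightarrow> 'b set set" where
  "spec_preim R S h U = {q \<in> Spec S. spec_map R h q \<in> U}"

definition pull_sec ::
    "('a, 'm) ring_scheme \<Rightarrow> ('b, 'n) ring_scheme \<Rightarrow> ('a \<Rightarrow> 'b) \<Rightarrow> 'a set set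
      \<Rightarrow> 'a loc_section \<Rightarrow> 'b loc_section" where
  "pull_sec R S h U \<sigma> = (\<lambda>q \<in> spec_preim R S h U. germ_map S h q (\<sigma> (spec_map R h q)))"

text \<open>Rank at the point \<open>p\<close> of a matrix \<open>M\<close> over \<open>R\<close>: the maximal number of columns that are
  linearly independent over the residue field \<open>Frac (R / p)\<close>. Denominators in a linear relation
  can be cleared, so its coefficients may be taken in \<open>R\<close>.\<close>

definition indep_cols_at ::
    "('a, 'm) ring_scheme \<Rightarrow> 'a set \<Rightarrow> 'i set \<Rightarrow> ('i \<Rightarrow> 'j \<Rightarrow> 'a) \<Rightarrow> 'j set \<Rightarrow> bool" where
  "indep_cols_at R p I M S \<longleftrightarrow> (\<forall>a \<in> S \<rightarrow> carrier R.
     (\<forall>i\<in>I. (\<Oplus>\<^bsub>R\<^esub>j\<in>S. M i j \<otimes>\<^bsub>R\<^esub> a j) \<in> p) \<longrightarrow> (\<forall>j\<in>S. a j \<in> p))"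

definition rank_at ::
    "('a, 'm) ring_scheme \<Rightarrow> 'a set \<Rightarrow> 'i set \<Rightarrow> 'j set \<Rightarrow> ('i \<Rightarrow> 'j \<Rightarrow> 'a) \<Rightarrow> nat" where
  "rank_at R p I J M = Max {card S | S. S \<subseteq> J \<and> indep_cols_at R p I M S}"

section \<open>Sheaves of modules, and sheaves on a quotient stack\<close>

record ('p, 'a, 'b) msheaf =
  sec :: "'p set \<Rightarrow> ('a, 'b) module"
  res :: "'p set \<Rightarrow> 'p set \<Rightarrow> 'b \<Rightarrow> 'b"

text \<open>Isomorphism, over the family \<open>T\<close> of open sets, of sheaves of \<open>OX\<close>-modules.\<close>

definition msheaf_iso ::
    "'p set set \<Rightarrow> ('p set \<Rightarrow> 'a ring) \<Rightarrow> ('p, 'a, 'b) msheaf \<Rightarrow> ('p, 'a, 'c) msheaf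
      \<Rightarrow> ('p set \<Rightarrow> 'b \<Rightarrow> 'c) \<Rightarrow> bool" where
  "msheaf_iso T OX F F' \<eta> \<longleftrightarrow>
     (\<forall>U\<in>T. bij_betw (\<eta> U) (carrier (sec F U)) (carrier (sec F' U)) \<and>
        (\<forall>x \<in> carrier (sec F U). \<forall>y \<in> carrier (sec F U).
           \<eta> U (x \<oplus>\<^bsub>sec F U\<^esub> y) = \<eta> U x \<oplus>\<^bsub>sec F' U\<^esub> \<eta> U y) \<and>
        (\<forall>a \<in> carrier (OX U). \<forall>x \<in> carrier (sec F U).
           \<eta> U (a \<odot>\<^bsub>sec F U\<^esub> x) = a \<odot>\<^bsub>sec F' U\<^esub> \<eta> U x)) \<and>
     (\<forall>U\<in>T. \<forall>V\<in>T. V \<subseteq> U \<longrightarrow>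
        (\<forall>x \<in> carrier (sec F U). \<eta> V (res F U V x) = res F' U V (\<eta> U x)))"

text \<open>The sheaf of modules \<open>f\<^sub>* O\<close> on \<open>Spec R\<close>, for the morphism
  \<open>f : Spec S \<rightarrow> Spec R\<close> given by \<open>h : R \<rightarrow> S\<close>.\<close>

definition pushforward ::
    "('a, 'm) ring_scheme \<Rightarrow> ('b, 'n) ring_scheme \<Rightarrow> ('a \<Rightarrow> 'b)
      \<Rightarrow> ('a set, 'a loc_section, 'b loc_section) msheaf" where
  "pushforward R S h = \<lparr>
     sec = (\<lambda>U. let W = spec_preim R S h U in \<lparr>
        carrier = carrier (Osec S W), mult = mult (Osec S W), one = one (Osec S W),
        zero = zero (Osec S W), add = add (Osec S W),
        smult = (\<lambda>\<sigma> \<tau>. pull_sec R S h U \<sigma> \<otimes>\<^bsub>Osec S W\<^esub> \<tau>)\<rparr>),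
     res = (\<lambda>U V \<tau>. restrict \<tau> (spec_preim R S h V))\<rparr>"

text \<open>The action groupoid \<open>H \<times> X \<rightrightarrows> X\<close> of an affine group scheme \<open>H\<close> on an \<open>H\<close>-stable open
  subscheme \<open>X\<close> (the locus) of \<open>Spec A\<close>: the rings \<open>A\<close> and \<open>k[H] \<otimes> A\<close>, and the two
  homomorphisms \<open>A \<rightarrow> k[H] \<otimes> A\<close> given by the projection and by the action.\<close>

record ('a, 'b) action_gpd =
  base :: "'a ring"
  total :: "'b ring"
  proj :: "'a \<Rightarrow> 'b"
  act :: "'a \<Rightarrow> 'b"
  locus :: "'a set set"

definition opens0 :: "('a, 'b) action_gpd \<Rightarrow> 'a set set set" where
  "opens0 \<Gamma> = {U. zopen (base \<Gamma>) U \<and> U \<subseteq> locus \<Gamma>}"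

definition opens1 :: "('a, 'b) action_gpd \<Rightarrow> 'b set set set" where
  "opens1 \<Gamma> = {U. zopen (total \<Gamma>) U \<and> U \<subseteq> spec_preim (base \<Gamma>) (total \<Gamma>) (proj \<Gamma>) (locus \<Gamma>)}"

text \<open>A quasi-coherent sheaf on the quotient stack \<open>[X / H]\<close> is an \<open>H\<close>-equivariant
  quasi-coherent sheaf on \<open>X\<close>. It is given as a cartesian sheaf on the groupoid: a sheaf
  \<open>F\<^sub>0\<close> on \<open>X\<close>, a sheaf \<open>F\<^sub>1\<close> on \<open>H \<times> X\<close>, and maps \<open>F\<^sub>0(U) \<rightarrow> F\<^sub>1(proj\<^sup>-\<^sup>1 U)\<close> and
  \<open>F\<^sub>0(U) \<rightarrow> F\<^sub>1(act\<^sup>-\<^sup>1 U)\<close> which identify \<open>F\<^sub>1\<close> with \<open>proj\<^sup>* F\<^sub>0\<close> and with \<open>act\<^sup>* F\<^sub>0\<close>.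
  The composite of the two identifications is the equivariant structure
  \<open>act\<^sup>* F\<^sub>0 \<cong> proj\<^sup>* F\<^sub>0\<close>.\<close>

record ('p, 'a, 'b, 'p1, 'a1, 'b1) stack_sheaf =
  lev0 :: "('p, 'a, 'b) msheaf"
  lev1 :: "('p1, 'a1, 'b1) msheaf"
  via_proj :: "'p set \<Rightarrow> 'b \<Rightarrow> 'b1"
  via_act :: "'p set \<Rightarrow> 'b \<Rightarrow> 'b1"

text \<open>An isomorphism \<open>\<eta>\<^sub>0\<close> on \<open>X\<close> is equivariant iff \<open>proj\<^sup>* \<eta>\<^sub>0\<close> and \<open>act\<^sup>* \<eta>\<^sub>0\<close> agree
  after the identifications with \<open>F\<^sub>1\<close>. Compatibility with \<open>via_proj\<close> and \<open>via_act\<close> says that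
  \<open>\<eta>\<^sub>1\<close> is this common value.\<close>

definition stack_sheaf_isomorphic ::
    "('a, 'b) action_gpd
      \<Rightarrow> ('a set, 'a loc_section, 'c, 'b set, 'b loc_section, 'd) stack_sheaf
      \<Rightarrow> ('a set, 'a loc_section, 'e, 'b set, 'b loc_section, 'f) stack_sheaf \<Rightarrow> bool" where
  "stack_sheaf_isomorphic \<Gamma> F F' \<longleftrightarrow> (\<exists>\<eta>0 \<eta>1.
     msheaf_iso (opens0 \<Gamma>) (Osec (base \<Gamma>)) (lev0 F) (lev0 F') \<eta>0 \<and>
     msheaf_iso (opens1 \<Gamma>) (Osec (total \<Gamma>)) (lev1 F) (lev1 F') \<eta>1 \<and>
     (\<forall>U \<in> opens0 \<Gamma>. \<forall>x \<in> carrier (sec (lev0 F) U).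
        \<eta>1 (spec_preim (base \<Gamma>) (total \<Gamma>) (proj \<Gamma>) U) (via_proj F U x)
          = via_proj F' U (\<eta>0 U x) \<and>
        \<eta>1 (spec_preim (base \<Gamma>) (total \<Gamma>) (act \<Gamma>) U) (via_act F U x)
          = via_act F' U (\<eta>0 U x)))"

text \<open>Let \<open>H\<close> act on the affine scheme \<open>Spec C\<close> and let \<open>f : Spec C \<rightarrow> Spec A\<close> be equivariant.
  Since \<open>f\<close> is affine and \<open>proj\<close>, \<open>act\<close> are flat, base change identifies both pullbacks of
  \<open>f\<^sub>* O\<close> with \<open>(id \<times> f)\<^sub>* O\<close>, which yields the equivariant sheaf \<open>f\<^sub>* O\<close> (restricted
  to the locus by \<open>stack_sheaf_isomorphic\<close>). Arguments: \<open>C\<close>, \<open>D = k[H] \<otimes> C\<close>, the homomorphisms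
  \<open>A \<rightarrow> C\<close> and \<open>k[H] \<otimes> A \<rightarrow> D\<close> of \<open>f\<close> and \<open>id \<times> f\<close>, and the homomorphisms \<open>C \<rightarrow> D\<close> of
  the projection and of the action.\<close>

definition equivariant_pushforward ::
    "('a, 'b) action_gpd \<Rightarrow> ('c, 'm) ring_scheme \<Rightarrow> ('d, 'n) ring_scheme
      \<Rightarrow> ('a \<Rightarrow> 'c) \<Rightarrow> ('b \<Rightarrow> 'd) \<Rightarrow> ('c \<Rightarrow> 'd) \<Rightarrow> ('c \<Rightarrow> 'd)
      \<Rightarrow> ('a set, 'a loc_section, 'c loc_section, 'b set, 'b loc_section, 'd loc_section) stack_sheaf" where
  "equivariant_pushforward \<Gamma> C D f0 f1 pr ac = \<lparr>
     lev0 = pushforward (base \<Gamma>) C f0,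
     lev1 = pushforward (total \<Gamma>) D f1,
     via_proj = (\<lambda>U. pull_sec C D pr (spec_preim (base \<Gamma>) C f0 U)),
     via_act = (\<lambda>U. pull_sec C D ac (spec_preim (base \<Gamma>) C f0 U))\<rparr>"

section \<open>Coordinate rings\<close>

text \<open>An affine variety given by its \<open>k\<close>-points and a generating set of regular functions.
  Below, the \<open>k\<close>-points are those of products of vector spaces and groups \<open>GL(V)\<close>. Since
  \<open>k\<close> is infinite they are Zariski dense in the corresponding \<open>k\<close>-schemes, hence a regular
  function is determined by its values on them and \<open>coord_ring\<close> is the coordinate ring.\<close>

record ('x, 'k) variety =
  pts :: "'x set"
  coords :: "('x \<Rightarrow> 'k) set"

inductive_set regular :: "('x, 'k::field) variety \<Rightarrow> ('x \<Rightarrow> 'k) set" for X where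
  const: "(\<lambda>x \<in> pts X. a) \<in> regular X"
| coord: "f \<in> coords X \<Longrightarrow> (\<lambda>x \<in> pts X. f x) \<in> regular X"
| add: "f \<in> regular X \<Longrightarrow> g \<in> regular X \<Longrightarrow> (\<lambda>x \<in> pts X. f x + g x) \<in> regular X"
| mult: "f \<in> regular X \<Longrightarrow> g \<in> regular X \<Longrightarrow> (\<lambda>x \<in> pts X. f x * g x) \<in> regular X"

definition coord_ring :: "('x, 'k::field) variety \<Rightarrow> ('x \<Rightarrow> 'k) ring" where
  "coord_ring X = \<lparr>
     carrier = regular X,
     mult = (\<lambda>f g. \<lambda>x \<in> pts X. f x * g x), one = (\<lambda>x \<in> pts X. 1),
     zero = (\<lambda>x \<in> pts X. 0), add = (\<lambda>f g. \<lambda>x \<in> pts X. f x + g x)\<rparr>"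

definition comap :: "('x, 'k) variety \<Rightarrow> ('x \<Rightarrow> 'y) \<Rightarrow> ('y \<Rightarrow> 'k) \<Rightarrow> 'x \<Rightarrow> 'k" where
  "comap X m f = (\<lambda>x \<in> pts X. f (m x))"

definition vprod :: "('x, 'k) variety \<Rightarrow> ('y, 'k) variety \<Rightarrow> ('x \<times> 'y, 'k) variety" where
  "vprod X Y = \<lparr>
     pts = pts X \<times> pts Y,
     coords = (\<lambda>f. f \<circ> fst) ` coords X \<union> (\<lambda>f. f \<circ> snd) ` coords Y\<rparr>"

definition Hom_var ::
    "('k::field \<Rightarrow> 'a::ab_group_add \<Rightarrow> 'a) \<Rightarrow> ('k \<Rightarrow> 'b::ab_group_add \<Rightarrow> 'b)
      \<Rightarrow> ('a \<Rightarrow> 'b, 'k) variety" where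
  "Hom_var sA sB = \<lparr>
     pts = {f. Vector_Spaces.linear sA sB f},
     coords = {(\<lambda>f. \<xi> (f a)) | \<xi> a. Vector_Spaces.linear sB (*) \<xi>}\<rparr>"

text \<open>\<open>k[GL(V)]\<close> is generated by the entries of \<open>g\<close> and of its inverse.\<close>

definition GL_var :: "('k::field \<Rightarrow> 'a::ab_group_add \<Rightarrow> 'a) \<Rightarrow> ('a \<Rightarrow> 'a, 'k) variety" where
  "GL_var s = \<lparr>
     pts = {g. Vector_Spaces.linear s s g \<and> bij g},
     coords = {(\<lambda>g. \<xi> (g a)) | \<xi> a. Vector_Spaces.linear s (*) \<xi>}
       \<union> {(\<lambda>g. \<xi> (inv_into UNIV g a)) | \<xi> a. Vector_Spaces.linear s (*) \<xi>}\<rparr>"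

section \<open>The kernel and the fibre product\<close>

locale three_spaces =
  V: finite_dimensional_vector_space scaleV BV +
  W: finite_dimensional_vector_space scaleW BW +
  W': finite_dimensional_vector_space scaleW' BW'
  for scaleV :: "'k::field_char_0 \<Rightarrow> 'v::ab_group_add \<Rightarrow> 'v" and BV :: "'v set"
    and scaleW :: "'k \<Rightarrow> 'w::ab_group_add \<Rightarrow> 'w" and BW :: "'w set"
    and scaleW' :: "'k \<Rightarrow> 'u::ab_group_add \<Rightarrow> 'u" and BW' :: "'u set"
begin

definition G :: "('v \<Rightarrow> 'v, 'k) variety" where
  "G = GL_var scaleV"

definition Z :: "(('v \<Rightarrow> 'w) \<times> ('u \<Rightarrow> 'v), 'k) variety" where
  "Z = vprod (Hom_var scaleV scaleW) (Hom_var scaleW' scaleV)"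

definition QZ :: "(('v \<Rightarrow> 'w) \<times> ('u \<Rightarrow> 'v) \<times> ('v \<Rightarrow> 'v), 'k) variety" where
  "QZ = vprod (Hom_var scaleV scaleW)
     (vprod (Hom_var scaleW' scaleV) (Hom_var scaleV scaleV))"

definition actZ :: "('v \<Rightarrow> 'v) \<Rightarrow> ('v \<Rightarrow> 'w) \<times> ('u \<Rightarrow> 'v) \<Rightarrow> ('v \<Rightarrow> 'w) \<times> ('u \<Rightarrow> 'v)" where
  "actZ = (\<lambda>g (\<phi>, \<theta>). (\<phi> \<circ> inv_into UNIV g, g \<circ> \<theta>))"

definition actZZ where
  "actZZ = (\<lambda>(g1, g2) (z1, z2). (actZ g1 z1, actZ g2 z2))"

definition actQ ::
    "('v \<Rightarrow> 'v) \<times> ('v \<Rightarrow> 'v) \<Rightarrow> ('v \<Rightarrow> 'w) \<times> ('u \<Rightarrow> 'v) \<times> ('v \<Rightarrow> 'v)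
      \<Rightarrow> ('v \<Rightarrow> 'w) \<times> ('u \<Rightarrow> 'v) \<times> ('v \<Rightarrow> 'v)" where
  "actQ = (\<lambda>(g1, g2) (\<phi>, \<theta>, c).
     (\<phi> \<circ> inv_into UNIV g1, g2 \<circ> \<theta>, g1 \<circ> c \<circ> inv_into UNIV g2))"

definition p :: "('v \<Rightarrow> 'w) \<times> ('u \<Rightarrow> 'v) \<times> ('v \<Rightarrow> 'v) \<Rightarrow> ('v \<Rightarrow> 'w) \<times> ('u \<Rightarrow> 'v)" where
  "p = (\<lambda>(\<phi>, \<theta>, c). (\<phi>, c \<circ> \<theta>))"

definition s :: "('v \<Rightarrow> 'w) \<times> ('u \<Rightarrow> 'v) \<times> ('v \<Rightarrow> 'v) \<Rightarrow> ('v \<Rightarrow> 'w) \<times> ('u \<Rightarrow> 'v)" where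
  "s = (\<lambda>(\<phi>, \<theta>, c). (\<phi> \<circ> c, \<theta>))"

definition ps where "ps x = (p x, s x)"

text \<open>The matrices over \<open>k[Z]\<close> of the universal maps \<open>\<phi>\<close> and \<open>\<theta>\<close>.\<close>

definition mat_phi :: "'w \<Rightarrow> 'v \<Rightarrow> ('v \<Rightarrow> 'w) \<times> ('u \<Rightarrow> 'v) \<Rightarrow> 'k" where
  "mat_phi w v = (\<lambda>z \<in> pts Z. W.representation BW (fst z v) w)"

definition mat_theta :: "'v \<Rightarrow> 'u \<Rightarrow> ('v \<Rightarrow> 'w) \<times> ('u \<Rightarrow> 'v) \<Rightarrow> 'k" where
  "mat_theta v u = (\<lambda>z \<in> pts Z. V.representation BV (snd z u) v)"

definition Uplus :: "(('v \<Rightarrow> 'w) \<times> ('u \<Rightarrow> 'v) \<Rightarrow> 'k) set set" where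
  "Uplus = {x \<in> Spec (coord_ring Z). rank_at (coord_ring Z) x BW BV mat_phi = V.dim UNIV}"

definition Uminus :: "(('v \<Rightarrow> 'w) \<times> ('u \<Rightarrow> 'v) \<Rightarrow> 'k) set set" where
  "Uminus = {x \<in> Spec (coord_ring Z). rank_at (coord_ring Z) x BV BW' mat_theta = V.dim UNIV}"

abbreviation "GG \<equiv> vprod G G"
abbreviation "ZZ \<equiv> vprod Z Z"
abbreviation "GGZZ \<equiv> vprod GG ZZ"
abbreviation "GGQ \<equiv> vprod GG QZ"

text \<open>\<open>Z\<^sup>+ \<times> Z\<^sup>-\<close> is the quotient of \<open>U\<^sup>+ \<times> U\<^sup>-\<close>, an open subscheme of \<open>Z \<times> Z\<close>,
  by \<open>G \<times> G\<close>.\<close>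

definition ZplusZminus where
  "ZplusZminus = \<lparr>
     base = coord_ring ZZ,
     total = coord_ring GGZZ,
     proj = comap GGZZ snd,
     act = comap GGZZ (\<lambda>(h, z). actZZ h z),
     locus = spec_preim (coord_ring Z) (coord_ring ZZ) (comap ZZ fst) Uplus
       \<inter> spec_preim (coord_ring Z) (coord_ring ZZ) (comap ZZ snd) Uminus\<rparr>"

definition P where
  "P = equivariant_pushforward ZplusZminus (coord_ring QZ) (coord_ring GGQ)
     (comap QZ ps) (comap GGQ (\<lambda>(h, x). (h, ps x)))
     (comap GGQ snd) (comap GGQ (\<lambda>(h, x). actQ h x))"

text \<open>\<open>k[Z]\<^sup>G\<close>: as functions are determined by their values on \<open>k\<close>-points, the condition
  says that the action and the projection \<open>G \<times> Z \<rightarrow> Z\<close> pull \<open>f\<close> back to the same element.\<close>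

definition invariants :: "(('v \<Rightarrow> 'w) \<times> ('u \<Rightarrow> 'v) \<Rightarrow> 'k) set" where
  "invariants = {f \<in> carrier (coord_ring Z). \<forall>g \<in> pts G. \<forall>z \<in> pts Z. f (actZ g z) = f z}"

text \<open>\<open>Z \<times>\<^bsub>Z\<^sub>0\<^esub> Z\<close> is the spectrum of the tensor product \<open>k[Z] \<otimes> k[Z]\<close> over
  \<open>k[Z]\<^sup>G\<close>, that is, of the quotient of \<open>k[Z \<times> Z]\<close> by the ideal generated by all
  \<open>f \<otimes> 1 - 1 \<otimes> f\<close> with \<open>f\<close> invariant.\<close>

definition fib_gens where
  "fib_gens = {(\<lambda>z \<in> pts ZZ. f (fst z) - f (snd z)) | f. f \<in> invariants}"

definition fib_ideal where
  "fib_ideal = genideal (coord_ring ZZ) fib_gens"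

text \<open>The ideal of \<open>G \<times> G \<times> (Z \<times>\<^bsub>Z\<^sub>0\<^esub> Z)\<close>.\<close>

definition GG_fib_ideal where
  "GG_fib_ideal = genideal (coord_ring GGZZ) (comap GGZZ snd ` fib_gens)"

text \<open>A map of quotient rings induced by \<open>h\<close>; as for germs, all members of the union coincide.\<close>

definition induced where
  "induced h c = (\<Union>a\<in>c. GG_fib_ideal +>\<^bsub>coord_ring GGZZ\<^esub> h a)"

text \<open>The restriction of \<open>Z \<times>\<^bsub>Z\<^sub>0\<^esub> Z\<close> to \<open>U\<^sup>+ \<times> U\<^sup>-\<close> is the \<open>G \<times> G\<close>-stable closed
  subscheme which descends to \<open>Z\<^sup>+ \<times>\<^bsub>Z\<^sub>0\<^esub> Z\<^sup>-\<close>.\<close>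

definition O_fib where
  "O_fib = equivariant_pushforward ZplusZminus
     (coord_ring ZZ Quot fib_ideal) (coord_ring GGZZ Quot GG_fib_ideal)
     (\<lambda>f. fib_ideal +>\<^bsub>coord_ring ZZ\<^esub> f) (\<lambda>f. GG_fib_ideal +>\<^bsub>coord_ring GGZZ\<^esub> f)
     (induced (proj ZplusZminus)) (induced (act ZplusZminus))"

end

end

(* Write a point of Z x Z as (phi1, theta1, phi2, theta2). The morphism (p, s) parametrizes the
   points with theta1 = c theta2 and phi2 = phi1 c. Invariants agree on the two components of
   such a point: this is clear if c is invertible, and c can be deformed along a line to
   endomorphisms with smaller kernel, on which a polynomial identity may be tested. Hence (p, s)
   factors through the fibre product. Conversely, near a prime of U+ x U- there are N and R with
   N phi1 = Delta and theta2 R = Delta' for nonzero scalars Delta, Delta', so c = N phi2 / Delta is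
   a function on Z x Z. Since the entries of phi theta are invariant, phi1 theta1 = phi2 theta2 on
   the fibre product; multiplying by N and by R yields theta1 = c theta2 and phi2 = phi1 c there.
   So the map of rings is an isomorphism on all stalks over U+ x U-, and the same argument
   with the parameters G x G gives the equivariance. *)

theory Submission
  imports Defs "HOL-Computational_Algebra.Polynomial"
begin

section \<open>Prime ideals and germs\<close>

text \<open>In general the ring map from k[Z x Z] modulo the fibre ideal to k[Q] is not an
  isomorphism: where phi and theta vanish, (p, s) forgets c. So there is no global inverse to write
  down, and everything is reduced to \<open>stalk_iso\<close>, which states bijectivity after
  localization elementwise, by clearing denominators outside a prime; no localized ring is formed.
  The second obstacle is that the fibre product is not known to be reduced, so an equation on it
  cannot be tested at k-points. Such equations are carried as congruences of functions modulo the
  ideal (\<open>in_ideal\<close>); k-points only serve to identify honest functions. The passage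
  from relations between coordinates to all functions vanishing on the graph is an induction over
  the generation of regular functions (\<open>graph_section\<close>). The sheaf isomorphism is the
  inverse of pulling sections back from the fibre product to Q, and equivariance becomes the
  commutation of two squares of ring maps. Both levels of the groupoid need the same geometric
  argument, which is therefore stated once, for an abstract family.\<close>

lemma Spec_subset: "x \<in> Spec R \<Longrightarrow> x \<subseteq> carrier R"
  unfolding Spec_def by (auto dest: primeideal.axioms(1) ideal.Icarr)

lemma (in cring) Spec_mult_iff:
  assumes "x \<in> Spec R" "a \<in> carrier R" "b \<in> carrier R"
  shows "a \<otimes> b \<in> x \<longleftrightarrow> a \<in> x \<or> b \<in> x"
proof -
  interpret x: primeideal x R using assms(1) by (simp add: Spec_def)
  show ?thesis
    using x.I_prime[OF assms(2,3)] x.I_l_closed[OF _ assms(2), of b] x.I_r_closed[OF _ assms(3), of a]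
    by auto
qed

lemma (in cring) Spec_one: "x \<in> Spec R \<Longrightarrow> \<one> \<notin> x"
  unfolding Spec_def using ideal.one_imp_carrier primeideal.I_notcarr primeideal.axioms(1) by blast

lemma (in cring) Spec_zero: "x \<in> Spec R \<Longrightarrow> \<zero> \<in> x"
  unfolding Spec_def using additive_subgroup.zero_closed ideal.axioms(1) primeideal.axioms(1) by blast

lemma (in cring) Spec_add: "x \<in> Spec R \<Longrightarrow> a \<in> x \<Longrightarrow> b \<in> x \<Longrightarrow> a \<oplus> b \<in> x"
  unfolding Spec_def
  by (auto intro: additive_subgroup.a_closed[OF ideal.axioms(1)[OF primeideal.axioms(1)]])

lemma (in cring) Spec_pow: "x \<in> Spec R \<Longrightarrow> a \<in> carrier R \<Longrightarrow> a \<notin> x \<Longrightarrow> a [^] (n::nat) \<notin> x"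
  by (induction n) (auto simp: Spec_one Spec_mult_iff)

lemma (in cring) SpecI:
  assumes "x \<subseteq> carrier R" "\<zero> \<in> x" "\<one> \<notin> x"
    and add: "\<And>a b. a \<in> x \<Longrightarrow> b \<in> x \<Longrightarrow> a \<oplus> b \<in> x"
    and mult: "\<And>a b. a \<in> carrier R \<Longrightarrow> b \<in> x \<Longrightarrow> a \<otimes> b \<in> x"
    and prime: "\<And>a b. a \<in> carrier R \<Longrightarrow> b \<in> carrier R \<Longrightarrow> a \<otimes> b \<in> x \<Longrightarrow> a \<in> x \<or> b \<in> x"
  shows "x \<in> Spec R"
proof -
  have neg: "\<ominus> a \<in> x" if "a \<in> x" for a
  proof -
    have "\<ominus> a = (\<ominus> \<one>) \<otimes> a" using that assms(1) by (simp add: l_minus subset_iff)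
    then show ?thesis using mult[of "\<ominus> \<one>" a] that by simp
  qed
  have "subgroup x (add_monoid R)"
    by (rule add.subgroupI) (use assms(1,2) neg add in \<open>auto simp: a_inv_def\<close>)
  then have "ideal x R"
    by (intro idealI ring_axioms) (use assms(1) mult m_comm in \<open>metis subsetD\<close>)+
  then show ?thesis
    unfolding Spec_def using assms(3) prime by (auto intro!: primeidealI is_cring)
qed

lemma zopen_subset: "zopen R U \<Longrightarrow> U \<subseteq> Spec R"
  by (auto simp: zopen_def)

lemma zopen_basic:
  assumes "a \<in> carrier R"
  shows "zopen R {x \<in> Spec R. a \<notin> x}"
  unfolding zopen_def using assms by (intro exI[of _ "{a}"]) auto

lemma zopen_contains_basic:
  assumes "zopen R U" "x \<in> U"
  obtains a where "a \<in> carrier R" "a \<notin> x" "{y \<in> Spec R. a \<notin> y} \<subseteq> U"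
proof -
  obtain E where E: "E \<subseteq> carrier R" "U = {x \<in> Spec R. \<not> E \<subseteq> x}"
    using assms(1) unfolding zopen_def by auto
  then obtain a where "a \<in> E" "a \<notin> x" using assms(2) by auto
  then show thesis using that[of a] E by auto
qed

lemma (in cring) zopen_Int:
  assumes "zopen R U" "zopen R V"
  shows "zopen R (U \<inter> V)"
proof -
  obtain E F where E: "E \<subseteq> carrier R" "U = {x \<in> Spec R. \<not> E \<subseteq> x}"
    and F: "F \<subseteq> carrier R" "V = {x \<in> Spec R. \<not> F \<subseteq> x}"
    using assms unfolding zopen_def by auto
  let ?EF = "{a \<otimes> b | a b. a \<in> E \<and> b \<in> F}"
  have *: "?EF \<subseteq> x \<longleftrightarrow> E \<subseteq> x \<or> F \<subseteq> x" if x: "x \<in> Spec R" for x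
  proof
    assume EF: "?EF \<subseteq> x"
    show "E \<subseteq> x \<or> F \<subseteq> x"
    proof (rule ccontr)
      assume "\<not> (E \<subseteq> x \<or> F \<subseteq> x)"
      then obtain a b where ab: "a \<in> E" "a \<notin> x" "b \<in> F" "b \<notin> x" by blast
      then have "a \<otimes> b \<in> x" using EF by blast
      then show False using Spec_mult_iff[OF x, of a b] ab E(1) F(1) by blast
    qed
  next
    assume "E \<subseteq> x \<or> F \<subseteq> x"
    then show "?EF \<subseteq> x" using Spec_mult_iff[OF x] E(1) F(1) by (auto simp: subset_iff)
  qed
  have "?EF \<subseteq> carrier R" using E(1) F(1) by auto
  moreover have "U \<inter> V = {x \<in> Spec R. \<not> ?EF \<subseteq> x}"
    using * unfolding E(2) F(2) by blast
  ultimately show ?thesis unfolding zopen_def by blast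
qed

section \<open>Equality and arithmetic of fractions in the local ring at a prime\<close>

lemma (in cring) germ_eq_iff:
  assumes x: "x \<in> Spec R" and a: "a \<in> carrier R" "s \<in> carrier R" "s \<notin> x"
    and b: "b \<in> carrier R" "t \<in> carrier R" "t \<notin> x"
  shows "germ R x a s = germ R x b t \<longleftrightarrow> (\<exists>u \<in> carrier R - x. u \<otimes> (a \<otimes> t) = u \<otimes> (b \<otimes> s))"
proof
  assume "germ R x a s = germ R x b t"
  moreover have "(b, t) \<in> germ R x b t"
    using b one_closed Spec_one[OF x] unfolding germ_def by blast
  ultimately have "(b, t) \<in> germ R x a s" by simp
  then show "\<exists>u \<in> carrier R - x. u \<otimes> (a \<otimes> t) = u \<otimes> (b \<otimes> s)"
    unfolding germ_def by auto
next
  have sub: "germ R x a s \<subseteq> germ R x b t"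
    if a: "a \<in> carrier R" "s \<in> carrier R" "s \<notin> x"
      and b: "b \<in> carrier R" "t \<in> carrier R" "t \<notin> x"
      and u: "u \<in> carrier R - x" "u \<otimes> (a \<otimes> t) = u \<otimes> (b \<otimes> s)" for a s b t u
  proof
    fix z assume "z \<in> germ R x a s"
    then obtain c r v where z: "z = (c, r)" "c \<in> carrier R" "r \<in> carrier R" "r \<notin> x"
      and v: "v \<in> carrier R" "v \<notin> x" "v \<otimes> (a \<otimes> r) = v \<otimes> (c \<otimes> s)"
      unfolding germ_def by auto
    have "(u \<otimes> v \<otimes> s) \<otimes> (b \<otimes> r) = (u \<otimes> (b \<otimes> s)) \<otimes> (v \<otimes> r)"
      using a b z u(1) v(1) by (simp add: m_ac)
    also have "\<dots> = (v \<otimes> (a \<otimes> r)) \<otimes> (u \<otimes> t)"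
      unfolding u(2)[symmetric] using a b z u(1) v(1) by (simp add: m_ac)
    also have "\<dots> = (u \<otimes> v \<otimes> s) \<otimes> (c \<otimes> t)"
      unfolding v(3) using a b z u(1) v(1) by (simp add: m_ac)
    finally have "(u \<otimes> v \<otimes> s) \<otimes> (b \<otimes> r) = (u \<otimes> v \<otimes> s) \<otimes> (c \<otimes> t)" .
    \<comment> \<open>Transitivity of equality of fractions: besides the two multipliers, the
      denominator \<open>s\<close> of the middle fraction has to be multiplied in.\<close>
    moreover have "u \<otimes> v \<otimes> s \<in> carrier R - x"
      using a u(1) v(1,2) by (simp add: Spec_mult_iff[OF x])
    ultimately show "z \<in> germ R x b t"
      unfolding germ_def using z by blast
  qed
  assume "\<exists>u \<in> carrier R - x. u \<otimes> (a \<otimes> t) = u \<otimes> (b \<otimes> s)"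
  then obtain u where "u \<in> carrier R - x" "u \<otimes> (a \<otimes> t) = u \<otimes> (b \<otimes> s)" by blast
  then show "germ R x a s = germ R x b t"
    using sub[OF a b] sub[OF b a] by force
qed

lemma (in cring) germ_eqI:
  assumes "x \<in> Spec R" "a \<in> carrier R" "s \<in> carrier R" "s \<notin> x"
    and "b \<in> carrier R" "t \<in> carrier R" "t \<notin> x" and "a \<otimes> t = b \<otimes> s"
  shows "germ R x a s = germ R x b t"
proof -
  have "\<one> \<in> carrier R - x" "\<one> \<otimes> (a \<otimes> t) = \<one> \<otimes> (b \<otimes> s)"
    using assms(8) Spec_one[OF assms(1)] by simp_all
  then show ?thesis using germ_eq_iff[OF assms(1-7)] by blast
qed

lemma (in cring) germ_self:
  assumes "x \<in> Spec R" "a \<in> carrier R" "s \<in> carrier R" "s \<notin> x"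
  shows "(a, s) \<in> germ R x a s"
proof -
  have "\<one> \<in> carrier R - x" using Spec_one[OF assms(1)] by simp
  then show ?thesis unfolding germ_def using assms by blast
qed

lemma (in cring) germ_memD:
  assumes "x \<in> Spec R" "a \<in> carrier R" "s \<in> carrier R" "s \<notin> x" "(b, t) \<in> germ R x a s"
  shows "b \<in> carrier R" "t \<in> carrier R" "t \<notin> x"
    "\<exists>u \<in> carrier R - x. u \<otimes> (a \<otimes> t) = u \<otimes> (b \<otimes> s)" "germ R x b t = germ R x a s"
proof -
  show b: "b \<in> carrier R" and t: "t \<in> carrier R" "t \<notin> x"
    and ex: "\<exists>u \<in> carrier R - x. u \<otimes> (a \<otimes> t) = u \<otimes> (b \<otimes> s)"
    using assms(5) unfolding germ_def by auto
  show "germ R x b t = germ R x a s"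
    using germ_eq_iff[OF assms(1-4) b t] ex by blast
qed

text \<open>The union in \<open>germ_mult\<close> runs over all representatives. They all contribute
  the same class: the product of the multipliers that witness the two equalities of fractions
  witnesses the equality of the products.\<close>

lemma (in cring) germ_mult_germ:
  assumes x: "x \<in> Spec R" and a: "a \<in> carrier R" "s \<in> carrier R" "s \<notin> x"
    and b: "b \<in> carrier R" "t \<in> carrier R" "t \<notin> x"
  shows "germ_mult R x (germ R x a s) (germ R x b t) = germ R x (a \<otimes> b) (s \<otimes> t)"
proof -
  have "germ R x (a' \<otimes> b') (s' \<otimes> t') = germ R x (a \<otimes> b) (s \<otimes> t)"
    if "(a', s') \<in> germ R x a s" "(b', t') \<in> germ R x b t" for a' s' b' t'
  proof -
    note A = germ_memD[OF x a that(1)] and B = germ_memD[OF x b that(2)]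
    obtain u v where u: "u \<in> carrier R" "u \<notin> x" "u \<otimes> (a \<otimes> s') = u \<otimes> (a' \<otimes> s)"
      and v: "v \<in> carrier R" "v \<notin> x" "v \<otimes> (b \<otimes> t') = v \<otimes> (b' \<otimes> t)"
      using A(4) B(4) by blast
    have "(u \<otimes> v) \<otimes> ((a' \<otimes> b') \<otimes> (s \<otimes> t)) = (u \<otimes> (a' \<otimes> s)) \<otimes> (v \<otimes> (b' \<otimes> t))"
      using A(1-3) B(1-3) a b u(1) v(1) by (simp add: m_ac)
    also have "\<dots> = (u \<otimes> v) \<otimes> ((a \<otimes> b) \<otimes> (s' \<otimes> t'))"
      unfolding u(3)[symmetric] v(3)[symmetric]
      using A(1-3) B(1-3) a b u(1) v(1) by (simp add: m_ac)
    finally have "(u \<otimes> v) \<otimes> ((a' \<otimes> b') \<otimes> (s \<otimes> t)) = (u \<otimes> v) \<otimes> ((a \<otimes> b) \<otimes> (s' \<otimes> t'))" .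
    moreover have "u \<otimes> v \<in> carrier R - x"
      using u(1,2) v(1,2) by (simp add: Spec_mult_iff[OF x])
    ultimately show ?thesis
      using A(1-3) B(1-3) a b
      by (subst germ_eq_iff[OF x]) (auto simp: Spec_mult_iff[OF x])
  qed
  then show ?thesis
    unfolding germ_mult_def using germ_self[OF x a] germ_self[OF x b] by fast
qed

lemma (in cring) germ_add_germ:
  assumes x: "x \<in> Spec R" and a: "a \<in> carrier R" "s \<in> carrier R" "s \<notin> x"
    and b: "b \<in> carrier R" "t \<in> carrier R" "t \<notin> x"
  shows "germ_add R x (germ R x a s) (germ R x b t) = germ R x ((a \<otimes> t) \<oplus> (b \<otimes> s)) (s \<otimes> t)"
proof -
  have "germ R x ((a' \<otimes> t') \<oplus> (b' \<otimes> s')) (s' \<otimes> t') = germ R x ((a \<otimes> t) \<oplus> (b \<otimes> s)) (s \<otimes> t)"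
    if "(a', s') \<in> germ R x a s" "(b', t') \<in> germ R x b t" for a' s' b' t'
  proof -
    note A = germ_memD[OF x a that(1)] and B = germ_memD[OF x b that(2)]
    obtain u v where u: "u \<in> carrier R" "u \<notin> x" "u \<otimes> (a \<otimes> s') = u \<otimes> (a' \<otimes> s)"
      and v: "v \<in> carrier R" "v \<notin> x" "v \<otimes> (b \<otimes> t') = v \<otimes> (b' \<otimes> t)"
      using A(4) B(4) by blast
    have "(u \<otimes> v) \<otimes> (((a' \<otimes> t') \<oplus> (b' \<otimes> s')) \<otimes> (s \<otimes> t))
        = (u \<otimes> (a' \<otimes> s)) \<otimes> (v \<otimes> (t' \<otimes> t)) \<oplus> (v \<otimes> (b' \<otimes> t)) \<otimes> (u \<otimes> (s \<otimes> s'))"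
      using A(1-3) B(1-3) a b u(1) v(1) by algebra
    also have "\<dots> = (u \<otimes> v) \<otimes> (((a \<otimes> t) \<oplus> (b \<otimes> s)) \<otimes> (s' \<otimes> t'))"
      unfolding u(3)[symmetric] v(3)[symmetric]
      using A(1-3) B(1-3) a b u(1) v(1) by algebra
    finally have "(u \<otimes> v) \<otimes> (((a' \<otimes> t') \<oplus> (b' \<otimes> s')) \<otimes> (s \<otimes> t)) = (u \<otimes> v) \<otimes> (((a \<otimes> t) \<oplus> (b \<otimes> s)) \<otimes> (s' \<otimes> t'))" .
    moreover have "u \<otimes> v \<in> carrier R - x"
      using u(1,2) v(1,2) by (simp add: Spec_mult_iff[OF x])
    ultimately show ?thesis
      using A(1-3) B(1-3) a b
      by (subst germ_eq_iff[OF x]) (auto simp: Spec_mult_iff[OF x])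
  qed
  then show ?thesis
    unfolding germ_add_def using germ_self[OF x a] germ_self[OF x b] by fast
qed

section \<open>Sections and their pullback\<close>

lemma ring_hom_cringI2: "cring R \<Longrightarrow> cring S \<Longrightarrow> h \<in> ring_hom R S \<Longrightarrow> ring_hom_cring R S h"
  by (simp add: ring_hom_cring_axioms_def ring_hom_cring_def)

lemma spec_map_Spec:
  assumes "ring_hom_cring R S h" "q \<in> Spec S"
  shows "spec_map R h q \<in> Spec R"
proof -
  interpret ring_hom_cring R S h by fact
  have "ring_hom_ring R S h" ..
  then have "primeideal {r \<in> carrier R. h r \<in> q} R"
    using assms(2) R.is_cring ring_hom_ring.primeideal_vimage unfolding Spec_def by blast
  then show ?thesis by (simp add: Spec_def spec_map_def)
qed

lemma spec_preim_mono: "V \<subseteq> U \<Longrightarrow> spec_preim R S h V \<subseteq> spec_preim R S h U"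
  by (auto simp: spec_preim_def)

lemma zopen_spec_preim:
  assumes "ring_hom_cring R S h" "zopen R U"
  shows "zopen S (spec_preim R S h U)"
proof -
  interpret ring_hom_cring R S h by fact
  obtain E where E: "E \<subseteq> carrier R" "U = {x \<in> Spec R. \<not> E \<subseteq> x}"
    using assms(2) unfolding zopen_def by auto
  have "h ` E \<subseteq> carrier S" using E(1) by auto
  moreover have "spec_preim R S h U = {x \<in> Spec S. \<not> h ` E \<subseteq> x}"
  proof -
    have "spec_map R h x \<in> U \<longleftrightarrow> \<not> h ` E \<subseteq> x" if "x \<in> Spec S" for x
      using spec_map_Spec[OF assms(1) that] E(1) unfolding E(2)
      by (auto simp: spec_map_def image_subset_iff subset_iff)
    then show ?thesis unfolding spec_preim_def by blast
  qed
  ultimately show ?thesis unfolding zopen_def by blast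
qed

lemma spec_map_comp:
  assumes "h \<in> ring_hom R S"
  shows "spec_map R h (spec_map S k q) = spec_map R (k \<circ> h) q"
  using assms by (auto simp: spec_map_def ring_hom_closed)

lemma spec_map_cong:
  assumes "\<And>a. a \<in> carrier R \<Longrightarrow> h a = h' a"
  shows "spec_map R h q = spec_map R h' q"
  using assms by (auto simp: spec_map_def)

lemma spec_preim_comp:
  assumes "ring_hom_cring S T k" "h \<in> ring_hom R S"
  shows "spec_preim S T k (spec_preim R S h U) = spec_preim R T (k \<circ> h) U"
  using spec_map_Spec[OF assms(1)] by (auto simp: spec_preim_def spec_map_comp[OF assms(2)])

lemma spec_preim_cong:
  assumes "\<And>a. a \<in> carrier R \<Longrightarrow> h a = h' a"
  shows "spec_preim R S h U = spec_preim R S h' U"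
  using spec_map_cong[of R h h', OF assms] by (simp add: spec_preim_def)

lemma germ_map_germ:
  assumes h: "ring_hom_cring R S h" and q: "q \<in> Spec S"
    and a: "a \<in> carrier R" "s \<in> carrier R" "s \<notin> spec_map R h q"
  shows "germ_map S h q (germ R (spec_map R h q) a s) = germ S q (h a) (h s)"
proof -
  interpret ring_hom_cring R S h by fact
  note p = spec_map_Spec[OF h q]
  have "germ S q (h b) (h t) = germ S q (h a) (h s)"
    if "(b, t) \<in> germ R (spec_map R h q) a s" for b t
  proof -
    note B = R.germ_memD[OF p a that]
    obtain u where u: "u \<in> carrier R" "u \<notin> spec_map R h q" "u \<otimes>\<^bsub>R\<^esub> (a \<otimes>\<^bsub>R\<^esub> t) = u \<otimes>\<^bsub>R\<^esub> (b \<otimes>\<^bsub>R\<^esub> s)"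
      using B(4) by auto
    have "h u \<otimes>\<^bsub>S\<^esub> (h b \<otimes>\<^bsub>S\<^esub> h s) = h (u \<otimes>\<^bsub>R\<^esub> (b \<otimes>\<^bsub>R\<^esub> s))" using u(1) B(1,2) a(1,2) by simp
    also have "\<dots> = h u \<otimes>\<^bsub>S\<^esub> (h a \<otimes>\<^bsub>S\<^esub> h t)"
      unfolding u(3)[symmetric] using u(1) B(1,2) a(1,2) by simp
    finally have "h u \<otimes>\<^bsub>S\<^esub> (h b \<otimes>\<^bsub>S\<^esub> h s) = h u \<otimes>\<^bsub>S\<^esub> (h a \<otimes>\<^bsub>S\<^esub> h t)" .
    moreover have "h u \<in> carrier S - q" "h s \<notin> q" "h t \<notin> q"
      using u(1,2) B(2,3) a(2,3) by (auto simp: spec_map_def)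
    ultimately show ?thesis
      using a(1,2) B(1,2) by (subst S.germ_eq_iff[OF q]) auto
  qed
  then show ?thesis
    unfolding germ_map_def using R.germ_self[OF p a] by fast
qed

lemma Osec_extensional: "\<sigma> \<in> carrier (Osec R U) \<Longrightarrow> \<sigma> \<in> extensional U"
  by (simp add: Osec_def)

lemma Osec_local:
  assumes "\<sigma> \<in> carrier (Osec R U)" "x \<in> U"
  obtains V a s where "zopen R V" "x \<in> V" "V \<subseteq> U" "a \<in> carrier R" "s \<in> carrier R"
    "\<And>q. q \<in> V \<Longrightarrow> s \<notin> q" "\<And>q. q \<in> V \<Longrightarrow> \<sigma> q = germ R q a s"
proof -
  have "\<forall>p\<in>U. \<exists>V. zopen R V \<and> p \<in> V \<and> V \<subseteq> U \<and>
       (\<exists>a \<in> carrier R. \<exists>s \<in> carrier R. \<forall>q\<in>V. s \<notin> q \<and> \<sigma> q = germ R q a s)"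
    using assms(1) by (simp add: Osec_def)
  from bspec[OF this assms(2)] show thesis using that by metis
qed

lemma Osec_germ:
  assumes "\<sigma> \<in> carrier (Osec R U)" "x \<in> U"
  obtains a s where "a \<in> carrier R" "s \<in> carrier R" "s \<notin> x" "\<sigma> x = germ R x a s"
  using Osec_local[OF assms] by metis

lemma OsecI:
  assumes "\<sigma> \<in> extensional U"
    and "\<And>x. x \<in> U \<Longrightarrow> \<exists>V a s. zopen R V \<and> x \<in> V \<and> V \<subseteq> U \<and> a \<in> carrier R \<and> s \<in> carrier R \<and>
      (\<forall>q\<in>V. s \<notin> q \<and> \<sigma> q = germ R q a s)"
  shows "\<sigma> \<in> carrier (Osec R U)"
proof -
  have "\<exists>V. zopen R V \<and> x \<in> V \<and> V \<subseteq> U \<and>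
       (\<exists>a \<in> carrier R. \<exists>s \<in> carrier R. \<forall>q\<in>V. s \<notin> q \<and> \<sigma> q = germ R q a s)" if "x \<in> U" for x
    using assms(2)[OF that] by metis
  then show ?thesis using assms(1) by (simp add: Osec_def)
qed

lemma Osec_add_apply: "x \<in> U \<Longrightarrow> (\<sigma> \<oplus>\<^bsub>Osec R U\<^esub> \<tau>) x = germ_add R x (\<sigma> x) (\<tau> x)"
  and Osec_mult_apply: "x \<in> U \<Longrightarrow> (\<sigma> \<otimes>\<^bsub>Osec R U\<^esub> \<tau>) x = germ_mult R x (\<sigma> x) (\<tau> x)"
  by (simp_all add: Osec_def)

text \<open>Sum and product of two fractions can both be written with the product of the
  denominators, so a single argument with the numerator \<open>num\<close> left open covers both
  ring operations. The neighbourhood is the intersection of the two given ones.\<close>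

lemma (in cring) Osec_binop_closed:
  assumes \<sigma>: "\<sigma> \<in> carrier (Osec R U)" and \<tau>: "\<tau> \<in> carrier (Osec R U)"
    and \<rho>: "\<rho> \<in> extensional U" "\<And>x. x \<in> U \<Longrightarrow> \<rho> x = F x (\<sigma> x) (\<tau> x)"
    and num: "\<And>a s b t. {a, s, b, t} \<subseteq> carrier R \<Longrightarrow> num a s b t \<in> carrier R"
    and F: "\<And>x a s b t. x \<in> Spec R \<Longrightarrow> {a, s, b, t} \<subseteq> carrier R \<Longrightarrow> s \<notin> x \<Longrightarrow> t \<notin> x \<Longrightarrow>
      F x (germ R x a s) (germ R x b t) = germ R x (num a s b t) (s \<otimes> t)"
  shows "\<rho> \<in> carrier (Osec R U)"
proof (rule OsecI[OF \<rho>(1)])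
  fix x assume x: "x \<in> U"
  from Osec_local[OF \<sigma> x] obtain V a s where V: "zopen R V" "x \<in> V" "V \<subseteq> U"
    "a \<in> carrier R" "s \<in> carrier R" "\<And>q. q \<in> V \<Longrightarrow> s \<notin> q" "\<And>q. q \<in> V \<Longrightarrow> \<sigma> q = germ R q a s" by metis
  from Osec_local[OF \<tau> x] obtain V' b t where V': "zopen R V'" "x \<in> V'" "V' \<subseteq> U"
    "b \<in> carrier R" "t \<in> carrier R" "\<And>q. q \<in> V' \<Longrightarrow> t \<notin> q" "\<And>q. q \<in> V' \<Longrightarrow> \<tau> q = germ R q b t" by metis
  have "s \<otimes> t \<notin> q \<and> \<rho> q = germ R q (num a s b t) (s \<otimes> t)" if "q \<in> V \<inter> V'" for q
  proof -
    have q: "q \<in> Spec R" "q \<in> U" using that zopen_subset[OF V(1)] V(3) by auto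
    show ?thesis
      using that V V' F[OF q(1), of a s b t] \<rho>(2)[OF q(2)] Spec_mult_iff[OF q(1)] by auto
  qed
  then show "\<exists>V a s. zopen R V \<and> x \<in> V \<and> V \<subseteq> U \<and> a \<in> carrier R \<and> s \<in> carrier R \<and>
      (\<forall>q\<in>V. s \<notin> q \<and> \<rho> q = germ R q a s)"
    using V(1-5) V'(1-5) zopen_Int[OF V(1) V'(1)] num[of a s b t]
    by (intro exI[of _ "V \<inter> V'"] exI[of _ "num a s b t"] exI[of _ "s \<otimes> t"]) auto
qed

lemma (in cring) Osec_add_closed:
  assumes "\<sigma> \<in> carrier (Osec R U)" "\<tau> \<in> carrier (Osec R U)"
  shows "\<sigma> \<oplus>\<^bsub>Osec R U\<^esub> \<tau> \<in> carrier (Osec R U)"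
  by (rule Osec_binop_closed[OF assms, where F = "germ_add R"
        and num = "\<lambda>a s b t. (a \<otimes> t) \<oplus> (b \<otimes> s)"])
    (auto simp: Osec_def germ_add_germ)

lemma (in cring) Osec_mult_closed:
  assumes "\<sigma> \<in> carrier (Osec R U)" "\<tau> \<in> carrier (Osec R U)"
  shows "\<sigma> \<otimes>\<^bsub>Osec R U\<^esub> \<tau> \<in> carrier (Osec R U)"
  by (rule Osec_binop_closed[OF assms, where F = "germ_mult R" and num = "\<lambda>a s b t. a \<otimes> b"])
    (auto simp: Osec_def germ_mult_germ)

lemma (in cring) Osec_restrict:
  assumes \<sigma>: "\<sigma> \<in> carrier (Osec R U)" and V: "zopen R V" "V \<subseteq> U"
  shows "restrict \<sigma> V \<in> carrier (Osec R V)"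
proof (rule OsecI)
  fix x assume x: "x \<in> V"
  then have "x \<in> U" using V(2) by auto
  from Osec_local[OF \<sigma> this] obtain W a s where W: "zopen R W" "x \<in> W" "W \<subseteq> U"
    "a \<in> carrier R" "s \<in> carrier R" "\<And>q. q \<in> W \<Longrightarrow> s \<notin> q" "\<And>q. q \<in> W \<Longrightarrow> \<sigma> q = germ R q a s"
    by metis
  then show "\<exists>W a s. zopen R W \<and> x \<in> W \<and> W \<subseteq> V \<and> a \<in> carrier R \<and> s \<in> carrier R \<and>
      (\<forall>q\<in>W. s \<notin> q \<and> restrict \<sigma> V q = germ R q a s)"
    using x zopen_Int[OF W(1) V(1)]
    by (intro exI[of _ "W \<inter> V"] exI[of _ a] exI[of _ s]) auto
qed simp

section \<open>Pullback of sections along a ring homomorphism\<close>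

lemma pull_sec_apply:
  "q \<in> spec_preim R S h U \<Longrightarrow> pull_sec R S h U \<sigma> q = germ_map S h q (\<sigma> (spec_map R h q))"
  by (simp add: pull_sec_def)

lemma pull_sec_extensional: "pull_sec R S h U \<sigma> \<in> extensional (spec_preim R S h U)"
  by (simp add: pull_sec_def)

lemma pull_sec_closed:
  assumes h: "ring_hom_cring R S h" and \<sigma>: "\<sigma> \<in> carrier (Osec R U)"
  shows "pull_sec R S h U \<sigma> \<in> carrier (Osec S (spec_preim R S h U))"
proof (rule OsecI[OF pull_sec_extensional])
  interpret ring_hom_cring R S h by fact
  fix q assume q: "q \<in> spec_preim R S h U"
  then have "spec_map R h q \<in> U" by (simp add: spec_preim_def)
  from Osec_local[OF \<sigma> this] obtain V a s where V: "zopen R V" "spec_map R h q \<in> V" "V \<subseteq> U"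
    "a \<in> carrier R" "s \<in> carrier R" "\<And>q. q \<in> V \<Longrightarrow> s \<notin> q" "\<And>q. q \<in> V \<Longrightarrow> \<sigma> q = germ R q a s" by metis
  have "h s \<notin> q' \<and> pull_sec R S h U \<sigma> q' = germ S q' (h a) (h s)"
    if "q' \<in> spec_preim R S h V" for q'
  proof -
    have q': "q' \<in> Spec S" "spec_map R h q' \<in> V" using that by (auto simp: spec_preim_def)
    have s: "s \<notin> spec_map R h q'" using V(6) q'(2) .
    then have "h s \<notin> q'" using V(5) by (simp add: spec_map_def)
    moreover have "q' \<in> spec_preim R S h U" using that spec_preim_mono[OF V(3)] by blast
    ultimately show ?thesis
      using V(7)[OF q'(2)] germ_map_germ[OF h q'(1) V(4,5) s] by (simp add: pull_sec_apply)
  qed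
  then show "\<exists>V a s. zopen S V \<and> q \<in> V \<and> V \<subseteq> spec_preim R S h U \<and> a \<in> carrier S \<and> s \<in> carrier S \<and>
      (\<forall>q\<in>V. s \<notin> q \<and> pull_sec R S h U \<sigma> q = germ S q a s)"
    using q V(2-5) zopen_spec_preim[OF h V(1)] spec_preim_mono[OF V(3)]
    by (intro exI[of _ "spec_preim R S h V"] exI[of _ "h a"] exI[of _ "h s"])
      (auto simp: spec_preim_def)
qed

lemma pull_sec_binop:
  assumes h: "ring_hom_cring R S h" and \<sigma>: "\<sigma> \<in> carrier (Osec R U)" and \<tau>: "\<tau> \<in> carrier (Osec R U)"
  shows pull_sec_mult: "pull_sec R S h U (\<sigma> \<otimes>\<^bsub>Osec R U\<^esub> \<tau>)
      = pull_sec R S h U \<sigma> \<otimes>\<^bsub>Osec S (spec_preim R S h U)\<^esub> pull_sec R S h U \<tau>" (is ?mult)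
    and pull_sec_add: "pull_sec R S h U (\<sigma> \<oplus>\<^bsub>Osec R U\<^esub> \<tau>)
      = pull_sec R S h U \<sigma> \<oplus>\<^bsub>Osec S (spec_preim R S h U)\<^esub> pull_sec R S h U \<tau>" (is ?add)
proof -
  interpret ring_hom_cring R S h by fact
  have *: "germ_map S h q ((\<sigma> \<otimes>\<^bsub>Osec R U\<^esub> \<tau>) x)
        = germ_mult S q (germ_map S h q (\<sigma> x)) (germ_map S h q (\<tau> x)) \<and>
      germ_map S h q ((\<sigma> \<oplus>\<^bsub>Osec R U\<^esub> \<tau>) x)
        = germ_add S q (germ_map S h q (\<sigma> x)) (germ_map S h q (\<tau> x))"
    if "q \<in> Spec S" "x \<in> U" and x: "x = spec_map R h q" for q x
  proof -
    have xs: "x \<in> Spec R" using spec_map_Spec[OF h that(1)] x by simp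
    from Osec_germ[OF \<sigma> that(2)] obtain a s where a: "a \<in> carrier R" "s \<in> carrier R" "s \<notin> x"
      "\<sigma> x = germ R x a s" .
    from Osec_germ[OF \<tau> that(2)] obtain b t where b: "b \<in> carrier R" "t \<in> carrier R" "t \<notin> x"
      "\<tau> x = germ R x b t" .
    have st: "s \<otimes>\<^bsub>R\<^esub> t \<notin> x" using R.Spec_mult_iff[OF xs] a b by simp
    have "h s \<notin> q" "h t \<notin> q" using a b unfolding x by (auto simp: spec_map_def)
    note g = germ_map_germ[OF h that(1), folded x]
    show ?thesis
      using a b st xs that(1,2) \<open>h s \<notin> q\<close> \<open>h t \<notin> q\<close>
      by (simp add: Osec_mult_apply Osec_add_apply R.germ_mult_germ R.germ_add_germ g
          S.germ_mult_germ S.germ_add_germ)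
  qed
  show ?mult
    by (rule extensionalityI[where A = "spec_preim R S h U"])
      (use * in \<open>auto simp: pull_sec_apply Osec_mult_apply spec_preim_def pull_sec_def Osec_def\<close>)
  show ?add
    by (rule extensionalityI[where A = "spec_preim R S h U"])
      (use * in \<open>auto simp: pull_sec_apply Osec_add_apply spec_preim_def pull_sec_def Osec_def\<close>)
qed

lemma pull_sec_comp:
  assumes h: "ring_hom_cring R S h" and k: "ring_hom_cring S T k"
    and \<sigma>: "\<sigma> \<in> carrier (Osec R U)"
  shows "pull_sec S T k (spec_preim R S h U) (pull_sec R S h U \<sigma>) = pull_sec R T (k \<circ> h) U \<sigma>"
proof -
  interpret h: ring_hom_cring R S h by fact
  interpret k: ring_hom_cring S T k by fact
  have kh: "ring_hom_cring R T (k \<circ> h)"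
    using h.homh k.homh by (intro ring_hom_cringI2 h.R.is_cring k.S.is_cring ring_hom_trans)
  have hh: "h \<in> ring_hom R S" by (rule h.homh)
  note pre = spec_preim_comp[OF k hh]
  show ?thesis
  proof (rule extensionalityI[where A = "spec_preim R T (k \<circ> h) U"])
    show "pull_sec S T k (spec_preim R S h U) (pull_sec R S h U \<sigma>)
        \<in> extensional (spec_preim R T (k \<circ> h) U)"
      using pull_sec_extensional[of S T k "spec_preim R S h U"] pre by simp
    fix q assume q: "q \<in> spec_preim R T (k \<circ> h) U"
    then have qT: "q \<in> Spec T" and qU: "spec_map R (k \<circ> h) q \<in> U" by (auto simp: spec_preim_def)
    have qk: "spec_map S k q \<in> Spec S" by (rule spec_map_Spec[OF k qT])
    have qk': "spec_map S k q \<in> spec_preim R S h U"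
      using qk qU by (simp add: spec_preim_def spec_map_comp[OF hh])
    from Osec_germ[OF \<sigma> qU] obtain a s where a: "a \<in> carrier R" "s \<in> carrier R"
      "s \<notin> spec_map R (k \<circ> h) q" "\<sigma> (spec_map R (k \<circ> h) q) = germ R (spec_map R (k \<circ> h) q) a s" .
    have hs: "h s \<notin> spec_map S k q" using a(2,3) by (simp add: spec_map_def)
    have "pull_sec R T (k \<circ> h) U \<sigma> q = germ T q (k (h a)) (k (h s))"
      using germ_map_germ[OF kh qT a(1-3)] a(4) q by (simp add: pull_sec_apply)
    moreover have "germ_map S h (spec_map S k q) (\<sigma> (spec_map R (k \<circ> h) q))
        = germ S (spec_map S k q) (h a) (h s)"
      using germ_map_germ[OF h qk a(1,2)] a(3,4) by (simp add: spec_map_comp[OF hh])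
    ultimately show "pull_sec S T k (spec_preim R S h U) (pull_sec R S h U \<sigma>) q
        = pull_sec R T (k \<circ> h) U \<sigma> q"
      using q qk' a hs germ_map_germ[OF k qT _ _ hs, of "h a"]
      by (simp add: pull_sec_apply pre spec_map_comp[OF hh])
  qed (rule pull_sec_extensional)
qed

lemma pull_sec_cong:
  assumes "ring_hom_cring R S h" "ring_hom_cring R S h'" "\<sigma> \<in> carrier (Osec R U)"
    and eq: "\<And>a. a \<in> carrier R \<Longrightarrow> h a = h' a"
  shows "pull_sec R S h U \<sigma> = pull_sec R S h' U \<sigma>"
proof (rule extensionalityI[where A = "spec_preim R S h U"])
  note [simp] = spec_map_cong[of R h h', OF eq] spec_preim_cong[of R h h', OF eq]
  show "pull_sec R S h' U \<sigma> \<in> extensional (spec_preim R S h U)"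
    using pull_sec_extensional[of R S h'] by simp
  fix q assume q: "q \<in> spec_preim R S h U"
  then have q': "q \<in> Spec S" "spec_map R h' q \<in> U" "q \<in> spec_preim R S h' U"
    by (auto simp: spec_preim_def)
  from Osec_germ[OF assms(3) q'(2)] obtain a s where a: "a \<in> carrier R" "s \<in> carrier R"
    "s \<notin> spec_map R h' q" "\<sigma> (spec_map R h' q) = germ R (spec_map R h' q) a s" .
  show "pull_sec R S h U \<sigma> q = pull_sec R S h' U \<sigma> q"
    using a q q'(3) germ_map_germ[OF assms(1) q'(1) a(1,2)] germ_map_germ[OF assms(2) q'(1) a(1-3)]
    by (simp add: pull_sec_apply eq)
qed (rule pull_sec_extensional)

section \<open>Homomorphisms that are isomorphisms on stalks\<close>

text \<open>The homomorphism \<open>g\<close> becomes an isomorphism after localization at the prime \<open>q\<close> of \<open>B\<close>.\<close>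

definition stalk_iso ::
    "('b, 'm) ring_scheme \<Rightarrow> ('c, 'n) ring_scheme \<Rightarrow> ('b \<Rightarrow> 'c) \<Rightarrow> 'b set \<Rightarrow> bool" where
  "stalk_iso B C g q \<longleftrightarrow>
     (\<forall>c \<in> carrier C. \<exists>u \<in> carrier B - q. \<exists>b \<in> carrier B. g u \<otimes>\<^bsub>C\<^esub> c = g b) \<and>
     (\<forall>b \<in> carrier B. g b = \<zero>\<^bsub>C\<^esub> \<longrightarrow> (\<exists>u \<in> carrier B - q. u \<otimes>\<^bsub>B\<^esub> b = \<zero>\<^bsub>B\<^esub>))"

lemma stalk_iso_surjD:
  assumes "stalk_iso B C g q" "c \<in> carrier C"
  obtains u b where "u \<in> carrier B" "u \<notin> q" "b \<in> carrier B" "g u \<otimes>\<^bsub>C\<^esub> c = g b"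
  using assms unfolding stalk_iso_def by (meson Diff_iff)

lemma stalk_iso_injD:
  assumes "stalk_iso B C g q" "b \<in> carrier B" "g b = \<zero>\<^bsub>C\<^esub>"
  obtains u where "u \<in> carrier B" "u \<notin> q" "u \<otimes>\<^bsub>B\<^esub> b = \<zero>\<^bsub>B\<^esub>"
  using assms unfolding stalk_iso_def by (meson Diff_iff)

context
  fixes B :: "('b, 'm) ring_scheme" and C :: "('c, 'n) ring_scheme" and g
  assumes hom: "ring_hom_cring B C g"
begin

interpretation ring_hom_cring B C g by (rule hom)

lemma stalk_iso_eqD:
  assumes "stalk_iso B C g q" "a \<in> carrier B" "b \<in> carrier B" "g a = g b"
  obtains u where "u \<in> carrier B" "u \<notin> q" "u \<otimes>\<^bsub>B\<^esub> a = u \<otimes>\<^bsub>B\<^esub> b"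
proof -
  have "g (a \<ominus>\<^bsub>B\<^esub> b) = \<zero>\<^bsub>C\<^esub>" using assms by (simp add: R.minus_eq S.r_neg)
  then obtain u where u: "u \<in> carrier B" "u \<notin> q" "u \<otimes>\<^bsub>B\<^esub> (a \<ominus>\<^bsub>B\<^esub> b) = \<zero>\<^bsub>B\<^esub>"
    using stalk_iso_injD[OF assms(1)] assms(2,3) by (metis R.minus_closed)
  have "u \<otimes>\<^bsub>B\<^esub> a = u \<otimes>\<^bsub>B\<^esub> (a \<ominus>\<^bsub>B\<^esub> b) \<oplus>\<^bsub>B\<^esub> u \<otimes>\<^bsub>B\<^esub> b"
    using u(1) assms(2,3) by algebra
  then have "u \<otimes>\<^bsub>B\<^esub> a = u \<otimes>\<^bsub>B\<^esub> b" unfolding u(3) using u(1) assms(2,3) by simp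
  with u that show thesis by blast
qed

text \<open>\<open>g u\<close> lies outside the prime \<open>q\<close>, so there \<open>c\<close>
  and \<open>g b\<close> differ by a unit. This is how statements about elements of \<open>C\<close>
  relative to \<open>q\<close> are transported to \<open>B\<close> in all that follows.\<close>

lemma stalk_iso_mem_iff:
  assumes "q \<in> Spec C" "u \<in> carrier B" "u \<notin> spec_map B g q" "b \<in> carrier B"
    "c \<in> carrier C" "g u \<otimes>\<^bsub>C\<^esub> c = g b"
  shows "c \<in> q \<longleftrightarrow> b \<in> spec_map B g q"
proof -
  have "g u \<notin> q" using assms(2,3) by (simp add: spec_map_def)
  then show ?thesis
    using S.Spec_mult_iff[OF assms(1) _ assms(5), of "g u"] assms(2,4,6) by (simp add: spec_map_def)
qed

text \<open>By \<open>stalk_iso_mem_iff\<close>, whether \<open>c\<close> belongs to a prime can be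
  read off from the preimage of that prime in \<open>B\<close>.\<close>

lemma stalk_iso_spec_map_inj:
  assumes "stalk_iso B C g (spec_map B g q)" "q \<in> Spec C" "q' \<in> Spec C"
    and eq: "spec_map B g q = spec_map B g q'"
  shows "q = q'"
proof -
  have "c \<in> q \<longleftrightarrow> c \<in> q'" if c: "c \<in> carrier C" for c
  proof -
    from stalk_iso_surjD[OF assms(1) c] obtain u b
      where u: "u \<in> carrier B" "u \<notin> spec_map B g q" "b \<in> carrier B" "g u \<otimes>\<^bsub>C\<^esub> c = g b" .
    show ?thesis
      using stalk_iso_mem_iff[OF assms(2) u(1-3) c u(4)]
        stalk_iso_mem_iff[OF assms(3) u(1,2)[unfolded eq] u(3) c u(4)] eq by simp
  qed
  then show ?thesis using Spec_subset[OF assms(2)] Spec_subset[OF assms(3)] by blast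
qed

lemma stalk_iso_spec_map_surj:
  assumes iso: "stalk_iso B C g x" and x: "x \<in> Spec B"
  obtains q where "q \<in> Spec C" "spec_map B g q = x"
proof -
  \<comment> \<open>The prime generated by \<open>x\<close> in the localization, contracted to
    \<open>C\<close>: the elements that some \<open>u\<close> outside \<open>x\<close> moves into
    the image of \<open>x\<close>.\<close>
  define q where "q = {c \<in> carrier C. \<exists>u \<in> carrier B - x. \<exists>b \<in> x. g u \<otimes>\<^bsub>C\<^esub> c = g b}"
  have xB: "b \<in> carrier B" if "b \<in> x" for b using that Spec_subset[OF x] by auto
  note mult_iff = R.Spec_mult_iff[OF x]
  have qI: "c \<in> q" if "c \<in> carrier C" "u \<in> carrier B" "u \<notin> x" "b \<in> x" "g u \<otimes>\<^bsub>C\<^esub> c = g b" for c u b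
    unfolding q_def using that by blast
  \<comment> \<open>Membership in \<open>q\<close> can be tested with any relation for
    \<open>c\<close>, not only with the one that put \<open>c\<close> there: two relations for the
    same \<open>c\<close> are cross-multiplied, and the injectivity half of \<open>stalk_iso\<close>
    brings the resulting equation back to \<open>B\<close> at the cost of a factor \<open>w\<close>
    outside \<open>x\<close>.\<close>
  have qD: "b \<in> x" if "c \<in> q" "u \<in> carrier B" "u \<notin> x" "b \<in> carrier B" "g u \<otimes>\<^bsub>C\<^esub> c = g b" for c u b
  proof -
    have "c \<in> carrier C" "\<exists>u \<in> carrier B - x. \<exists>b \<in> x. g u \<otimes>\<^bsub>C\<^esub> c = g b"
      using that(1) unfolding q_def by simp_all
    then obtain v d where v: "v \<in> carrier B" "v \<notin> x" "d \<in> x" "g v \<otimes>\<^bsub>C\<^esub> c = g d" "c \<in> carrier C"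
      by (meson Diff_iff)
    have d: "d \<in> carrier B" by (rule xB[OF v(3)])
    have "g (v \<otimes>\<^bsub>B\<^esub> b) = g v \<otimes>\<^bsub>C\<^esub> (g u \<otimes>\<^bsub>C\<^esub> c)" using that v(1) by simp
    also have "\<dots> = g u \<otimes>\<^bsub>C\<^esub> (g v \<otimes>\<^bsub>C\<^esub> c)" using that(2) v(1,5) by (simp add: S.m_ac)
    also have "\<dots> = g (u \<otimes>\<^bsub>B\<^esub> d)" using v(4) d that(2) by simp
    finally have "g (v \<otimes>\<^bsub>B\<^esub> b) = g (u \<otimes>\<^bsub>B\<^esub> d)" .
    moreover have "v \<otimes>\<^bsub>B\<^esub> b \<in> carrier B" "u \<otimes>\<^bsub>B\<^esub> d \<in> carrier B"
      using that(2,4) v(1) d by simp_all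
    ultimately obtain w where w: "w \<in> carrier B" "w \<notin> x"
      "w \<otimes>\<^bsub>B\<^esub> (v \<otimes>\<^bsub>B\<^esub> b) = w \<otimes>\<^bsub>B\<^esub> (u \<otimes>\<^bsub>B\<^esub> d)" using stalk_iso_eqD[OF iso] by metis
    have "w \<otimes>\<^bsub>B\<^esub> (v \<otimes>\<^bsub>B\<^esub> b) \<in> x"
      unfolding w(3) using w(1) v(3) d that(2) by (simp add: mult_iff)
    then show ?thesis using w(1,2) v(1,2) that(4) by (simp add: mult_iff)
  qed
  have "q \<in> Spec C"
  proof (rule S.SpecI)
    show "q \<subseteq> carrier C" by (auto simp: q_def)
    show "\<zero>\<^bsub>C\<^esub> \<in> q"
      by (rule qI[of _ "\<one>\<^bsub>B\<^esub>" "\<zero>\<^bsub>B\<^esub>"]) (use R.Spec_one[OF x] R.Spec_zero[OF x] in auto)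
    show "\<one>\<^bsub>C\<^esub> \<notin> q"
      using qD[of "\<one>\<^bsub>C\<^esub>" "\<one>\<^bsub>B\<^esub>" "\<one>\<^bsub>B\<^esub>"] R.Spec_one[OF x] by auto
  next
    fix c d assume "c \<in> q" "d \<in> q"
    then obtain u b v b' where c: "c \<in> carrier C" "u \<in> carrier B" "u \<notin> x" "b \<in> x" "g u \<otimes>\<^bsub>C\<^esub> c = g b"
      and d: "d \<in> carrier C" "v \<in> carrier B" "v \<notin> x" "b' \<in> x" "g v \<otimes>\<^bsub>C\<^esub> d = g b'"
      unfolding q_def by auto
    note bb = xB[OF c(4)] xB[OF d(4)]
    have "g (u \<otimes>\<^bsub>B\<^esub> v) \<otimes>\<^bsub>C\<^esub> (c \<oplus>\<^bsub>C\<^esub> d) = g v \<otimes>\<^bsub>C\<^esub> (g u \<otimes>\<^bsub>C\<^esub> c) \<oplus>\<^bsub>C\<^esub> g u \<otimes>\<^bsub>C\<^esub> (g v \<otimes>\<^bsub>C\<^esub> d)"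
      using c(1,2) d(1,2) by (simp add: S.m_ac S.r_distr)
    also have "\<dots> = g (v \<otimes>\<^bsub>B\<^esub> b \<oplus>\<^bsub>B\<^esub> u \<otimes>\<^bsub>B\<^esub> b')" using c d bb by simp
    finally have "g (u \<otimes>\<^bsub>B\<^esub> v) \<otimes>\<^bsub>C\<^esub> (c \<oplus>\<^bsub>C\<^esub> d) = g (v \<otimes>\<^bsub>B\<^esub> b \<oplus>\<^bsub>B\<^esub> u \<otimes>\<^bsub>B\<^esub> b')" .
    moreover have "v \<otimes>\<^bsub>B\<^esub> b \<oplus>\<^bsub>B\<^esub> u \<otimes>\<^bsub>B\<^esub> b' \<in> x"
      using c d bb by (intro R.Spec_add[OF x]) (simp_all add: mult_iff)
    ultimately show "c \<oplus>\<^bsub>C\<^esub> d \<in> q"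
      by (intro qI[of _ "u \<otimes>\<^bsub>B\<^esub> v" "v \<otimes>\<^bsub>B\<^esub> b \<oplus>\<^bsub>B\<^esub> u \<otimes>\<^bsub>B\<^esub> b'"]) (use c d bb in \<open>simp_all add: mult_iff\<close>)
  next
    fix c d assume "c \<in> carrier C" "d \<in> q"
    then obtain v b' where d: "d \<in> carrier C" "v \<in> carrier B" "v \<notin> x" "b' \<in> x" "g v \<otimes>\<^bsub>C\<^esub> d = g b'"
      unfolding q_def by auto
    from stalk_iso_surjD[OF iso \<open>c \<in> carrier C\<close>] obtain u b
      where u: "u \<in> carrier B" "u \<notin> x" "b \<in> carrier B" "g u \<otimes>\<^bsub>C\<^esub> c = g b" .
    have "g (u \<otimes>\<^bsub>B\<^esub> v) \<otimes>\<^bsub>C\<^esub> (c \<otimes>\<^bsub>C\<^esub> d) = (g u \<otimes>\<^bsub>C\<^esub> c) \<otimes>\<^bsub>C\<^esub> (g v \<otimes>\<^bsub>C\<^esub> d)"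
      using d(1,2) u(1) \<open>c \<in> carrier C\<close> by (simp add: S.m_ac)
    also have "\<dots> = g (b \<otimes>\<^bsub>B\<^esub> b')" using d u xB[OF d(4)] by simp
    finally show "c \<otimes>\<^bsub>C\<^esub> d \<in> q"
      by (intro qI[of _ "u \<otimes>\<^bsub>B\<^esub> v" "b \<otimes>\<^bsub>B\<^esub> b'"])
        (use d u xB[OF d(4)] \<open>c \<in> carrier C\<close> in \<open>simp_all add: mult_iff\<close>)
  next
    fix c d assume c: "c \<in> carrier C" and d: "d \<in> carrier C" and cd: "c \<otimes>\<^bsub>C\<^esub> d \<in> q"
    from stalk_iso_surjD[OF iso c] obtain u b
      where u: "u \<in> carrier B" "u \<notin> x" "b \<in> carrier B" "g u \<otimes>\<^bsub>C\<^esub> c = g b" .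
    from stalk_iso_surjD[OF iso d] obtain v b'
      where v: "v \<in> carrier B" "v \<notin> x" "b' \<in> carrier B" "g v \<otimes>\<^bsub>C\<^esub> d = g b'" .
    have "g (u \<otimes>\<^bsub>B\<^esub> v) \<otimes>\<^bsub>C\<^esub> (c \<otimes>\<^bsub>C\<^esub> d) = (g u \<otimes>\<^bsub>C\<^esub> c) \<otimes>\<^bsub>C\<^esub> (g v \<otimes>\<^bsub>C\<^esub> d)"
      using c d u(1) v(1) by (simp add: S.m_ac)
    also have "\<dots> = g (b \<otimes>\<^bsub>B\<^esub> b')" using u v by simp
    finally have "b \<otimes>\<^bsub>B\<^esub> b' \<in> x" by (intro qD[OF cd, of "u \<otimes>\<^bsub>B\<^esub> v"]) (use u v in \<open>auto simp: mult_iff\<close>)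
    then have "b \<in> x \<or> b' \<in> x" using u v by (simp add: mult_iff)
    then show "c \<in> q \<or> d \<in> q" using qI[OF c u(1,2) _ u(4)] qI[OF d v(1,2) _ v(4)] by blast
  qed
  moreover have "spec_map B g q = x"
  proof -
    have "b \<in> x \<longleftrightarrow> g b \<in> q" if b: "b \<in> carrier B" for b
      using qI[of "g b" "\<one>\<^bsub>B\<^esub>" b] qD[of "g b" "\<one>\<^bsub>B\<^esub>" b] b R.Spec_one[OF x] by auto
    then show ?thesis using xB by (auto simp: spec_map_def)
  qed
  ultimately show thesis by (rule that)
qed

lemma stalk_iso_germ_inj:
  assumes iso: "stalk_iso B C g x" and x: "x = spec_map B g q" and q: "q \<in> Spec C"
    and a: "a \<in> carrier B" "s \<in> carrier B" "s \<notin> x"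
    and b: "b \<in> carrier B" "t \<in> carrier B" "t \<notin> x"
    and eq: "germ C q (g a) (g s) = germ C q (g b) (g t)"
  shows "germ B x a s = germ B x b t"
proof -
  have xB: "x \<in> Spec B" using spec_map_Spec[OF hom q] x by simp
  have "g s \<notin> q" "g t \<notin> q" using a b x by (auto simp: spec_map_def)
  with eq a b obtain c where c: "c \<in> carrier C" "c \<notin> q"
    "c \<otimes>\<^bsub>C\<^esub> (g a \<otimes>\<^bsub>C\<^esub> g t) = c \<otimes>\<^bsub>C\<^esub> (g b \<otimes>\<^bsub>C\<^esub> g s)"
    using S.germ_eq_iff[OF q, of "g a" "g s" "g b" "g t"] by auto
  from stalk_iso_surjD[OF iso c(1)] obtain u d
    where u: "u \<in> carrier B" "u \<notin> x" "d \<in> carrier B" "g u \<otimes>\<^bsub>C\<^esub> c = g d" .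
  \<comment> \<open>The multiplier \<open>c\<close> lives in \<open>C\<close>. Clearing its
    denominator \<open>u\<close> replaces it by the image of \<open>d\<close>, still outside the
    prime; a further multiplier \<open>v\<close> then lifts the equation from \<open>C\<close> to
    \<open>B\<close>.\<close>
  have d: "d \<notin> x" using stalk_iso_mem_iff[OF q u(1) _ u(3) c(1) u(4)] u(2) c(2) x by simp
  have "g (d \<otimes>\<^bsub>B\<^esub> (a \<otimes>\<^bsub>B\<^esub> t)) = g u \<otimes>\<^bsub>C\<^esub> (c \<otimes>\<^bsub>C\<^esub> (g a \<otimes>\<^bsub>C\<^esub> g t))"
    using a(1,2) b(1,2) u(1,3) u(4)[symmetric] c(1) by (simp add: S.m_ac)
  also have "\<dots> = g (d \<otimes>\<^bsub>B\<^esub> (b \<otimes>\<^bsub>B\<^esub> s))"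
    unfolding c(3) using a(1,2) b(1,2) u(1,3) u(4)[symmetric] c(1) by (simp add: S.m_ac)
  finally obtain v where v: "v \<in> carrier B" "v \<notin> x"
    "v \<otimes>\<^bsub>B\<^esub> (d \<otimes>\<^bsub>B\<^esub> (a \<otimes>\<^bsub>B\<^esub> t)) = v \<otimes>\<^bsub>B\<^esub> (d \<otimes>\<^bsub>B\<^esub> (b \<otimes>\<^bsub>B\<^esub> s))"
    using stalk_iso_eqD[OF iso] a b u(3) by (metis R.m_closed)
  have "v \<otimes>\<^bsub>B\<^esub> d \<in> carrier B - x" using v u(3) d R.Spec_mult_iff[OF xB] by auto
  moreover have "(v \<otimes>\<^bsub>B\<^esub> d) \<otimes>\<^bsub>B\<^esub> (a \<otimes>\<^bsub>B\<^esub> t) = (v \<otimes>\<^bsub>B\<^esub> d) \<otimes>\<^bsub>B\<^esub> (b \<otimes>\<^bsub>B\<^esub> s)"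
    using v(1,3) u(3) a b by (simp add: R.m_assoc)
  ultimately show ?thesis using R.germ_eq_iff[OF xB a b] by blast
qed

text \<open>Near \<open>q\<close> a section of \<open>C\<close> is described by three elements: a
  numerator, a denominator and an \<open>e\<close> that cuts out the neighbourhood. Moving these
  finitely many elements to \<open>B\<close> needs \<open>stalk_iso\<close> at one prime only, and
  yields one fraction over \<open>B\<close> that is valid above a whole open subset of
  \<open>Spec B\<close>.\<close>

lemma stalk_iso_section_local:
  assumes W: "zopen B W" and \<tau>: "\<tau> \<in> carrier (Osec C (spec_preim B C g W))"
    and q: "q \<in> spec_preim B C g W" and iso: "stalk_iso B C g (spec_map B g q)"
  shows "\<exists>V a r. zopen B V \<and> spec_map B g q \<in> V \<and> V \<subseteq> W \<and> a \<in> carrier B \<and> r \<in> carrier B \<and>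
    (\<forall>y\<in>Spec C. spec_map B g y \<in> V \<longrightarrow> r \<notin> spec_map B g y \<and> \<tau> y = germ C y (g a) (g r))"
proof -
  have qC: "q \<in> Spec C" and qW: "spec_map B g q \<in> W" using q by (auto simp: spec_preim_def)
  let ?x = "spec_map B g q"
  have xB: "?x \<in> Spec B" by (rule spec_map_Spec[OF hom qC])
  from Osec_local[OF \<tau> q] obtain V c s where V: "zopen C V" "q \<in> V" "c \<in> carrier C" "s \<in> carrier C"
    "\<And>y. y \<in> V \<Longrightarrow> s \<notin> y" "\<And>y. y \<in> V \<Longrightarrow> \<tau> y = germ C y c s" by metis
  from zopen_contains_basic[OF V(1,2)] obtain e where e: "e \<in> carrier C" "e \<notin> q"
    "{y \<in> Spec C. e \<notin> y} \<subseteq> V" .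
  from stalk_iso_surjD[OF iso e(1)] obtain u0 e'
    where u0: "u0 \<in> carrier B" "u0 \<notin> ?x" "e' \<in> carrier B" "g u0 \<otimes>\<^bsub>C\<^esub> e = g e'" .
  from stalk_iso_surjD[OF iso V(3)] obtain u b
    where u: "u \<in> carrier B" "u \<notin> ?x" "b \<in> carrier B" "g u \<otimes>\<^bsub>C\<^esub> c = g b" .
  from stalk_iso_surjD[OF iso V(4)] obtain v s'
    where v: "v \<in> carrier B" "v \<notin> ?x" "s' \<in> carrier B" "g v \<otimes>\<^bsub>C\<^esub> s = g s'" .
  have e': "e' \<notin> ?x" using stalk_iso_mem_iff[OF qC u0(1-3) e(1) u0(4)] e(2) by simp
  \<comment> \<open>Above this set \<open>e\<close> is outside the prime, so the given fraction is
    valid, and the factors \<open>u\<close> and \<open>v\<close> used for numerator and denominator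
    are outside the prime as well.\<close>
  let ?V = "{y \<in> Spec B. e' \<otimes>\<^bsub>B\<^esub> (u \<otimes>\<^bsub>B\<^esub> v) \<notin> y} \<inter> W"
  have "v \<otimes>\<^bsub>B\<^esub> b \<in> carrier B" "u \<otimes>\<^bsub>B\<^esub> s' \<in> carrier B" using u v by simp_all
  moreover have "zopen B ?V" using u0 u v W by (intro R.zopen_Int zopen_basic) simp_all
  moreover have "?x \<in> ?V" using u u0 v e' xB qW R.Spec_mult_iff[OF xB] by simp
  moreover have "u \<otimes>\<^bsub>B\<^esub> s' \<notin> spec_map B g y \<and> \<tau> y = germ C y (g (v \<otimes>\<^bsub>B\<^esub> b)) (g (u \<otimes>\<^bsub>B\<^esub> s'))"
    if y: "y \<in> Spec C" and yV: "spec_map B g y \<in> ?V" for y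
  proof -
    have yB: "spec_map B g y \<in> Spec B" using yV by simp
    have y': "e' \<notin> spec_map B g y" "u \<notin> spec_map B g y" "v \<notin> spec_map B g y"
      using yV u0 u v R.Spec_mult_iff[OF yB] by auto
    then have "g u0 \<otimes>\<^bsub>C\<^esub> e \<notin> y" using u0 by (simp add: spec_map_def)
    then have "e \<notin> y" using S.Spec_mult_iff[OF y] u0(1) e(1) by simp
    then have "y \<in> V" using e(3) y by blast
    then have s: "s \<notin> y" and \<tau>y: "\<tau> y = germ C y c s" using V(5,6) by auto
    have s': "s' \<notin> spec_map B g y" using stalk_iso_mem_iff[OF y v(1) y'(3) v(3) V(4) v(4)] s by simp
    have us': "u \<otimes>\<^bsub>B\<^esub> s' \<notin> spec_map B g y" using R.Spec_mult_iff[OF yB] u v s' y' by simp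
    \<comment> \<open>Formally c / s = (b / u) / (s' / v) = v b / (u s').\<close>
    have "c \<otimes>\<^bsub>C\<^esub> g (u \<otimes>\<^bsub>B\<^esub> s') = (g u \<otimes>\<^bsub>C\<^esub> c) \<otimes>\<^bsub>C\<^esub> (g v \<otimes>\<^bsub>C\<^esub> s)"
      using u(1) v V(3,4) by (simp add: S.m_ac)
    also have "\<dots> = g (v \<otimes>\<^bsub>B\<^esub> b) \<otimes>\<^bsub>C\<^esub> s"
      unfolding u(4) using u(3) v(1) V(4) by (simp add: S.m_ac)
    finally have "germ C y c s = germ C y (g (v \<otimes>\<^bsub>B\<^esub> b)) (g (u \<otimes>\<^bsub>B\<^esub> s'))"
      using us' u(1,3) v(1,3) V(3,4) s by (intro S.germ_eqI[OF y]) (auto simp: spec_map_def)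
    then show ?thesis using us' \<tau>y by simp
  qed
  ultimately show ?thesis
    by (intro exI[of _ ?V] exI[of _ "v \<otimes>\<^bsub>B\<^esub> b"] exI[of _ "u \<otimes>\<^bsub>B\<^esub> s'"]) blast
qed

text \<open>Exactly one prime of \<open>C\<close> lies over each point of \<open>W\<close>, and the
  stalks there agree, so values of sections correspond. That the section recovered on
  \<open>W\<close> is again locally a fraction is \<open>stalk_iso_section_local\<close>.\<close>

proposition pull_sec_bij:
  assumes W: "zopen B W" and iso: "\<And>x. x \<in> W \<Longrightarrow> stalk_iso B C g x"
  shows "bij_betw (pull_sec B C g W) (carrier (Osec B W)) (carrier (Osec C (spec_preim B C g W)))"
proof (rule bij_betw_imageI)
  have W_Spec: "x \<in> Spec B" if "x \<in> W" for x using that zopen_subset[OF W] by blast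
  show "inj_on (pull_sec B C g W) (carrier (Osec B W))"
  proof (rule inj_onI)
    fix \<sigma> \<sigma>' assume \<sigma>: "\<sigma> \<in> carrier (Osec B W)" and \<sigma>': "\<sigma>' \<in> carrier (Osec B W)"
      and eq: "pull_sec B C g W \<sigma> = pull_sec B C g W \<sigma>'"
    show "\<sigma> = \<sigma>'"
    proof (rule extensionalityI[OF Osec_extensional[OF \<sigma>] Osec_extensional[OF \<sigma>']])
      fix x assume x: "x \<in> W"
      from stalk_iso_spec_map_surj[OF iso[OF x] W_Spec[OF x]] obtain q
        where q: "q \<in> Spec C" "spec_map B g q = x" .
      from Osec_germ[OF \<sigma> x] obtain a s where a: "a \<in> carrier B" "s \<in> carrier B" "s \<notin> x"
        "\<sigma> x = germ B x a s" .
      from Osec_germ[OF \<sigma>' x] obtain b t where b: "b \<in> carrier B" "t \<in> carrier B" "t \<notin> x"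
        "\<sigma>' x = germ B x b t" .
      have "q \<in> spec_preim B C g W" using q x by (simp add: spec_preim_def)
      then have "germ_map C g q (\<sigma> x) = germ_map C g q (\<sigma>' x)"
        using fun_cong[OF eq, of q] q(2) by (simp add: pull_sec_apply)
      then have "germ C q (g a) (g s) = germ C q (g b) (g t)"
        using germ_map_germ[OF hom q(1)] q(2) a b by simp
      then show "\<sigma> x = \<sigma>' x"
        unfolding a(4) b(4) by (rule stalk_iso_germ_inj[OF iso[OF x] q(2)[symmetric] q(1) a(1-3) b(1-3)])
    qed
  qed
  show "pull_sec B C g W ` carrier (Osec B W) = carrier (Osec C (spec_preim B C g W))"
  proof
    show "pull_sec B C g W ` carrier (Osec B W) \<subseteq> carrier (Osec C (spec_preim B C g W))"
      using pull_sec_closed[OF hom] by blast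
    show "carrier (Osec C (spec_preim B C g W)) \<subseteq> pull_sec B C g W ` carrier (Osec B W)"
    proof
      fix \<tau> assume \<tau>: "\<tau> \<in> carrier (Osec C (spec_preim B C g W))"
      define R where "R q z \<longleftrightarrow> (\<exists>a\<in>carrier B. \<exists>r\<in>carrier B - spec_map B g q.
        z = germ B (spec_map B g q) a r \<and> \<tau> q = germ C q (g a) (g r))" for q z
      \<comment> \<open>The value at \<open>x\<close> is the germ whose image is the value of
        \<open>\<tau>\<close> at the prime over \<open>x\<close>. The choice is forced: the prime is
        unique by \<open>stalk_iso_spec_map_inj\<close>, the germ by
        \<open>stalk_iso_germ_inj\<close>.\<close>
      define \<sigma> where "\<sigma> = (\<lambda>x\<in>W. SOME z. \<exists>q\<in>Spec C. spec_map B g q = x \<and> R q z)"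
      have \<sigma>_eq: "\<sigma> (spec_map B g q) = germ B (spec_map B g q) a r"
        if "q \<in> Spec C" "spec_map B g q \<in> W" "a \<in> carrier B" "r \<in> carrier B"
          "r \<notin> spec_map B g q" "\<tau> q = germ C q (g a) (g r)" for q a r
      proof -
        have "R q (germ B (spec_map B g q) a r)" using that unfolding R_def by blast
        moreover have "z = germ B (spec_map B g q) a r"
          if z: "\<exists>q'\<in>Spec C. spec_map B g q' = spec_map B g q \<and> R q' z" for z
        proof -
          obtain q' where q': "q' \<in> Spec C" "spec_map B g q' = spec_map B g q" "R q' z"
            using z by auto
          have "q' = q"
            using stalk_iso_spec_map_inj[OF iso] q' \<open>q \<in> Spec C\<close> \<open>spec_map B g q \<in> W\<close> by metis
          then obtain b t where "b \<in> carrier B" "t \<in> carrier B" "t \<notin> spec_map B g q"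
            "z = germ B (spec_map B g q) b t" "\<tau> q = germ C q (g b) (g t)"
            using q'(3) unfolding R_def by auto
          then show ?thesis
            using stalk_iso_germ_inj[OF iso refl] \<open>q \<in> Spec C\<close> \<open>spec_map B g q \<in> W\<close>
              \<open>a \<in> carrier B\<close> \<open>r \<in> carrier B\<close> \<open>r \<notin> spec_map B g q\<close> \<open>\<tau> q = germ C q (g a) (g r)\<close>
            by metis
        qed
        ultimately show ?thesis
          unfolding \<sigma>_def restrict_apply' [OF that(2)] using that(1)
          by (intro some_equality) blast+
      qed
      have "\<sigma> \<in> carrier (Osec B W)"
      proof (rule OsecI)
        show "\<sigma> \<in> extensional W" by (simp add: \<sigma>_def)
        fix x assume x: "x \<in> W"
        from stalk_iso_spec_map_surj[OF iso[OF x] W_Spec[OF x]] obtain q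
          where q: "q \<in> Spec C" "spec_map B g q = x" .
        then have "q \<in> spec_preim B C g W" using x by (simp add: spec_preim_def)
        then obtain V a r where V: "zopen B V" "x \<in> V" "V \<subseteq> W" "a \<in> carrier B" "r \<in> carrier B"
          "\<forall>y\<in>Spec C. spec_map B g y \<in> V \<longrightarrow> r \<notin> spec_map B g y \<and> \<tau> y = germ C y (g a) (g r)"
          using stalk_iso_section_local[OF W \<tau>, of q] iso[OF x] q(2) by auto
        have "r \<notin> x' \<and> \<sigma> x' = germ B x' a r" if x': "x' \<in> V" for x'
        proof -
          have W': "x' \<in> W" using x' V(3) by auto
          from stalk_iso_spec_map_surj[OF iso[OF W'] W_Spec[OF W']] obtain q'
            where q': "q' \<in> Spec C" "spec_map B g q' = x'" .
          then show ?thesis using \<sigma>_eq[of q' a r] V x' W' by auto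
        qed
        with V(1-5) show "\<exists>V a s. zopen B V \<and> x \<in> V \<and> V \<subseteq> W \<and> a \<in> carrier B \<and> s \<in> carrier B \<and>
            (\<forall>q\<in>V. s \<notin> q \<and> \<sigma> q = germ B q a s)" by metis
      qed
      moreover have "pull_sec B C g W \<sigma> = \<tau>"
      proof (rule extensionalityI[OF pull_sec_extensional Osec_extensional[OF \<tau>]])
        fix q assume q: "q \<in> spec_preim B C g W"
        then have q': "q \<in> Spec C" "spec_map B g q \<in> W" by (auto simp: spec_preim_def)
        obtain a r where a: "a \<in> carrier B" "r \<in> carrier B" "r \<notin> spec_map B g q"
          "\<tau> q = germ C q (g a) (g r)"
          using stalk_iso_section_local[OF W \<tau> q iso[OF q'(2)]] q'(1) by metis
        show "pull_sec B C g W \<sigma> q = \<tau> q"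
          using q \<sigma>_eq[OF q' a] germ_map_germ[OF hom q'(1) a(1-3)] a(4) by (simp add: pull_sec_apply)
      qed
      ultimately show "\<tau> \<in> pull_sec B C g W ` carrier (Osec B W)" by (metis imageI)
    qed
  qed
qed

end

section \<open>Isomorphism of equivariant pushforwards\<close>

text \<open>The isomorphism has to lead from the pushforward from \<open>Spec C\<close> (for Q) to
  that from \<open>Spec B\<close> (for the fibre product), against the natural direction of
  pullback; hence the inverse.\<close>

definition push_iso where
  "push_iso A B C f g U =
     inv_into (carrier (Osec B (spec_preim A B f U))) (pull_sec B C g (spec_preim A B f U))"

lemma ring_hom_cring_cong:
  assumes "ring_hom_cring R S h" "\<And>a. a \<in> carrier R \<Longrightarrow> h' a = h a"
  shows "ring_hom_cring R S h'"
proof -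
  interpret ring_hom_cring R S h by fact
  show ?thesis
    by (intro ring_hom_cringI2 R.is_cring S.is_cring ring_hom_memI)
      (use assms(2) in simp_all)
qed

lemma pushforward_simps:
  shows "carrier (sec (pushforward A C h) U) = carrier (Osec C (spec_preim A C h U))"
    and "x \<oplus>\<^bsub>sec (pushforward A C h) U\<^esub> y = x \<oplus>\<^bsub>Osec C (spec_preim A C h U)\<^esub> y"
    and "\<sigma> \<odot>\<^bsub>sec (pushforward A C h) U\<^esub> x = pull_sec A C h U \<sigma> \<otimes>\<^bsub>Osec C (spec_preim A C h U)\<^esub> x"
    and "res (pushforward A C h) U V x = restrict x (spec_preim A C h V)"
  by (simp_all add: pushforward_def Let_def)

text \<open>A map \<open>Spec C\<close> to \<open>Spec B\<close> over \<open>Spec A\<close>, to be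
  shown an isomorphism above an open part of \<open>Spec A\<close>. The identity
  \<open>h a = g (f a)\<close> is demanded on the carrier only, because \<open>quot_map\<close> is
  controlled only on cosets of ring elements while \<open>comap\<close> makes sense for every
  function.\<close>

locale affine_triangle =
  fixes A :: "'a ring" and B :: "('b, 'm) ring_scheme" and C :: "('c, 'n) ring_scheme" and f g h
  assumes f: "ring_hom_cring A B f" and g: "ring_hom_cring B C g"
    and h: "\<And>a. a \<in> carrier A \<Longrightarrow> h a = g (f a)"
begin

sublocale f: ring_hom_cring A B f by (rule f)
sublocale g: ring_hom_cring B C g by (rule g)

lemma gf: "ring_hom_cring A C (g \<circ> f)"
  using f.homh g.homh by (intro ring_hom_cringI2 f.R.is_cring g.S.is_cring ring_hom_trans)

lemma hh: "ring_hom_cring A C h"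
  by (rule ring_hom_cring_cong[OF gf]) (simp add: h)

lemma preim_h: "spec_preim A C h U = spec_preim B C g (spec_preim A B f U)"
  by (simp add: spec_preim_comp[OF g f.homh] spec_preim_cong[of A "g \<circ> f" h] h)

lemma pull_h: "\<sigma> \<in> carrier (Osec A U) \<Longrightarrow>
    pull_sec A C h U \<sigma> = pull_sec B C g (spec_preim A B f U) (pull_sec A B f U \<sigma>)"
  by (simp add: pull_sec_comp[OF f g] pull_sec_cong[OF hh gf] h)

lemma push_iso_bij:
  assumes "zopen A U" "\<And>x. x \<in> spec_preim A B f U \<Longrightarrow> stalk_iso B C g x"
  shows "bij_betw (pull_sec B C g (spec_preim A B f U))
    (carrier (Osec B (spec_preim A B f U))) (carrier (Osec C (spec_preim A C h U)))"
  unfolding preim_h by (rule pull_sec_bij[OF g zopen_spec_preim[OF f assms(1)] assms(2)])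

lemma push_iso_pull_sec:
  assumes "zopen A U" "\<And>x. x \<in> spec_preim A B f U \<Longrightarrow> stalk_iso B C g x"
    and "y \<in> carrier (Osec B (spec_preim A B f U))"
  shows "push_iso A B C f g U (pull_sec B C g (spec_preim A B f U) y) = y"
  unfolding push_iso_def
  using push_iso_bij[OF assms(1,2)] assms(3) by (simp add: bij_betw_def)

lemma push_iso_surj:
  assumes "zopen A U" "\<And>x. x \<in> spec_preim A B f U \<Longrightarrow> stalk_iso B C g x"
    and "x \<in> carrier (Osec C (spec_preim A C h U))"
  obtains y where "y \<in> carrier (Osec B (spec_preim A B f U))"
    "x = pull_sec B C g (spec_preim A B f U) y"
  using push_iso_bij[OF assms(1,2)] assms(3) by (auto simp: bij_betw_def)

lemma push_iso_msheaf_iso: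
  assumes T: "\<And>U. U \<in> T \<Longrightarrow> zopen A U"
    and iso: "\<And>U x. U \<in> T \<Longrightarrow> x \<in> spec_preim A B f U \<Longrightarrow> stalk_iso B C g x"
  shows "msheaf_iso T (Osec A) (pushforward A C h) (pushforward A B f) (push_iso A B C f g)"
  unfolding msheaf_iso_def pushforward_simps
proof (intro conjI ballI impI)
  fix U assume U: "U \<in> T"
  let ?W = "spec_preim A B f U"
  show "bij_betw (push_iso A B C f g U) (carrier (Osec C (spec_preim A C h U))) (carrier (Osec B ?W))"
    unfolding push_iso_def using push_iso_bij[OF T[OF U] iso[OF U]] by (rule bij_betw_inv_into)
  note inv = push_iso_pull_sec[OF T[OF U] iso[OF U]]
  note surj = push_iso_surj[OF T[OF U] iso[OF U]]
  {
    fix x y assume "x \<in> carrier (Osec C (spec_preim A C h U))" "y \<in> carrier (Osec C (spec_preim A C h U))"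
    then obtain x' y' where x': "x' \<in> carrier (Osec B ?W)" "x = pull_sec B C g ?W x'"
      and y': "y' \<in> carrier (Osec B ?W)" "y = pull_sec B C g ?W y'"
      using surj by metis
    show "push_iso A B C f g U (x \<oplus>\<^bsub>Osec C (spec_preim A C h U)\<^esub> y)
        = push_iso A B C f g U x \<oplus>\<^bsub>Osec B ?W\<^esub> push_iso A B C f g U y"
      unfolding preim_h x'(2) y'(2) pull_sec_add[OF g x'(1) y'(1), symmetric]
      using x'(1) y'(1) by (simp add: inv f.S.Osec_add_closed)
  next
    fix a x assume a: "a \<in> carrier (Osec A U)" and "x \<in> carrier (Osec C (spec_preim A C h U))"
    then obtain x' where x': "x' \<in> carrier (Osec B ?W)" "x = pull_sec B C g ?W x'"
      using surj by metis
    have a': "pull_sec A B f U a \<in> carrier (Osec B ?W)" by (rule pull_sec_closed[OF f a])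
    show "push_iso A B C f g U (pull_sec A C h U a \<otimes>\<^bsub>Osec C (spec_preim A C h U)\<^esub> x)
        = pull_sec A B f U a \<otimes>\<^bsub>Osec B ?W\<^esub> push_iso A B C f g U x"
      unfolding preim_h x'(2) pull_h[OF a] pull_sec_mult[OF g a' x'(1), symmetric]
      using x'(1) a' by (simp add: inv f.S.Osec_mult_closed)
  next
    fix V x assume V: "V \<in> T" "V \<subseteq> U" and "x \<in> carrier (Osec C (spec_preim A C h U))"
    then obtain x' where x': "x' \<in> carrier (Osec B ?W)" "x = pull_sec B C g ?W x'"
      using surj by metis
    let ?W' = "spec_preim A B f V"
    have sub: "?W' \<subseteq> ?W" by (rule spec_preim_mono[OF V(2)])
    have r: "restrict x' ?W' \<in> carrier (Osec B ?W')"
      by (rule f.S.Osec_restrict[OF x'(1) zopen_spec_preim[OF f T[OF V(1)]] sub])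
    have "restrict (pull_sec B C g ?W x') (spec_preim B C g ?W') = pull_sec B C g ?W' (restrict x' ?W')"
      using spec_preim_mono[OF sub, of B C g]
      by (auto simp: fun_eq_iff pull_sec_def spec_preim_def restrict_def)
    then show "push_iso A B C f g V (restrict x (spec_preim A C h V))
        = restrict (push_iso A B C f g U x) ?W'"
      unfolding preim_h x'(2) using x'(1) r by (simp add: inv push_iso_pull_sec[OF T[OF V(1)] iso[OF V(1)]])
  }
qed

end

text \<open>The homomorphisms \<open>m : A \<rightarrow> A1\<close>, \<open>mB : B \<rightarrow> B1\<close>, \<open>mC : C \<rightarrow> C1\<close> stand for the projection
  and for the action.\<close>

lemma push_iso_natural:
  fixes A :: "'a ring" and A1 :: "'a1 ring"
    and B :: "('b, 'm) ring_scheme" and B1 :: "('b1, 'm1) ring_scheme"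
    and C :: "('c, 'n) ring_scheme" and C1 :: "('c1, 'n1) ring_scheme"
  assumes tri: "affine_triangle A B C f g h" and tri1: "affine_triangle A1 B1 C1 f1 g1 h1"
    and m: "ring_hom_cring A A1 m" and mB: "ring_hom_cring B B1 mB" and mC: "ring_hom_cring C C1 mC"
    and fm: "\<And>a. a \<in> carrier A \<Longrightarrow> f1 (m a) = mB (f a)"
    and gm: "\<And>b. b \<in> carrier B \<Longrightarrow> g1 (mB b) = mC (g b)"
    and U: "zopen A U" and iso: "\<And>x. x \<in> spec_preim A B f U \<Longrightarrow> stalk_iso B C g x"
    and iso1: "\<And>x. x \<in> spec_preim A1 B1 f1 (spec_preim A A1 m U) \<Longrightarrow> stalk_iso B1 C1 g1 x"
    and x: "x \<in> carrier (Osec C (spec_preim A C h U))"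
  shows "push_iso A1 B1 C1 f1 g1 (spec_preim A A1 m U) (pull_sec C C1 mC (spec_preim A C h U) x)
    = pull_sec B B1 mB (spec_preim A B f U) (push_iso A B C f g U x)"
proof -
  interpret t: affine_triangle A B C f g h by fact
  interpret t1: affine_triangle A1 B1 C1 f1 g1 h1 by fact
  interpret m: ring_hom_cring A A1 m by fact
  interpret mB: ring_hom_cring B B1 mB by fact
  interpret mC: ring_hom_cring C C1 mC by fact
  let ?W = "spec_preim A B f U"
  have W1: "spec_preim B B1 mB ?W = spec_preim A1 B1 f1 (spec_preim A A1 m U)"
    by (simp add: spec_preim_comp[OF mB t.f.homh] spec_preim_comp[OF t1.f m.homh])
      (rule spec_preim_cong, simp add: fm)
  from t.push_iso_surj[OF U iso x] obtain y
    where y: "y \<in> carrier (Osec B ?W)" "x = pull_sec B C g ?W y" .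
  have y1: "pull_sec B B1 mB ?W y \<in> carrier (Osec B1 (spec_preim A1 B1 f1 (spec_preim A A1 m U)))"
    using pull_sec_closed[OF mB y(1)] W1 by simp
  have hom1: "ring_hom_cring B C1 (mC \<circ> g)"
    using t.g.homh mC.homh by (intro ring_hom_cringI2 t.f.S.is_cring t1.g.S.is_cring ring_hom_trans)
  have hom2: "ring_hom_cring B C1 (g1 \<circ> mB)"
    using mB.homh t1.g.homh by (intro ring_hom_cringI2 t.f.S.is_cring t1.g.S.is_cring ring_hom_trans)
  \<comment> \<open>With \<open>x\<close> written as the pullback of \<open>y\<close> along
    \<open>g\<close>, the commuting square for \<open>g\<close> and \<open>g1\<close> shows that the
    pullback of \<open>x\<close> comes along \<open>g1\<close> from the pullback of
    \<open>y\<close>. Inverting on both sides gives the claim.\<close>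
  have "pull_sec C C1 mC (spec_preim A C h U) x = pull_sec B C1 (mC \<circ> g) ?W y"
    unfolding y(2) t.preim_h by (rule pull_sec_comp[OF t.g mC y(1)])
  also have "\<dots> = pull_sec B C1 (g1 \<circ> mB) ?W y"
    by (rule pull_sec_cong[OF hom1 hom2 y(1)]) (simp add: gm)
  also have "\<dots> = pull_sec B1 C1 g1 (spec_preim B B1 mB ?W) (pull_sec B B1 mB ?W y)"
    by (rule pull_sec_comp[OF mB t1.g y(1), symmetric])
  finally have "pull_sec C C1 mC (spec_preim A C h U) x
      = pull_sec B1 C1 g1 (spec_preim A1 B1 f1 (spec_preim A A1 m U)) (pull_sec B B1 mB ?W y)"
    unfolding W1 .
  then show ?thesis
    using t1.push_iso_pull_sec[OF zopen_spec_preim[OF m U] iso1 y1]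
      t.push_iso_pull_sec[OF U iso y(1)] y(2) by simp
qed

text \<open>Compatibility with \<open>via_act\<close> evaluates the level-one isomorphism on
  preimages under the action. Since \<open>action_gpd\<close> does not record that the locus is
  stable, stalk isomorphisms above its preimage under \<open>act\<close> are a separate hypothesis,
  \<open>iso_ac\<close>.\<close>

proposition equivariant_pushforward_isomorphic:
  fixes \<Gamma> :: "('a, 'a1) action_gpd"
  defines "A \<equiv> base \<Gamma>" and "A1 \<equiv> total \<Gamma>"
  assumes tri: "affine_triangle A B C f g h" and tri1: "affine_triangle A1 B1 C1 f1 g1 h1"
    and pr: "ring_hom_cring A A1 (proj \<Gamma>)" "ring_hom_cring B B1 prB" "ring_hom_cring C C1 prC"
      "\<And>a. a \<in> carrier A \<Longrightarrow> f1 (proj \<Gamma> a) = prB (f a)"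
      "\<And>b. b \<in> carrier B \<Longrightarrow> g1 (prB b) = prC (g b)"
    and ac: "ring_hom_cring A A1 (act \<Gamma>)" "ring_hom_cring B B1 acB" "ring_hom_cring C C1 acC"
      "\<And>a. a \<in> carrier A \<Longrightarrow> f1 (act \<Gamma> a) = acB (f a)"
      "\<And>b. b \<in> carrier B \<Longrightarrow> g1 (acB b) = acC (g b)"
    and iso: "\<And>x. x \<in> spec_preim A B f (locus \<Gamma>) \<Longrightarrow> stalk_iso B C g x"
    and iso_pr: "\<And>x. x \<in> spec_preim A1 B1 f1 (spec_preim A A1 (proj \<Gamma>) (locus \<Gamma>)) \<Longrightarrow>
      stalk_iso B1 C1 g1 x"
    and iso_ac: "\<And>x. x \<in> spec_preim A1 B1 f1 (spec_preim A A1 (act \<Gamma>) (locus \<Gamma>)) \<Longrightarrow>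
      stalk_iso B1 C1 g1 x"
  shows "stack_sheaf_isomorphic \<Gamma>
    (equivariant_pushforward \<Gamma> C C1 h h1 prC acC) (equivariant_pushforward \<Gamma> B B1 f f1 prB acB)"
proof -
  have sub: "y \<in> spec_preim A1 B1 f1 (spec_preim A A1 k U)
      \<Longrightarrow> y \<in> spec_preim A1 B1 f1 (spec_preim A A1 k (locus \<Gamma>))"
    if "U \<subseteq> locus \<Gamma>" for U k y
    using that spec_preim_mono by (auto simp: spec_preim_def)
  have iso0: "stalk_iso B C g x" if "U \<subseteq> locus \<Gamma>" "x \<in> spec_preim A B f U" for U x
    using iso[of x] that spec_preim_mono[OF that(1), of A B f] by blast
  show ?thesis
    unfolding stack_sheaf_isomorphic_def
  proof (intro exI conjI ballI)
    show "msheaf_iso (opens0 \<Gamma>) (Osec (base \<Gamma>)) (lev0 (equivariant_pushforward \<Gamma> C C1 h h1 prC acC))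
        (lev0 (equivariant_pushforward \<Gamma> B B1 f f1 prB acB)) (push_iso A B C f g)"
      unfolding equivariant_pushforward_def stack_sheaf.simps A_def[symmetric]
      by (rule affine_triangle.push_iso_msheaf_iso[OF tri]) (auto simp: opens0_def A_def[symmetric] intro: iso0)
    show "msheaf_iso (opens1 \<Gamma>) (Osec (total \<Gamma>)) (lev1 (equivariant_pushforward \<Gamma> C C1 h h1 prC acC))
        (lev1 (equivariant_pushforward \<Gamma> B B1 f f1 prB acB)) (push_iso A1 B1 C1 f1 g1)"
      unfolding equivariant_pushforward_def stack_sheaf.simps A1_def[symmetric]
    proof (rule affine_triangle.push_iso_msheaf_iso[OF tri1])
      fix U x assume "U \<in> opens1 \<Gamma>" "x \<in> spec_preim A1 B1 f1 U"
      then show "stalk_iso B1 C1 g1 x"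
        using iso_pr[of x] spec_preim_mono[of U _ A1 B1 f1] by (auto simp: opens1_def A_def A1_def)
    qed (simp add: opens1_def A1_def)
  next
    fix U x assume U: "U \<in> opens0 \<Gamma>"
      and x: "x \<in> carrier (sec (lev0 (equivariant_pushforward \<Gamma> C C1 h h1 prC acC)) U)"
    have U': "zopen A U" "U \<subseteq> locus \<Gamma>" using U by (auto simp: opens0_def A_def)
    have x': "x \<in> carrier (Osec C (spec_preim A C h U))"
      using x by (simp add: equivariant_pushforward_def pushforward_simps A_def)
    show "push_iso A1 B1 C1 f1 g1 (spec_preim (base \<Gamma>) (total \<Gamma>) (proj \<Gamma>) U)
         (via_proj (equivariant_pushforward \<Gamma> C C1 h h1 prC acC) U x) =
        via_proj (equivariant_pushforward \<Gamma> B B1 f f1 prB acB) U (push_iso A B C f g U x)"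
      unfolding equivariant_pushforward_def stack_sheaf.simps A_def[symmetric] A1_def[symmetric]
      by (rule push_iso_natural[OF tri tri1 pr U'(1) iso0[OF U'(2)] iso_pr[OF sub[OF U'(2)]] x'])
    show "push_iso A1 B1 C1 f1 g1 (spec_preim (base \<Gamma>) (total \<Gamma>) (act \<Gamma>) U)
         (via_act (equivariant_pushforward \<Gamma> C C1 h h1 prC acC) U x) =
        via_act (equivariant_pushforward \<Gamma> B B1 f f1 prB acB) U (push_iso A B C f g U x)"
      unfolding equivariant_pushforward_def stack_sheaf.simps A_def[symmetric] A1_def[symmetric]
      by (rule push_iso_natural[OF tri tri1 ac U'(1) iso0[OF U'(2)] iso_ac[OF sub[OF U'(2)]] x'])
  qed
qed

section \<open>Coordinate rings\<close>

text \<open>Elements of \<open>coord_ring X\<close> are extensional functions on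
  \<open>pts X\<close>. \<open>reg\<close> and \<open>in_ideal\<close> apply to arbitrary total
  functions and ignore their values elsewhere, so that computations can be done with plain pointwise
  formulas.\<close>

definition reg :: "('x, 'k::field) variety \<Rightarrow> ('x \<Rightarrow> 'k) \<Rightarrow> bool" where
  "reg X F \<longleftrightarrow> restrict F (pts X) \<in> regular X"

definition in_ideal :: "('x, 'k) variety \<Rightarrow> ('x \<Rightarrow> 'k) set \<Rightarrow> ('x \<Rightarrow> 'k) \<Rightarrow> bool" where
  "in_ideal X I F \<longleftrightarrow> restrict F (pts X) \<in> I"

lemma regular_induct [consumes 1, case_names const coord add mult]:
  assumes "f \<in> regular X"
    and "\<And>a. P (\<lambda>x\<in>pts X. a)"
    and "\<And>f. f \<in> coords X \<Longrightarrow> P (restrict f (pts X))"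
    and "\<And>f g. f \<in> regular X \<Longrightarrow> P f \<Longrightarrow> g \<in> regular X \<Longrightarrow> P g \<Longrightarrow> P (\<lambda>x\<in>pts X. f x + g x)"
    and "\<And>f g. f \<in> regular X \<Longrightarrow> P f \<Longrightarrow> g \<in> regular X \<Longrightarrow> P g \<Longrightarrow> P (\<lambda>x\<in>pts X. f x * g x)"
  shows "P f"
  using assms(1) by (rule regular.induct) (fact assms)+

lemma regular_extensional: "f \<in> regular X \<Longrightarrow> f \<in> extensional (pts X)"
  by (erule regular_induct) (rule restrict_extensional)+

lemma regular_restrict: "f \<in> regular X \<Longrightarrow> restrict f (pts X) = f"
  using extensional_restrict regular_extensional by metis

lemma reg_regular: "f \<in> regular X \<Longrightarrow> reg X f"
  by (simp add: regular_restrict reg_def)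

lemma reg_cong: "reg X F \<Longrightarrow> (\<And>x. x \<in> pts X \<Longrightarrow> F x = F' x) \<Longrightarrow> reg X F'"
  unfolding reg_def by (metis restrict_ext)

lemma reg_const: "reg X (\<lambda>x. a)"
  unfolding reg_def by (rule regular.const)

lemma reg_coord: "f \<in> coords X \<Longrightarrow> reg X f"
  unfolding reg_def by (rule regular.coord)

lemma reg_add: assumes "reg X F" "reg X F'" shows "reg X (\<lambda>x. F x + F' x)"
  using regular.add[OF assms[unfolded reg_def]] by (rule reg_cong[OF reg_regular]) simp

lemma reg_mult: assumes "reg X F" "reg X F'" shows "reg X (\<lambda>x. F x * F' x)"
  using regular.mult[OF assms[unfolded reg_def]] by (rule reg_cong[OF reg_regular]) simp

lemma reg_uminus: "reg X F \<Longrightarrow> reg X (\<lambda>x. - F x)"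
  using reg_mult[OF reg_const[of X "- 1"], of F] by simp

lemma reg_diff: "reg X F \<Longrightarrow> reg X F' \<Longrightarrow> reg X (\<lambda>x. F x - F' x)"
  using reg_add[of X F "\<lambda>x. - F' x"] reg_uminus[of X F'] by simp

lemma reg_sum: "(\<And>i. i \<in> S \<Longrightarrow> reg X (F i)) \<Longrightarrow> reg X (\<lambda>x. \<Sum>i\<in>S. F i x)"
  by (induction S rule: infinite_finite_induct) (auto intro: reg_add reg_const)

lemma reg_power: "reg X F \<Longrightarrow> reg X (\<lambda>x. F x ^ n)"
  by (induction n) (auto intro: reg_mult reg_const)

lemma coord_ring_simps [simp]:
  "carrier (coord_ring X) = regular X"
  "(f \<otimes>\<^bsub>coord_ring X\<^esub> g) = (\<lambda>x \<in> pts X. f x * g x)"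
  "f \<oplus>\<^bsub>coord_ring X\<^esub> g = (\<lambda>x \<in> pts X. f x + g x)"
  "\<one>\<^bsub>coord_ring X\<^esub> = (\<lambda>x \<in> pts X. 1)"
  "\<zero>\<^bsub>coord_ring X\<^esub> = (\<lambda>x \<in> pts X. 0)"
  by (simp_all add: coord_ring_def)

lemma restrict_regular_iff [simp]: "restrict F (pts X) \<in> regular X \<longleftrightarrow> reg X F"
  by (simp add: reg_def)

lemma coord_ring_cring: "cring (coord_ring X)"
proof (rule cringI)
  show "abelian_group (coord_ring X)"
  proof (rule abelian_groupI)
    fix f assume "f \<in> carrier (coord_ring X)"
    then have f: "reg X (\<lambda>x. - f x)" by (simp add: reg_uminus reg_regular)
    show "\<exists>g\<in>carrier (coord_ring X). g \<oplus>\<^bsub>coord_ring X\<^esub> f = \<zero>\<^bsub>coord_ring X\<^esub>"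
      by (rule bexI[of _ "\<lambda>x\<in>pts X. - f x"], rule extensionalityI[where A = "pts X"]) (use f in simp_all)
  next
    fix f assume "f \<in> carrier (coord_ring X)"
    then show "\<zero>\<^bsub>coord_ring X\<^esub> \<oplus>\<^bsub>coord_ring X\<^esub> f = f"
      by (intro extensionalityI[where A = "pts X"]) (simp_all add: regular_extensional)
  next
    show "f \<oplus>\<^bsub>coord_ring X\<^esub> g \<oplus>\<^bsub>coord_ring X\<^esub> h = f \<oplus>\<^bsub>coord_ring X\<^esub> (g \<oplus>\<^bsub>coord_ring X\<^esub> h)"
      and "f \<oplus>\<^bsub>coord_ring X\<^esub> g = g \<oplus>\<^bsub>coord_ring X\<^esub> f" for f g h
      by (rule extensionalityI[where A = "pts X"]; simp add: add_ac)+
  qed (simp_all add: reg_const reg_add reg_regular)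
  show "comm_monoid (coord_ring X)"
  proof (rule comm_monoidI)
    fix f assume "f \<in> carrier (coord_ring X)"
    then show "\<one>\<^bsub>coord_ring X\<^esub> \<otimes>\<^bsub>coord_ring X\<^esub> f = f"
      by (intro extensionalityI[where A = "pts X"]) (simp_all add: regular_extensional)
  next
    show "f \<otimes>\<^bsub>coord_ring X\<^esub> g \<otimes>\<^bsub>coord_ring X\<^esub> h = f \<otimes>\<^bsub>coord_ring X\<^esub> (g \<otimes>\<^bsub>coord_ring X\<^esub> h)"
      and "f \<otimes>\<^bsub>coord_ring X\<^esub> g = g \<otimes>\<^bsub>coord_ring X\<^esub> f" for f g h
      by (rule extensionalityI[where A = "pts X"]; simp add: mult_ac)+
  qed (simp_all add: reg_const reg_mult reg_regular)
  show "(f \<oplus>\<^bsub>coord_ring X\<^esub> g) \<otimes>\<^bsub>coord_ring X\<^esub> h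
      = f \<otimes>\<^bsub>coord_ring X\<^esub> h \<oplus>\<^bsub>coord_ring X\<^esub> g \<otimes>\<^bsub>coord_ring X\<^esub> h" for f g h
    by (rule extensionalityI[where A = "pts X"]; simp add: algebra_simps)
qed

lemma coord_ring_pow:
  assumes "f \<in> regular X"
  shows "f [^]\<^bsub>coord_ring X\<^esub> (n::nat) = (\<lambda>x\<in>pts X. f x ^ n)"
proof (induction n)
  case (Suc n)
  show ?case
    unfolding nat_pow_Suc Suc coord_ring_simps
    by (rule extensionalityI[where A = "pts X"], (rule restrict_extensional)+) (simp add: mult.commute)
qed (simp add: nat_pow_def)

lemma coord_ring_finsum:
  assumes "finite S" "\<And>j. j \<in> S \<Longrightarrow> F j \<in> regular X"
  shows "(\<Oplus>\<^bsub>coord_ring X\<^esub>j\<in>S. F j) = (\<lambda>x\<in>pts X. \<Sum>j\<in>S. F j x)"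
proof -
  interpret cring "coord_ring X" by (rule coord_ring_cring)
  show ?thesis
    using assms
  proof (induction S rule: finite_induct)
    case (insert j S)
    have F: "F j \<in> regular X" "\<And>i. i \<in> S \<Longrightarrow> F i \<in> regular X" by (rule insert.prems, simp)+
    note IH = insert.IH[OF F(2)]
    have "(\<Oplus>\<^bsub>coord_ring X\<^esub>j\<in>insert j S. F j) = F j \<oplus>\<^bsub>coord_ring X\<^esub> (\<Oplus>\<^bsub>coord_ring X\<^esub>j\<in>S. F j)"
      by (intro finsum_insert insert.hyps) (simp_all add: F Pi_def)
    also have "\<dots> = (\<lambda>x\<in>pts X. \<Sum>j\<in>insert j S. F j x)"
      using insert.hyps by (intro extensionalityI[where A = "pts X"]) (simp_all add: IH)
    finally show ?case .
  qed simp
qed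

section \<open>Congruences of functions modulo an ideal\<close>

lemma in_ideal_cong:
  "in_ideal X I F \<Longrightarrow> (\<And>x. x \<in> pts X \<Longrightarrow> F x = F' x) \<Longrightarrow> in_ideal X I F'"
  unfolding in_ideal_def by (metis restrict_ext)

lemma in_ideal_reg:
  assumes "ideal I (coord_ring X)" "in_ideal X I F"
  shows "reg X F"
  using ideal.Icarr[OF assms(1) assms(2)[unfolded in_ideal_def]] by simp

lemma in_ideal_mem:
  assumes "ideal I (coord_ring X)" "f \<in> I"
  shows "in_ideal X I f"
  using assms(2) ideal.Icarr[OF assms] by (simp add: in_ideal_def regular_restrict)

lemma in_ideal_add:
  assumes "ideal I (coord_ring X)" "in_ideal X I F" "in_ideal X I F'"
  shows "in_ideal X I (\<lambda>x. F x + F' x)"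
proof -
  interpret ideal I "coord_ring X" by fact
  have "restrict F (pts X) \<oplus>\<^bsub>coord_ring X\<^esub> restrict F' (pts X) \<in> I"
    using assms(2,3) unfolding in_ideal_def
    by (rule additive_subgroup.a_closed[OF is_additive_subgroup])
  from in_ideal_cong[OF in_ideal_mem[OF assms(1) this]] show ?thesis by simp
qed

lemma in_ideal_mult:
  assumes "ideal I (coord_ring X)" "reg X F" "in_ideal X I F'"
  shows "in_ideal X I (\<lambda>x. F x * F' x)"
proof -
  interpret ideal I "coord_ring X" by fact
  have "restrict F (pts X) \<otimes>\<^bsub>coord_ring X\<^esub> restrict F' (pts X) \<in> I"
    using I_l_closed[OF assms(3)[unfolded in_ideal_def]] assms(2) by (simp only: coord_ring_simps reg_def)
  from in_ideal_cong[OF in_ideal_mem[OF assms(1) this]] show ?thesis by simp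
qed

lemma in_ideal_zero: "ideal I (coord_ring X) \<Longrightarrow> in_ideal X I (\<lambda>x. 0)"
  using additive_subgroup.zero_closed[OF ideal.axioms(1)] unfolding in_ideal_def by fastforce

lemma in_ideal_sum:
  assumes "ideal I (coord_ring X)" "\<And>i. i \<in> S \<Longrightarrow> in_ideal X I (F i)"
  shows "in_ideal X I (\<lambda>x. \<Sum>i\<in>S. F i x)"
  using assms(2)
  by (induction S rule: infinite_finite_induct)
    (auto intro: in_ideal_zero[OF assms(1)] in_ideal_add[OF assms(1)])

section \<open>Morphisms of varieties and pullback of functions\<close>

definition morphism :: "('x, 'k::field) variety \<Rightarrow> ('y, 'k) variety \<Rightarrow> ('x \<Rightarrow> 'y) \<Rightarrow> bool" where
  "morphism X Y m \<longleftrightarrow> m \<in> pts X \<rightarrow> pts Y \<and> (\<forall>f\<in>coords Y. reg X (\<lambda>x. f (m x)))"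

lemma morphism_pts: "morphism X Y m \<Longrightarrow> x \<in> pts X \<Longrightarrow> m x \<in> pts Y"
  by (auto simp: morphism_def)

lemma morphism_regular:
  assumes "morphism X Y m" "f \<in> regular Y"
  shows "reg X (\<lambda>x. f (m x))"
  using assms(2)
proof (rule regular_induct)
  fix a
  show "reg X (\<lambda>x. (\<lambda>y\<in>pts Y. a) (m x))"
    by (rule reg_cong[OF reg_const]) (simp add: morphism_pts[OF assms(1)])
next
  fix f assume "f \<in> coords Y"
  then have "reg X (\<lambda>x. f (m x))" using assms(1) by (simp add: morphism_def)
  then show "reg X (\<lambda>x. restrict f (pts Y) (m x))"
    by (rule reg_cong) (simp add: morphism_pts[OF assms(1)])
next
  fix f g assume "reg X (\<lambda>x. f (m x))" "reg X (\<lambda>x. g (m x))"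
  note reg_add[OF this] reg_mult[OF this]
  from reg_cong[OF this(1)] reg_cong[OF this(2)]
  show "reg X (\<lambda>x. (\<lambda>y\<in>pts Y. f y + g y) (m x))" "reg X (\<lambda>x. (\<lambda>y\<in>pts Y. f y * g y) (m x))"
    by (simp_all add: morphism_pts[OF assms(1)])
qed

lemma morphism_reg:
  assumes "morphism X Y m" "reg Y F"
  shows "reg X (\<lambda>x. F (m x))"
  using morphism_regular[OF assms(1) assms(2)[unfolded reg_def]] by (rule reg_cong) (simp add: morphism_pts[OF assms(1)])

lemma comap_hom:
  assumes "morphism X Y m"
  shows "ring_hom_cring (coord_ring Y) (coord_ring X) (comap X m)"
  by (intro ring_hom_cringI2 coord_ring_cring ring_hom_memI extensionalityI[where A = "pts X"])
    (auto simp: comap_def morphism_regular[OF assms] morphism_pts[OF assms])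

lemma comap_comap:
  assumes "morphism X Y m" "f \<in> regular Z"
  shows "comap X m (comap Y n f) = comap X (\<lambda>x. n (m x)) f"
  using morphism_pts[OF assms(1)] by (intro extensionalityI[where A = "pts X"]) (auto simp: comap_def)

section \<open>Homomorphisms from quotient rings\<close>

lemma Quot_carrier: "carrier (R Quot I) = {I +>\<^bsub>R\<^esub> a | a. a \<in> carrier R}"
  by (auto simp: FactRing_def A_RCOSETS_def' a_r_coset_def)

lemma Quot_hom:
  assumes "cring R" "ideal I R" "cring S" "F \<in> ring_hom R S"
    and \<phi>: "\<And>a. a \<in> carrier R \<Longrightarrow> \<phi> (I +>\<^bsub>R\<^esub> a) = F a"
  shows "ring_hom_cring (R Quot I) S \<phi>"
proof -
  interpret cring R by fact
  interpret ideal I R by fact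
  have pi: "(\<lambda>a. I +>\<^bsub>R\<^esub> a) \<in> ring_hom R (R Quot I)" by (rule rcos_ring_hom)
  note H = ring_hom_mult[OF pi, symmetric] ring_hom_add[OF pi, symmetric]
    ring_hom_one[OF pi, symmetric]
  show ?thesis
    by (intro ring_hom_cringI2 quotient_is_cring assms(1,3) ring_hom_memI)
      (auto simp: Quot_carrier \<phi> H ring_hom_mult[OF assms(4)] ring_hom_add[OF assms(4)]
        ring_hom_one[OF assms(4)] ring_hom_closed[OF assms(4)])
qed

lemma (in ideal) coset_eq_iff:
  assumes "a \<in> carrier R" "b \<in> carrier R"
  shows "I +> a = I +> b \<longleftrightarrow> a \<ominus> b \<in> I"
  using assms quotient_eq_iff_same_a_r_cos[OF is_ideal] by blast

lemma (in ideal) Quot_zero_iff: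
  assumes "a \<in> carrier R"
  shows "I +> a = \<zero>\<^bsub>R Quot I\<^esub> \<longleftrightarrow> a \<in> I"
proof -
  have "\<zero>\<^bsub>R Quot I\<^esub> = I +> \<zero>" by (simp add: FactRing_def a_coset_add_zero a_subset)
  then show ?thesis using coset_eq_iff[OF assms zero_closed] assms by (simp add: minus_eq)
qed

text \<open>The value on a coset of \<open>I\<close> is meaningful only if \<open>F\<close> vanishes on \<open>I\<close>.\<close>

definition quot_map :: "('a \<Rightarrow> 'b) \<Rightarrow> 'a set \<Rightarrow> 'b" where
  "quot_map F c = the_elem (F ` c)"

lemma quot_map_coset:
  assumes "ring_hom_cring R S F" "ideal I R" "\<And>a. a \<in> I \<Longrightarrow> F a = \<zero>\<^bsub>S\<^esub>" "a \<in> carrier R"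
  shows "quot_map F (I +>\<^bsub>R\<^esub> a) = F a"
proof -
  interpret F: ring_hom_cring R S F by fact
  interpret ideal I R by fact
  have eq: "F b = F a" if "b \<in> I +>\<^bsub>R\<^esub> a" for b
  proof -
    have "\<exists>i\<in>I. b = i \<oplus>\<^bsub>R\<^esub> a" using that by (simp only: a_r_coset_def' UN_iff singleton_iff)
    then obtain i where i: "i \<in> I" "b = i \<oplus>\<^bsub>R\<^esub> a" by (elim bexE)
    show ?thesis unfolding i(2) using assms(3)[OF i(1)] assms(4) Icarr[OF i(1)] by simp
  qed
  have "a \<in> I +>\<^bsub>R\<^esub> a" by (rule a_rcos_self[OF assms(4)])
  then have "F ` (I +>\<^bsub>R\<^esub> a) = {F a}" by (safe, metis eq singletonI) (rule imageI)
  then show ?thesis by (simp add: quot_map_def)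
qed

text \<open>One function \<open>t\<close> outside the prime suffices: its powers serve as all the
  denominators that \<open>stalk_iso\<close> asks for. Both halves thereby become statements about
  functions on points and about \<open>in_ideal\<close>, free of cosets.\<close>

lemma stalk_iso_coord:
  assumes \<pi>: "morphism X' X \<pi>" and I: "ideal I (coord_ring X)"
    and g: "ring_hom_cring (coord_ring X Quot I) (coord_ring X') g"
      "\<And>a. a \<in> regular X \<Longrightarrow> g (I +>\<^bsub>coord_ring X\<^esub> a) = comap X' \<pi> a"
    and q: "q \<in> Spec (coord_ring X Quot I)"
    and t: "t \<in> regular X" "t \<notin> spec_map (coord_ring X) (\<lambda>f. I +>\<^bsub>coord_ring X\<^esub> f) q"
    and surj: "\<And>c. c \<in> regular X' \<Longrightarrow>
      \<exists>n b. b \<in> regular X \<and> (\<forall>y\<in>pts X'. t (\<pi> y) ^ n * c y = b (\<pi> y))"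
    and inj: "\<And>a. a \<in> regular X \<Longrightarrow> (\<And>y. y \<in> pts X' \<Longrightarrow> a (\<pi> y) = 0) \<Longrightarrow>
      \<exists>n. in_ideal X I (\<lambda>x. t x ^ n * a x)"
  shows "stalk_iso (coord_ring X Quot I) (coord_ring X') g q"
proof -
  let ?A = "coord_ring X"
  interpret A: cring ?A by (rule coord_ring_cring)
  interpret I: ideal I ?A by fact
  let ?x = "spec_map ?A (\<lambda>f. I +>\<^bsub>?A\<^esub> f) q"
  have x: "?x \<in> Spec ?A" by (rule spec_map_Spec[OF I.rcos_ring_hom_cring[OF A.is_cring] q])
  define T where "T n = (\<lambda>x\<in>pts X. t x ^ n)" for n
  have T: "T n \<in> regular X" for n unfolding T_def using t(1) by (simp add: reg_power reg_regular)
  have "T n \<notin> ?x" for n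
    using A.Spec_pow[OF x _ t(2), of n] t(1) by (simp add: coord_ring_pow T_def)
  then have Tq: "I +>\<^bsub>?A\<^esub> T n \<in> carrier (?A Quot I) - q" for n
    using T[of n] by (auto simp: spec_map_def Quot_carrier)
  show ?thesis
    unfolding stalk_iso_def
  proof (intro conjI ballI impI)
    fix c assume "c \<in> carrier (coord_ring X')"
    then obtain n b where b: "b \<in> regular X" "\<forall>y\<in>pts X'. t (\<pi> y) ^ n * c y = b (\<pi> y)"
      using surj[of c] unfolding coord_ring_simps by blast
    have "g (I +>\<^bsub>?A\<^esub> T n) \<otimes>\<^bsub>coord_ring X'\<^esub> c = g (I +>\<^bsub>?A\<^esub> b)"
      using b morphism_pts[OF \<pi>] by (intro extensionalityI[where A = "pts X'"]) (simp_all add: g(2) T comap_def, simp add: T_def)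
    then show "\<exists>u\<in>carrier (?A Quot I) - q. \<exists>b\<in>carrier (?A Quot I). g u \<otimes>\<^bsub>coord_ring X'\<^esub> c = g b"
      using Tq b(1) by (intro bexI[of _ "I +>\<^bsub>?A\<^esub> T n"] bexI[of _ "I +>\<^bsub>?A\<^esub> b"]) (auto simp: Quot_carrier)
  next
    fix b assume "b \<in> carrier (?A Quot I)" and gb: "g b = \<zero>\<^bsub>coord_ring X'\<^esub>"
    then obtain a where a: "a \<in> regular X" "b = I +>\<^bsub>?A\<^esub> a" by (auto simp: Quot_carrier)
    have *: "comap X' \<pi> a = (\<lambda>y\<in>pts X'. 0)" using gb a g(2) by simp
    have "a (\<pi> y) = 0" if "y \<in> pts X'" for y
      using fun_cong[OF *, of y] unfolding comap_def restrict_apply'[OF that] .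
    from inj[OF a(1) this] obtain n where n: "(\<lambda>x\<in>pts X. t x ^ n * a x) \<in> I"
      unfolding in_ideal_def by blast
    have "(I +>\<^bsub>?A\<^esub> T n) \<otimes>\<^bsub>?A Quot I\<^esub> b = I +>\<^bsub>?A\<^esub> (T n \<otimes>\<^bsub>?A\<^esub> a)"
      using T a by (simp only: a(2) FactRing_def monoid.simps I.rcoset_mult_add coord_ring_simps)
    also have "T n \<otimes>\<^bsub>?A\<^esub> a = (\<lambda>x\<in>pts X. t x ^ n * a x)" by (intro extensionalityI[where A = "pts X"]) (simp_all add: T_def)
    also have "I +>\<^bsub>?A\<^esub> \<dots> = \<zero>\<^bsub>?A Quot I\<^esub>"
      using n I.Quot_zero_iff[OF I.Icarr[OF n]] by simp
    finally show "\<exists>u\<in>carrier (?A Quot I) - q. u \<otimes>\<^bsub>?A Quot I\<^esub> b = \<zero>\<^bsub>?A Quot I\<^esub>"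
      using Tq by blast
  qed
qed

section \<open>Regular vector-valued functions\<close>

lemma
  assumes "Vector_Spaces.linear s1 s2 f"
  shows lin_add: "f (a + b) = f a + f b" and lin_scale: "f (s1 r a) = s2 r (f a)"
    and lin_diff: "f (a - b) = f a - f b" and lin_sum: "f (\<Sum>i\<in>A. g i) = (\<Sum>i\<in>A. f (g i))"
    and lin_zero: "f 0 = 0"
proof -
  interpret Vector_Spaces.linear s1 s2 f by fact
  show "f (a + b) = f a + f b" "f (s1 r a) = s2 r (f a)" "f (a - b) = f a - f b"
    "f (\<Sum>i\<in>A. g i) = (\<Sum>i\<in>A. f (g i))" "f 0 = 0"
    by (simp_all add: add scale diff sum)
qed

text \<open>Testing against all linear forms avoids a choice of basis and matches
  \<open>Hom_var\<close>, whose coordinates are linear forms evaluated at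
  \<open>f a\<close>.\<close>

definition vreg where
  "vreg s2 X r \<longleftrightarrow> (\<forall>\<xi>. Vector_Spaces.linear s2 (*) \<xi> \<longrightarrow> reg X (\<lambda>x. \<xi> (r x)))"

definition in_ideal_vec where
  "in_ideal_vec s2 X I r \<longleftrightarrow> (\<forall>\<xi>. Vector_Spaces.linear s2 (*) \<xi> \<longrightarrow> in_ideal X I (\<lambda>x. \<xi> (r x)))"

lemma vregD: "vreg s2 X r \<Longrightarrow> Vector_Spaces.linear s2 (*) \<xi> \<Longrightarrow> reg X (\<lambda>x. \<xi> (r x))"
  by (simp add: vreg_def)

lemma in_ideal_vecD:
  "in_ideal_vec s2 X I r \<Longrightarrow> Vector_Spaces.linear s2 (*) \<xi> \<Longrightarrow> in_ideal X I (\<lambda>x. \<xi> (r x))"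
  by (simp add: in_ideal_vec_def)

lemma vreg_const: "vreg s2 X (\<lambda>x. v)"
  by (simp add: vreg_def reg_const)

lemma vreg_scale: "reg X F \<Longrightarrow> vreg s2 X r \<Longrightarrow> vreg s2 X (\<lambda>x. s2 (F x) (r x))"
  by (auto simp: vreg_def lin_scale intro: reg_mult)

lemma vreg_sum: "(\<And>i. i \<in> S \<Longrightarrow> vreg s2 X (r i)) \<Longrightarrow> vreg s2 X (\<lambda>x. \<Sum>i\<in>S. r i x)"
  by (auto simp: vreg_def lin_sum intro: reg_sum)

lemma vreg_morphism: "morphism X Y m \<Longrightarrow> vreg s2 Y r \<Longrightarrow> vreg s2 X (\<lambda>x. r (m x))"
  unfolding vreg_def using morphism_reg by blast

lemma in_ideal_vec_diff:
  assumes I: "ideal I (coord_ring X)" and "in_ideal_vec s2 X I r" "in_ideal_vec s2 X I r'"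
  shows "in_ideal_vec s2 X I (\<lambda>x. r x - r' x)"
  unfolding in_ideal_vec_def
proof (intro allI impI)
  fix \<xi> assume \<xi>: "Vector_Spaces.linear s2 (*) \<xi>"
  have "in_ideal X I (\<lambda>x. \<xi> (r x) + - 1 * \<xi> (r' x))"
    using assms \<xi> by (intro in_ideal_add[OF I] in_ideal_mult[OF I] reg_const) (simp_all add: in_ideal_vec_def)
  then show "in_ideal X I (\<lambda>x. \<xi> (r x - r' x))" by (simp add: lin_diff[OF \<xi>])
qed

lemma in_ideal_vec_scale:
  "ideal I (coord_ring X) \<Longrightarrow> reg X F \<Longrightarrow> in_ideal_vec s2 X I r \<Longrightarrow> in_ideal_vec s2 X I (\<lambda>x. s2 (F x) (r x))"
  by (auto simp: in_ideal_vec_def lin_scale intro: in_ideal_mult)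

context finite_dimensional_vector_space
begin

abbreviation crd :: "'b \<Rightarrow> 'b \<Rightarrow> 'a" where
  "crd \<equiv> representation Basis"

lemma crd_linear: "Vector_Spaces.linear scale (*) (\<lambda>v. crd v b)"
  by (rule linear_representation[OF independent_Basis span_Basis])

lemma crd_sum: "(\<Sum>b\<in>Basis. scale (crd v b) b) = v"
  by (rule sum_representation_eq[OF independent_Basis]) (simp_all add: span_Basis finite_Basis)

lemma linear_expand:
  assumes "Vector_Spaces.linear scale s2 f"
  shows "f v = (\<Sum>b\<in>Basis. s2 (crd v b) (f b))"
  using lin_sum[OF assms, of "\<lambda>b. scale (crd v b) b" Basis] lin_scale[OF assms] by (simp add: crd_sum)

lemma linear_family_apply:
  assumes "Vector_Spaces.linear scale s2 f" "Vector_Spaces.linear s2 (*) \<xi>"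
  shows "\<xi> (f v) = (\<Sum>b\<in>Basis. crd v b * \<xi> (f b))"
  by (subst linear_expand[OF assms(1)]) (simp add: lin_sum[OF assms(2)] lin_scale[OF assms(2)])

text \<open>The value is bilinear in the map and its argument; expanding the argument in the basis
  turns it into a finite sum of products of regular functions.\<close>

lemma vreg_apply:
  assumes "\<And>x. x \<in> pts X \<Longrightarrow> Vector_Spaces.linear scale s2 (L x)" "\<And>b. vreg s2 X (\<lambda>x. L x b)"
    and "vreg scale X r"
  shows "vreg s2 X (\<lambda>x. L x (r x))"
  unfolding vreg_def
proof (intro allI impI)
  fix \<xi> assume \<xi>: "Vector_Spaces.linear s2 (*) \<xi>"
  have "reg X (\<lambda>x. \<Sum>b\<in>Basis. crd (r x) b * \<xi> (L x b))"
    using vregD[OF assms(3) crd_linear] vregD[OF assms(2) \<xi>] by (intro reg_sum reg_mult)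
  then show "reg X (\<lambda>x. \<xi> (L x (r x)))"
    by (rule reg_cong) (simp add: linear_family_apply[OF assms(1) \<xi>])
qed

lemma in_ideal_vec_apply:
  assumes "ideal I (coord_ring X)"
    and "\<And>x. x \<in> pts X \<Longrightarrow> Vector_Spaces.linear scale s2 (L x)" "\<And>b. vreg s2 X (\<lambda>x. L x b)"
    and "in_ideal_vec scale X I r"
  shows "in_ideal_vec s2 X I (\<lambda>x. L x (r x))"
  unfolding in_ideal_vec_def
proof (intro allI impI)
  fix \<xi> assume \<xi>: "Vector_Spaces.linear s2 (*) \<xi>"
  have "in_ideal X I (\<lambda>x. \<Sum>b\<in>Basis. \<xi> (L x b) * crd (r x) b)"
    using in_ideal_vecD[OF assms(4) crd_linear] vregD[OF assms(3) \<xi>]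
    by (intro in_ideal_sum[OF assms(1)] in_ideal_mult[OF assms(1)])
  then show "in_ideal X I (\<lambda>x. \<xi> (L x (r x)))"
    by (rule in_ideal_cong) (simp add: linear_family_apply[OF assms(2) \<xi>] mult.commute)
qed

text \<open>Counterpart of \<open>in_ideal_vec_apply\<close> with the roles exchanged: here the
  linear map is congruent to zero and its argument is merely regular.\<close>

lemma in_ideal_vec_family:
  assumes "ideal I (coord_ring X)"
    and "\<And>x. x \<in> pts X \<Longrightarrow> Vector_Spaces.linear scale s2 (D x)" "\<And>b. in_ideal_vec s2 X I (\<lambda>x. D x b)"
    and "vreg scale X r"
  shows "in_ideal_vec s2 X I (\<lambda>x. D x (r x))"
  unfolding in_ideal_vec_def
proof (intro allI impI)
  fix \<xi> assume \<xi>: "Vector_Spaces.linear s2 (*) \<xi>"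
  have "in_ideal X I (\<lambda>x. \<Sum>b\<in>Basis. crd (r x) b * \<xi> (D x b))"
    using in_ideal_vecD[OF assms(3) \<xi>] vregD[OF assms(4) crd_linear]
    by (intro in_ideal_sum[OF assms(1)] in_ideal_mult[OF assms(1)])
  then show "in_ideal X I (\<lambda>x. \<xi> (D x (r x)))"
    by (rule in_ideal_cong) (simp add: linear_family_apply[OF assms(2) \<xi>])
qed

end

section \<open>Inverses of matrices of full rank\<close>

text \<open>\<open>indep_cols_at\<close> over a coordinate ring, rephrased for total functions. The
  coefficient family is regular at every index, so that columns can be added or dropped without side
  conditions.\<close>

definition indep_columns where
  "indep_columns X x I J M \<longleftrightarrow> (\<forall>a. (\<forall>j. reg X (a j)) \<longrightarrow>
     (\<forall>i\<in>I. in_ideal X x (\<lambda>z. \<Sum>j\<in>J. M i j z * a j z)) \<longrightarrow> (\<forall>j\<in>J. in_ideal X x (a j)))"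

lemma indep_columnsD:
  assumes "indep_columns X x I J M" "\<And>j. reg X (a j)"
    "\<And>i. i \<in> I \<Longrightarrow> in_ideal X x (\<lambda>z. \<Sum>j\<in>J. M i j z * a j z)" "j \<in> J"
  shows "in_ideal X x (a j)"
  using assms unfolding indep_columns_def by simp

text \<open>Fraction-free Gaussian elimination, one column at a time.\<close>

lemma indep_columns_left_inverse:
  fixes X :: "('x, 'k::field) variety"
  assumes x: "x \<in> Spec (coord_ring X)" and J: "finite J" and I: "finite I"
    and M: "\<And>i j. reg X (M i j)"
    and ind: "indep_columns X x I J M"
  shows "\<exists>N t. (\<forall>j i. reg X (N j i)) \<and> reg X t \<and> \<not> in_ideal X x t \<and>
    (\<forall>j\<in>J. \<forall>j'\<in>J. \<forall>z. (\<Sum>i\<in>I. N j i z * M i j' z) = (if j = j' then t z else 0))"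
  using J ind
proof (induction J rule: finite_induct)
  case empty
  interpret cring "coord_ring X" by (rule coord_ring_cring)
  have "\<not> in_ideal X x (\<lambda>z. 1)" using Spec_one[OF x] by (simp add: in_ideal_def)
  then show ?case by (intro exI[of _ "\<lambda>_ _ _. 0"] exI[of _ "\<lambda>_. 1"]) (simp add: reg_const)
next
  case (insert j0 J)
  interpret cring "coord_ring X" by (rule coord_ring_cring)
  have x_ideal: "ideal x (coord_ring X)" using x by (simp add: Spec_def primeideal.axioms(1))
  \<comment> \<open>The columns in \<open>J\<close> remain independent: a relation among them is one
    among all columns with coefficient 0 at \<open>j0\<close>.\<close>
  have "in_ideal X x (a j)"
    if a: "\<And>j. reg X (a j)" and s: "\<And>i. i \<in> I \<Longrightarrow> in_ideal X x (\<lambda>z. \<Sum>j\<in>J. M i j z * a j z)" and j: "j \<in> J"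
    for a j
  proof -
    have "in_ideal X x ((a(j0 := \<lambda>z. 0)) j)"
    proof (rule indep_columnsD[OF insert.prems])
      show "reg X ((a(j0 := \<lambda>z. 0)) j)" for j using a reg_const by auto
      fix i assume "i \<in> I"
      have "(\<Sum>j\<in>insert j0 J. M i j z * (a(j0 := \<lambda>z. 0)) j z) = (\<Sum>j\<in>J. M i j z * a j z)" for z
        using insert.hyps by (auto intro!: sum.cong)
      then show "in_ideal X x (\<lambda>z. \<Sum>j\<in>insert j0 J. M i j z * (a(j0 := \<lambda>z. 0)) j z)"
        using s[OF \<open>i \<in> I\<close>] by simp
    qed (use j in simp)
    moreover have "j \<noteq> j0" using j insert.hyps by auto
    ultimately show ?thesis by simp
  qed
  then have "indep_columns X x I J M" unfolding indep_columns_def by blast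
  from insert.IH[OF this] obtain N t where N: "\<And>j i. reg X (N j i)" and t: "reg X t" "\<not> in_ideal X x t"
    and NM: "\<And>j j' z. j \<in> J \<Longrightarrow> j' \<in> J \<Longrightarrow> (\<Sum>i\<in>I. N j i z * M i j' z) = (if j = j' then t z else 0)"
    by blast
  \<comment> \<open>\<open>c j\<close> / \<open>t\<close> is the coefficient of column
    \<open>j0\<close> along column \<open>j\<close>, as measured by the left inverse found so far.
    Below, \<open>r\<close> is what remains of \<open>t\<close> times column \<open>j0\<close> after
    subtracting these components.\<close>
  define c where "c j z = (\<Sum>i\<in>I. N j i z * M i j0 z)" for j z
  have c: "reg X (c j)" for j
    unfolding c_def[abs_def] by (intro reg_sum reg_mult N M)
  define r where "r i z = t z * M i j0 z - (\<Sum>j\<in>J. M i j z * c j z)" for i z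
  have r: "reg X (r i)" for i
    unfolding r_def[abs_def] by (intro reg_diff reg_sum reg_mult t c M)
  \<comment> \<open>If the whole remainder were zero modulo the prime, then \<open>t\<close> at
    \<open>j0\<close> together with the coefficients \<open>- c j\<close> would be a relation among
    the columns, although \<open>t\<close> is not in the prime.\<close>
  have "\<exists>i0\<in>I. \<not> in_ideal X x (r i0)"
  proof (rule ccontr)
    assume "\<not> ?thesis"
    then have all: "in_ideal X x (r i)" if "i \<in> I" for i using that by blast
    let ?a = "\<lambda>j. if j = j0 then t else (\<lambda>z. - c j z)"
    have "in_ideal X x (?a j0)"
    proof (rule indep_columnsD[OF insert.prems, where a = ?a and j = j0])
      show "reg X (?a j)" for j using t(1) reg_uminus[OF c] by simp
      fix i assume "i \<in> I"
      have "(\<Sum>j\<in>insert j0 J. M i j z * ?a j z) = r i z" for z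
      proof -
        have "(\<Sum>j\<in>J. M i j z * ?a j z) = (\<Sum>j\<in>J. - (M i j z * c j z))"
          using insert.hyps by (intro sum.cong) auto
        then show ?thesis using insert.hyps by (simp add: r_def sum_negf mult.commute)
      qed
      then show "in_ideal X x (\<lambda>z. \<Sum>j\<in>insert j0 J. M i j z * ?a j z)" using all[OF \<open>i \<in> I\<close>] by simp
    qed simp
    then show False using t(2) by simp
  qed
  then obtain i0 where i0: "i0 \<in> I" "\<not> in_ideal X x (r i0)" by blast
  \<comment> \<open>The row that reads off entry \<open>i0\<close> of the remainder: it annihilates
    the columns in \<open>J\<close> and has value \<open>r i0\<close> on column \<open>j0\<close>,
    so up to scalar it is the dual row for \<open>j0\<close>.\<close>
  define L where "L i z = (if i = i0 then t z else 0) - (\<Sum>j\<in>J. M i0 j z * N j i z)" for i z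
  have L: "reg X (L i)" for i
    unfolding L_def[abs_def] using t(1) reg_const
    by (cases "i = i0") (auto intro!: reg_diff reg_uminus reg_sum reg_mult N M)
  have L_sum: "(\<Sum>i\<in>I. L i z * M i j z) = t z * M i0 j z - (\<Sum>j'\<in>J. M i0 j' z * (\<Sum>i\<in>I. N j' i z * M i j z))"
    for j z
  proof -
    have "L i z * M i j z
        = (if i = i0 then t z * M i j z else 0) - (\<Sum>j'\<in>J. M i0 j' z * (N j' i z * M i j z))" for i
      by (cases "i = i0") (simp_all add: L_def left_diff_distrib sum_distrib_right mult.assoc)
    then have "(\<Sum>i\<in>I. L i z * M i j z)
        = (\<Sum>i\<in>I. if i = i0 then t z * M i j z else 0) - (\<Sum>i\<in>I. \<Sum>j'\<in>J. M i0 j' z * (N j' i z * M i j z))"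
      by (simp add: sum_subtractf)
    also have "(\<Sum>i\<in>I. \<Sum>j'\<in>J. M i0 j' z * (N j' i z * M i j z)) = (\<Sum>j'\<in>J. M i0 j' z * (\<Sum>i\<in>I. N j' i z * M i j z))"
      by (subst sum.swap) (simp add: sum_distrib_left)
    finally show ?thesis using I i0(1) by (simp cong: if_cong)
  qed
  have L0: "(\<Sum>i\<in>I. L i z * M i j0 z) = r i0 z" for z
    by (simp add: L_sum r_def c_def)
  have LJ: "(\<Sum>i\<in>I. L i z * M i j z) = 0" if "j \<in> J" for j z
  proof -
    have "(\<Sum>j'\<in>J. M i0 j' z * (\<Sum>i\<in>I. N j' i z * M i j z)) = (\<Sum>j'\<in>J. if j' = j then M i0 j' z * t z else 0)"
      using that by (intro sum.cong) (auto simp: NM)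
    then show ?thesis using that insert.hyps(1) by (simp add: L_sum mult.commute)
  qed
  \<comment> \<open>The common value on the diagonal is to be \<open>t\<close> times
    \<open>r i0\<close>. The row for \<open>j0\<close> is \<open>L\<close> scaled by
    \<open>t\<close>; an old row is scaled by \<open>r i0\<close>, and its value on column
    \<open>j0\<close>, now \<open>r i0\<close> times \<open>c j\<close>, is removed by subtracting
    \<open>c j\<close> times \<open>L\<close>.\<close>
  define N' where "N' j i z = (if j = j0 then t z * L i z else r i0 z * N j i z - c j z * L i z)" for j i z
  have N': "reg X (N' j i)" for j i
    unfolding N'_def[abs_def] using t(1) L r N c by (cases "j = j0") (auto intro!: reg_diff reg_mult)
  have t': "\<not> in_ideal X x (\<lambda>z. t z * r i0 z)"
  proof
    assume "in_ideal X x (\<lambda>z. t z * r i0 z)"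
    then have "restrict t (pts X) \<otimes>\<^bsub>coord_ring X\<^esub> restrict (r i0) (pts X) \<in> x"
      unfolding in_ideal_def by (simp cong: restrict_cong)
    moreover have "restrict t (pts X) \<otimes>\<^bsub>coord_ring X\<^esub> restrict (r i0) (pts X) \<in> x
        \<longleftrightarrow> restrict t (pts X) \<in> x \<or> restrict (r i0) (pts X) \<in> x"
      by (rule Spec_mult_iff[OF x]) (use t r in simp_all)
    ultimately show False using t(2) i0(2) unfolding in_ideal_def by blast
  qed
  have N'M: "(\<Sum>i\<in>I. N' j i z * M i j' z) = (if j = j' then t z * r i0 z else 0)"
    if "j \<in> insert j0 J" "j' \<in> insert j0 J" for j j' z
  proof (cases "j = j0")
    case True
    then have "(\<Sum>i\<in>I. N' j i z * M i j' z) = t z * (\<Sum>i\<in>I. L i z * M i j' z)"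
      by (simp add: N'_def sum_distrib_left mult_ac)
    then show ?thesis using that insert.hyps(2) L0 LJ True by (cases "j' = j0") auto
  next
    case False
    then have "(\<Sum>i\<in>I. N' j i z * M i j' z)
        = r i0 z * (\<Sum>i\<in>I. N j i z * M i j' z) - c j z * (\<Sum>i\<in>I. L i z * M i j' z)"
      by (simp add: N'_def sum_distrib_left algebra_simps sum_subtractf)
    then show ?thesis using that insert.hyps(2) L0 LJ NM False by (cases "j' = j0") (auto simp: c_def)
  qed
  show ?case
    using N' t' N'M reg_mult[OF t(1) r[of i0]]
    by (intro exI[of _ N'] exI[of _ "\<lambda>z. t z * r i0 z"]) blast
qed

section \<open>The graph of an endomorphism over the locus of full rank\<close>

text \<open>On \<open>X\<close> there are maps \<open>\<phi>1, \<phi>2 : V \<rightarrow> W\<close> and \<open>\<theta>1, \<theta>2 : W' \<rightarrow> V\<close>, on \<open>X'\<close> there is in addition an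
  endomorphism \<open>\<gamma>\<close> of \<open>V\<close> with \<open>\<theta>1 = \<gamma> \<theta>2\<close> and \<open>\<phi>2 = \<phi>1 \<gamma>\<close>. The entries of \<open>\<phi>1 \<theta>1 - \<phi>2 \<theta>2\<close> lie
  in \<open>I\<close>. The point \<open>mk x c\<close> of \<open>X'\<close> has \<open>\<phi>1\<close> and \<open>\<theta>2\<close> as \<open>x\<close>, and endomorphism \<open>c\<close>.\<close>

locale graph_family = three_spaces scaleV BV scaleW BW scaleW' BW'
  for scaleV :: "'k::field_char_0 \<Rightarrow> 'v::ab_group_add \<Rightarrow> 'v" and BV
    and scaleW :: "'k \<Rightarrow> 'w::ab_group_add \<Rightarrow> 'w" and BW
    and scaleW' :: "'k \<Rightarrow> 'u::ab_group_add \<Rightarrow> 'u" and BW' +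
  fixes X :: "('x, 'k) variety" and X' :: "('y, 'k) variety" and \<pi> :: "'y \<Rightarrow> 'x"
    and I :: "('x \<Rightarrow> 'k) set"
    and \<phi>1 \<phi>2 :: "'x \<Rightarrow> 'v \<Rightarrow> 'w" and \<theta>1 \<theta>2 :: "'x \<Rightarrow> 'u \<Rightarrow> 'v"
    and \<gamma> :: "'y \<Rightarrow> 'v \<Rightarrow> 'v" and mk :: "'x \<Rightarrow> ('v \<Rightarrow> 'v) \<Rightarrow> 'y"
  assumes \<pi>: "morphism X' X \<pi>" and I: "ideal I (coord_ring X)"
    and lin: "\<And>x. x \<in> pts X \<Longrightarrow> Vector_Spaces.linear scaleV scaleW (\<phi>1 x)"
      "\<And>x. x \<in> pts X \<Longrightarrow> Vector_Spaces.linear scaleV scaleW (\<phi>2 x)"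
      "\<And>x. x \<in> pts X \<Longrightarrow> Vector_Spaces.linear scaleW' scaleV (\<theta>1 x)"
      "\<And>x. x \<in> pts X \<Longrightarrow> Vector_Spaces.linear scaleW' scaleV (\<theta>2 x)"
      "\<And>y. y \<in> pts X' \<Longrightarrow> Vector_Spaces.linear scaleV scaleV (\<gamma> y)"
    and regular: "\<And>v. vreg scaleW X (\<lambda>x. \<phi>1 x v)" "\<And>v. vreg scaleW X (\<lambda>x. \<phi>2 x v)"
      "\<And>u. vreg scaleV X (\<lambda>x. \<theta>1 x u)" "\<And>u. vreg scaleV X (\<lambda>x. \<theta>2 x u)"
    and graph: "\<And>y v. y \<in> pts X' \<Longrightarrow> \<phi>2 (\<pi> y) v = \<phi>1 (\<pi> y) (\<gamma> y v)"
      "\<And>y u. y \<in> pts X' \<Longrightarrow> \<theta>1 (\<pi> y) u = \<gamma> y (\<theta>2 (\<pi> y) u)"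
    and rel: "\<And>u. in_ideal_vec scaleW X I (\<lambda>x. \<phi>1 x (\<theta>1 x u) - \<phi>2 x (\<theta>2 x u))"
    and mk: "\<And>x c. x \<in> pts X \<Longrightarrow> Vector_Spaces.linear scaleV scaleV c \<Longrightarrow> mk x c \<in> pts X'"
      "\<And>x c. x \<in> pts X \<Longrightarrow> Vector_Spaces.linear scaleV scaleV c \<Longrightarrow> \<phi>1 (\<pi> (mk x c)) = \<phi>1 x"
      "\<And>x c. x \<in> pts X \<Longrightarrow> Vector_Spaces.linear scaleV scaleV c \<Longrightarrow> \<theta>2 (\<pi> (mk x c)) = \<theta>2 x"
      "\<And>x c. x \<in> pts X \<Longrightarrow> Vector_Spaces.linear scaleV scaleV c \<Longrightarrow> \<gamma> (mk x c) = c"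
    and coords_X: "\<And>f. f \<in> coords X \<Longrightarrow>
      (\<forall>x\<in>pts X. \<forall>c. Vector_Spaces.linear scaleV scaleV c \<longrightarrow> f (\<pi> (mk x c)) = f x) \<or>
      (\<exists>\<xi> v. Vector_Spaces.linear scaleW (*) \<xi> \<and> f = (\<lambda>x. \<xi> (\<phi>2 x v))) \<or>
      (\<exists>\<xi> u. Vector_Spaces.linear scaleV (*) \<xi> \<and> f = (\<lambda>x. \<xi> (\<theta>1 x u)))"
    and coords_X': "\<And>f. f \<in> coords X' \<Longrightarrow>
      (\<exists>b. reg X b \<and> (\<forall>y\<in>pts X'. f y = b (\<pi> y))) \<or>
      (\<exists>\<xi> v. Vector_Spaces.linear scaleV (*) \<xi> \<and> f = (\<lambda>y. \<xi> (\<gamma> y v)))"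
begin

lemma \<pi>_pts: "y \<in> pts X' \<Longrightarrow> \<pi> y \<in> pts X"
  by (rule morphism_pts[OF \<pi>])

text \<open>\<open>N\<close> / \<open>\<Delta>\<close> is a left inverse of \<open>\<phi>1\<close>
  and \<open>R\<close> / \<open>\<Delta>'\<close> a right inverse of \<open>\<theta>2\<close>, with
  denominators cleared so that the identities hold at every point, including those where the
  denominators vanish.\<close>

context
  fixes N :: "'x \<Rightarrow> 'w \<Rightarrow> 'v" and R :: "'x \<Rightarrow> 'v \<Rightarrow> 'u" and \<Delta> \<Delta>' :: "'x \<Rightarrow> 'k"
  assumes N: "\<And>x. x \<in> pts X \<Longrightarrow> Vector_Spaces.linear scaleW scaleV (N x)" "\<And>w. vreg scaleV X (\<lambda>x. N x w)"
      "\<And>x v. x \<in> pts X \<Longrightarrow> N x (\<phi>1 x v) = scaleV (\<Delta> x) v"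
    and R: "\<And>v. vreg scaleW' X (\<lambda>x. R x v)"
      "\<And>x v. x \<in> pts X \<Longrightarrow> \<theta>2 x (R x v) = scaleV (\<Delta>' x) v"
    and \<Delta>: "reg X \<Delta>" "reg X \<Delta>'"
begin

text \<open>Only the entries of the endomorphism \<open>\<gamma>\<close> are not already functions
  on \<open>X\<close>, and these become so once multiplied by \<open>\<Delta>\<close>. Sums and
  products add up the exponents.\<close>

lemma graph_surj:
  assumes "c \<in> regular X'"
  shows "\<exists>n b. reg X b \<and> (\<forall>y\<in>pts X'. (\<Delta> (\<pi> y) * \<Delta>' (\<pi> y)) ^ n * c y = b (\<pi> y))"
  using assms
proof (rule regular_induct)
  fix a
  show "\<exists>n b. reg X b \<and> (\<forall>y\<in>pts X'. (\<Delta> (\<pi> y) * \<Delta>' (\<pi> y)) ^ n * (\<lambda>y\<in>pts X'. a) y = b (\<pi> y))"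
    by (intro exI[of _ 0] exI[of _ "\<lambda>_. a"]) (simp add: reg_const)
next
  fix f assume "f \<in> coords X'"
  from coords_X'[OF this]
  show "\<exists>n b. reg X b \<and> (\<forall>y\<in>pts X'. (\<Delta> (\<pi> y) * \<Delta>' (\<pi> y)) ^ n * restrict f (pts X') y = b (\<pi> y))"
  proof
    assume "\<exists>b. reg X b \<and> (\<forall>y\<in>pts X'. f y = b (\<pi> y))"
    then obtain b where "reg X b" "\<forall>y\<in>pts X'. f y = b (\<pi> y)" by blast
    then show ?thesis by (intro exI[of _ 0] exI[of _ b]) simp
  next
    assume "\<exists>\<xi> v. Vector_Spaces.linear scaleV (*) \<xi> \<and> f = (\<lambda>y. \<xi> (\<gamma> y v))"
    then obtain \<xi> v where \<xi>: "Vector_Spaces.linear scaleV (*) \<xi>" and f: "f = (\<lambda>y. \<xi> (\<gamma> y v))" by blast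
    \<comment> \<open>On the graph, applying \<open>N\<close> to \<open>\<phi>2\<close> gives
      \<open>\<Delta>\<close> times \<open>\<gamma>\<close>. The factor \<open>\<Delta>'\<close>
      only adjusts to the common denominator.\<close>
    let ?b = "\<lambda>x. \<Delta>' x * \<xi> (N x (\<phi>2 x v))"
    have "reg X ?b"
      by (rule reg_mult[OF \<Delta>(2) vregD[OF W.vreg_apply[OF N(1,2) regular(2)] \<xi>]])
    moreover have "(\<Delta> (\<pi> y) * \<Delta>' (\<pi> y)) ^ 1 * restrict f (pts X') y = ?b (\<pi> y)" if "y \<in> pts X'" for y
      using that by (simp add: f graph(1) N(3)[OF \<pi>_pts] lin_scale[OF \<xi>])
    ultimately show ?thesis by blast
  qed
next
  fix f g
  assume "\<exists>n b. reg X b \<and> (\<forall>y\<in>pts X'. (\<Delta> (\<pi> y) * \<Delta>' (\<pi> y)) ^ n * f y = b (\<pi> y))"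
  then obtain n b where b: "reg X b" "\<And>y. y \<in> pts X' \<Longrightarrow> (\<Delta> (\<pi> y) * \<Delta>' (\<pi> y)) ^ n * f y = b (\<pi> y)"
    by blast
  assume "\<exists>n b. reg X b \<and> (\<forall>y\<in>pts X'. (\<Delta> (\<pi> y) * \<Delta>' (\<pi> y)) ^ n * g y = b (\<pi> y))"
  then obtain m b' where b': "reg X b'" "\<And>y. y \<in> pts X' \<Longrightarrow> (\<Delta> (\<pi> y) * \<Delta>' (\<pi> y)) ^ m * g y = b' (\<pi> y)"
    by blast
  let ?t = "\<lambda>x. \<Delta> x * \<Delta>' x"
  have "reg X (\<lambda>x. ?t x ^ m * b x + ?t x ^ n * b' x)"
    by (intro reg_add reg_mult reg_power \<Delta> b b')
  moreover have "?t (\<pi> y) ^ (n + m) * (\<lambda>y\<in>pts X'. f y + g y) y = ?t (\<pi> y) ^ m * b (\<pi> y) + ?t (\<pi> y) ^ n * b' (\<pi> y)"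
    if "y \<in> pts X'" for y
    using that by (simp add: b(2)[symmetric] b'(2)[symmetric] power_add algebra_simps)
  ultimately show "\<exists>n b. reg X b \<and> (\<forall>y\<in>pts X'. ?t (\<pi> y) ^ n * (\<lambda>y\<in>pts X'. f y + g y) y = b (\<pi> y))"
    by (intro exI[of _ "n + m"] exI[of _ "\<lambda>x. ?t x ^ m * b x + ?t x ^ n * b' x"]) blast
  have "reg X (\<lambda>x. b x * b' x)"
    by (intro reg_mult b b')
  moreover have "?t (\<pi> y) ^ (n + m) * (\<lambda>y\<in>pts X'. f y * g y) y = b (\<pi> y) * b' (\<pi> y)"
    if "y \<in> pts X'" for y
    using that by (simp add: b(2)[symmetric] b'(2)[symmetric] power_add algebra_simps)
  ultimately show "\<exists>n b. reg X b \<and> (\<forall>y\<in>pts X'. ?t (\<pi> y) ^ n * (\<lambda>y\<in>pts X'. f y * g y) y = b (\<pi> y))"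
    by (intro exI[of _ "n + m"] exI[of _ "\<lambda>x. b x * b' x"]) blast
qed

text \<open>The endomorphism reconstructed from a point of \<open>X\<close>. Because 1 / 0 = 0, it
  is the zero map where \<open>\<Delta>\<close> vanishes, hence linear everywhere, and
  \<open>mk x (endo x)\<close> is a point of \<open>X'\<close> for every \<open>x\<close>.\<close>

definition endo :: "'x \<Rightarrow> 'v \<Rightarrow> 'v" where
  "endo x v = scaleV (1 / \<Delta> x) (N x (\<phi>2 x v))"

lemma endo_linear:
  assumes "x \<in> pts X"
  shows "Vector_Spaces.linear scaleV scaleV (endo x)"
  unfolding Vector_Spaces.linear_iff endo_def
  by (simp add: V.vector_space_axioms lin_add[OF lin(2)[OF assms]] lin_add[OF N(1)[OF assms]]
      lin_scale[OF lin(2)[OF assms]] lin_scale[OF N(1)[OF assms]] V.scale_right_distrib mult.commute)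

text \<open>Reconstructing \<open>c\<close> and returning to \<open>X\<close> keeps
  \<open>\<phi>1\<close> and \<open>\<theta>2\<close> and alters the other two components. The error
  is a combination of the entries of \<open>\<phi>1 \<theta>1 - \<phi>2 \<theta>2\<close> once
  denominators are cleared.\<close>

lemma graph_section_coords:
  assumes "f \<in> coords X"
  shows "\<exists>b. in_ideal X I b \<and> (\<forall>x\<in>pts X. \<Delta> x \<noteq> 0 \<longrightarrow> (\<Delta> x * \<Delta>' x) * (f x - f (\<pi> (mk x (endo x)))) = b x)"
proof -
  let ?D = "\<lambda>x u. \<phi>1 x (\<theta>1 x u) - \<phi>2 x (\<theta>2 x u)"
  have D_lin: "Vector_Spaces.linear scaleW' scaleW (?D x)" if "x \<in> pts X" for x
    unfolding Vector_Spaces.linear_iff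
    by (simp add: W.vector_space_axioms W'.vector_space_axioms lin_add[OF lin(1)[OF that]]
        lin_add[OF lin(2)[OF that]] lin_add[OF lin(3)[OF that]] lin_add[OF lin(4)[OF that]]
        lin_scale[OF lin(1)[OF that]] lin_scale[OF lin(2)[OF that]] lin_scale[OF lin(3)[OF that]]
        lin_scale[OF lin(4)[OF that]] W.scale_right_diff_distrib)
  have in_pts: "mk x (endo x) \<in> pts X'" if "x \<in> pts X" for x
    by (rule mk(1)[OF that endo_linear[OF that]])
  consider "\<forall>x\<in>pts X. \<forall>c. Vector_Spaces.linear scaleV scaleV c \<longrightarrow> f (\<pi> (mk x c)) = f x"
    | \<xi> v where "Vector_Spaces.linear scaleW (*) \<xi>" "f = (\<lambda>x. \<xi> (\<phi>2 x v))"
    | \<xi> u where "Vector_Spaces.linear scaleV (*) \<xi>" "f = (\<lambda>x. \<xi> (\<theta>1 x u))"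
    using coords_X[OF assms] by blast
  then show ?thesis
  proof cases
    case 1
    then show ?thesis
      using endo_linear in_ideal_zero[OF I] by (intro exI[of _ "\<lambda>_. 0"]) simp
  next
    case (2 \<xi> v)
    \<comment> \<open>Applying \<open>\<phi>1 N\<close> minus the scalar \<open>\<Delta>\<close> to
      the relation composed with \<open>R\<close> cancels the terms with \<open>\<theta>1\<close>,
      because \<open>N \<phi>1 = \<Delta>\<close>. Then \<open>\<theta>2 R = \<Delta>'\<close>
      leaves \<open>\<Delta>'\<close> times the difference of \<open>\<Delta> \<phi>2\<close> and
      \<open>\<phi>1 N \<phi>2\<close>.\<close>
    let ?b = "\<lambda>x. \<xi> (\<phi>1 x (N x (?D x (R x v))) - scaleW (\<Delta> x) (?D x (R x v)))"
    have D: "in_ideal_vec scaleW X I (\<lambda>x. ?D x (R x v))"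
      by (rule W'.in_ideal_vec_family[OF I D_lin rel R(1)])
    have ND: "in_ideal_vec scaleV X I (\<lambda>x. N x (?D x (R x v)))"
      by (rule W.in_ideal_vec_apply[OF I N(1,2) D])
    have \<phi>ND: "in_ideal_vec scaleW X I (\<lambda>x. \<phi>1 x (N x (?D x (R x v))))"
      by (rule V.in_ideal_vec_apply[OF I lin(1) regular(1) ND])
    have "in_ideal X I ?b"
      by (rule in_ideal_vecD[OF in_ideal_vec_diff[OF I \<phi>ND in_ideal_vec_scale[OF I \<Delta>(1) D]] 2(1)])
    moreover have "\<Delta> x * \<Delta>' x * (f x - f (\<pi> (mk x (endo x)))) = ?b x"
      if x: "x \<in> pts X" and \<Delta>0: "\<Delta> x \<noteq> 0" for x
    proof -
      note l = lin_scale[OF lin(1)[OF x]] lin_scale[OF lin(2)[OF x]] lin_scale[OF N(1)[OF x]]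
        lin_diff[OF lin(1)[OF x]] lin_diff[OF N(1)[OF x]]
        lin_scale[OF 2(1)] lin_diff[OF 2(1)]
      have f': "f (\<pi> (mk x (endo x))) = \<xi> (\<phi>1 x (endo x v))"
        using graph(1)[OF in_pts[OF x]] mk(2,4)[OF x endo_linear[OF x]] by (simp add: 2(2))
      have "?b x = \<Delta> x * \<xi> (\<phi>2 x (\<theta>2 x (R x v))) - \<xi> (\<phi>1 x (N x (\<phi>2 x (\<theta>2 x (R x v)))))"
        by (simp add: l N(3)[OF x] algebra_simps)
      also have "\<dots> = \<Delta> x * \<Delta>' x * \<xi> (\<phi>2 x v) - \<Delta>' x * \<xi> (\<phi>1 x (N x (\<phi>2 x v)))"
        by (simp add: l R(2)[OF x] algebra_simps)
      also have "\<dots> = \<Delta> x * \<Delta>' x * (f x - f (\<pi> (mk x (endo x))))"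
        unfolding f' using \<Delta>0 by (simp add: endo_def l 2(2) field_simps)
      finally show ?thesis by simp
    qed
    ultimately show ?thesis by blast
  next
    case (3 \<xi> u)
    \<comment> \<open>Applying \<open>N\<close> to the relation gives
      \<open>\<Delta> \<theta>1 - N \<phi>2 \<theta>2\<close>, which is \<open>\<Delta>\<close>
      times the error in \<open>\<theta>1\<close>.\<close>
    let ?b = "\<lambda>x. \<Delta>' x * \<xi> (N x (?D x u))"
    have "in_ideal X I ?b"
      by (rule in_ideal_mult[OF I \<Delta>(2) in_ideal_vecD[OF W.in_ideal_vec_apply[OF I N(1,2) rel] 3(1)]])
    moreover have "\<Delta> x * \<Delta>' x * (f x - f (\<pi> (mk x (endo x)))) = ?b x"
      if x: "x \<in> pts X" and \<Delta>0: "\<Delta> x \<noteq> 0" for x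
    proof -
      have f': "f (\<pi> (mk x (endo x))) = \<xi> (endo x (\<theta>2 x u))"
        using graph(2)[OF in_pts[OF x]] mk(3,4)[OF x endo_linear[OF x]] by (simp add: 3(2))
      show ?thesis
        unfolding f' using \<Delta>0
        by (simp add: 3(2) endo_def lin_scale[OF 3(1)] lin_diff[OF 3(1)] lin_diff[OF N(1)[OF x]]
            N(3)[OF x] field_simps)
    qed
    ultimately show ?thesis by blast
  qed
qed

lemma graph_section:
  assumes "f \<in> regular X"
  shows "\<exists>n b. in_ideal X I b \<and> (\<forall>x\<in>pts X. \<Delta> x \<noteq> 0 \<longrightarrow>
    (\<Delta> x * \<Delta>' x) ^ n * (f x - f (\<pi> (mk x (endo x)))) = b x)"
  using assms
proof (rule regular_induct)
  have in_pts: "\<pi> (mk x (endo x)) \<in> pts X" if "x \<in> pts X" for x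
    by (rule \<pi>_pts[OF mk(1)[OF that endo_linear[OF that]]])
  let ?t = "\<lambda>x. \<Delta> x * \<Delta>' x"
  let ?\<rho> = "\<lambda>x. \<pi> (mk x (endo x))"
  {
    fix a
    show "\<exists>n b. in_ideal X I b \<and> (\<forall>x\<in>pts X. \<Delta> x \<noteq> 0 \<longrightarrow> ?t x ^ n * ((\<lambda>x\<in>pts X. a) x - (\<lambda>x\<in>pts X. a) (?\<rho> x)) = b x)"
      using in_ideal_zero[OF I] in_pts by (intro exI[of _ 0] exI[of _ "\<lambda>_. 0"]) simp
  next
    fix f assume "f \<in> coords X"
    from graph_section_coords[OF this] obtain b
      where "in_ideal X I b" "\<forall>x\<in>pts X. \<Delta> x \<noteq> 0 \<longrightarrow> ?t x * (f x - f (?\<rho> x)) = b x" by blast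
    then show "\<exists>n b. in_ideal X I b \<and> (\<forall>x\<in>pts X. \<Delta> x \<noteq> 0 \<longrightarrow> ?t x ^ n * (restrict f (pts X) x - restrict f (pts X) (?\<rho> x)) = b x)"
      using in_pts by (intro exI[of _ 1] exI[of _ b]) simp
  next
    fix f g
    assume "\<exists>n b. in_ideal X I b \<and> (\<forall>x\<in>pts X. \<Delta> x \<noteq> 0 \<longrightarrow> ?t x ^ n * (f x - f (?\<rho> x)) = b x)"
    then obtain n b where b: "in_ideal X I b" "\<And>x. x \<in> pts X \<Longrightarrow> \<Delta> x \<noteq> 0 \<Longrightarrow> ?t x ^ n * (f x - f (?\<rho> x)) = b x"
      by blast
    assume "\<exists>n b. in_ideal X I b \<and> (\<forall>x\<in>pts X. \<Delta> x \<noteq> 0 \<longrightarrow> ?t x ^ n * (g x - g (?\<rho> x)) = b x)"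
    then obtain m b' where b': "in_ideal X I b'" "\<And>x. x \<in> pts X \<Longrightarrow> \<Delta> x \<noteq> 0 \<Longrightarrow> ?t x ^ m * (g x - g (?\<rho> x)) = b' x"
      by blast
    have "in_ideal X I (\<lambda>x. ?t x ^ m * b x + ?t x ^ n * b' x)"
      by (intro in_ideal_add[OF I] in_ideal_mult[OF I] reg_power reg_mult \<Delta> b b')
    moreover have "?t x ^ (n + m) * ((\<lambda>x\<in>pts X. f x + g x) x - (\<lambda>x\<in>pts X. f x + g x) (?\<rho> x)) = ?t x ^ m * b x + ?t x ^ n * b' x"
      if "x \<in> pts X" "\<Delta> x \<noteq> 0" for x
      using that in_pts by (simp add: b(2)[symmetric] b'(2)[symmetric] power_add algebra_simps)
    ultimately show "\<exists>n b. in_ideal X I b \<and> (\<forall>x\<in>pts X. \<Delta> x \<noteq> 0 \<longrightarrow>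
        ?t x ^ n * ((\<lambda>x\<in>pts X. f x + g x) x - (\<lambda>x\<in>pts X. f x + g x) (?\<rho> x)) = b x)"
      by (intro exI[of _ "n + m"] exI[of _ "\<lambda>x. ?t x ^ m * b x + ?t x ^ n * b' x"]) blast
    assume fg: "f \<in> regular X" "g \<in> regular X"
    \<comment> \<open>With f' and g' for the composites with \<open>?\<rho>\<close>, this is the
      expansion f g - f' g' = g (f - f') + f (g - g') - (f - f') (g - g'). The form avoids f' and
      g', which involve division by \<open>\<Delta>\<close> and need not be regular.\<close>
    have "in_ideal X I (\<lambda>x. (?t x ^ m * g x) * b x + ((?t x ^ n * f x) * b' x + (- b x) * b' x))"
      using fg
      by (intro in_ideal_add[OF I] in_ideal_mult[OF I] reg_power reg_mult reg_uminus \<Delta> b b'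
          in_ideal_reg[OF I] reg_regular)
    moreover have "?t x ^ (n + m) * ((\<lambda>x\<in>pts X. f x * g x) x - (\<lambda>x\<in>pts X. f x * g x) (?\<rho> x))
        = (?t x ^ m * g x) * b x + ((?t x ^ n * f x) * b' x + (- b x) * b' x)"
      if "x \<in> pts X" "\<Delta> x \<noteq> 0" for x
      using that in_pts by (simp add: b(2)[symmetric] b'(2)[symmetric] power_add algebra_simps)
    ultimately show "\<exists>n b. in_ideal X I b \<and> (\<forall>x\<in>pts X. \<Delta> x \<noteq> 0 \<longrightarrow>
        ?t x ^ n * ((\<lambda>x\<in>pts X. f x * g x) x - (\<lambda>x\<in>pts X. f x * g x) (?\<rho> x)) = b x)"
      by (intro exI[of _ "n + m"]
          exI[of _ "\<lambda>x. (?t x ^ m * g x) * b x + ((?t x ^ n * f x) * b' x + (- b x) * b' x)"]) blast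
  }
qed

lemma graph_inj:
  assumes "a \<in> regular X" "\<And>y. y \<in> pts X' \<Longrightarrow> a (\<pi> y) = 0"
  shows "\<exists>n. in_ideal X I (\<lambda>x. (\<Delta> x * \<Delta>' x) ^ n * a x)"
proof -
  obtain n b where b: "in_ideal X I b"
    "\<And>x. x \<in> pts X \<Longrightarrow> \<Delta> x \<noteq> 0 \<Longrightarrow> (\<Delta> x * \<Delta>' x) ^ n * (a x - a (\<pi> (mk x (endo x)))) = b x"
    using graph_section[OF assms(1)] by blast
  \<comment> \<open>The identity for \<open>b\<close> is known only where \<open>\<Delta>\<close>
    does not vanish. One more factor makes both sides zero at the remaining points, so that it
    becomes an equality of functions on all of \<open>X\<close>.\<close>
  have "in_ideal X I (\<lambda>x. (\<Delta> x * \<Delta>' x) * b x)"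
    by (intro in_ideal_mult[OF I] reg_mult \<Delta> b)
  then have "in_ideal X I (\<lambda>x. (\<Delta> x * \<Delta>' x) ^ Suc n * a x)"
  proof (rule in_ideal_cong)
    fix x assume x: "x \<in> pts X"
    have "a (\<pi> (mk x (endo x))) = 0" by (rule assms(2)[OF mk(1)[OF x endo_linear[OF x]]])
    then show "\<Delta> x * \<Delta>' x * b x = (\<Delta> x * \<Delta>' x) ^ Suc n * a x"
      using b(2)[OF x] by (cases "\<Delta> x = 0") (simp_all add: mult.assoc)
  qed
  then show ?thesis by blast
qed

lemma graph_stalk_iso:
  assumes g: "ring_hom_cring (coord_ring X Quot I) (coord_ring X') g"
      "\<And>a. a \<in> regular X \<Longrightarrow> g (I +>\<^bsub>coord_ring X\<^esub> a) = comap X' \<pi> a"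
    and q: "q \<in> Spec (coord_ring X Quot I)"
    and x: "x = spec_map (coord_ring X) (\<lambda>f. I +>\<^bsub>coord_ring X\<^esub> f) q"
    and t: "\<not> in_ideal X x \<Delta>" "\<not> in_ideal X x \<Delta>'"
  shows "stalk_iso (coord_ring X Quot I) (coord_ring X') g q"
proof -
  interpret A: cring "coord_ring X" by (rule coord_ring_cring)
  interpret I: ideal I "coord_ring X" by (rule I)
  have xs: "x \<in> Spec (coord_ring X)"
    unfolding x by (rule spec_map_Spec[OF I.rcos_ring_hom_cring[OF A.is_cring] q])
  let ?t = "\<lambda>x\<in>pts X. \<Delta> x * \<Delta>' x"
  have "?t = restrict \<Delta> (pts X) \<otimes>\<^bsub>coord_ring X\<^esub> restrict \<Delta>' (pts X)"
    by (simp cong: restrict_cong)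
  moreover have "restrict \<Delta> (pts X) \<otimes>\<^bsub>coord_ring X\<^esub> restrict \<Delta>' (pts X) \<in> x
      \<longleftrightarrow> restrict \<Delta> (pts X) \<in> x \<or> restrict \<Delta>' (pts X) \<in> x"
    by (rule A.Spec_mult_iff[OF xs]) (use \<Delta> in simp_all)
  ultimately have "?t \<notin> x" using t unfolding in_ideal_def by simp
  moreover have "?t \<in> regular X" using \<Delta> by (simp add: reg_mult)
  moreover have "\<exists>n b. b \<in> regular X \<and> (\<forall>y\<in>pts X'. ?t (\<pi> y) ^ n * c y = b (\<pi> y))"
    if c: "c \<in> regular X'" for c
  proof -
    obtain n b where "reg X b" "\<forall>y\<in>pts X'. (\<Delta> (\<pi> y) * \<Delta>' (\<pi> y)) ^ n * c y = b (\<pi> y)"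
      using graph_surj[OF c] by blast
    then show ?thesis
      by (intro exI[of _ n] exI[of _ "restrict b (pts X)"]) (simp add: \<pi>_pts)
  qed
  moreover have "\<exists>n. in_ideal X I (\<lambda>x. ?t x ^ n * a x)"
    if a: "a \<in> regular X" "\<And>y. y \<in> pts X' \<Longrightarrow> a (\<pi> y) = 0" for a
  proof -
    obtain n where "in_ideal X I (\<lambda>x. (\<Delta> x * \<Delta>' x) ^ n * a x)" using graph_inj[OF a] by blast
    then have "in_ideal X I (\<lambda>x. ?t x ^ n * a x)" by (rule in_ideal_cong) simp
    then show ?thesis by blast
  qed
  ultimately show ?thesis
    unfolding x by (intro stalk_iso_coord[OF \<pi> I g q, of ?t]) blast+
qed

end

end

section \<open>Morphisms between spaces of linear maps\<close>

lemma morphism_id: "morphism X X (\<lambda>x. x)"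
  by (simp add: morphism_def reg_coord)

lemma morphism_comp:
  assumes "morphism T X m" "morphism X Y n"
  shows "morphism T Y (\<lambda>t. n (m t))"
proof -
  have "reg T (\<lambda>x. f (n (m x)))" if "f \<in> coords Y" for f
    using morphism_reg[OF assms(1), of "\<lambda>x. f (n x)"] assms(2) that by (simp add: morphism_def)
  then show ?thesis
    unfolding morphism_def using morphism_pts[OF assms(1)] morphism_pts[OF assms(2)] by auto
qed

lemma morphism_cong:
  assumes "morphism T X m" "\<And>t. t \<in> pts T \<Longrightarrow> m t = m' t"
  shows "morphism T X m'"
  unfolding morphism_def
proof (intro conjI ballI funcsetI)
  fix t assume "t \<in> pts T" then show "m' t \<in> pts X"
    using morphism_pts[OF assms(1)] assms(2) by metis
next
  fix f assume "f \<in> coords X"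
  then have "reg T (\<lambda>x. f (m x))" using assms(1) by (simp add: morphism_def)
  then show "reg T (\<lambda>x. f (m' x))" by (rule reg_cong) (simp add: assms(2))
qed

lemma vprod_simps: "pts (vprod X Y) = pts X \<times> pts Y"
  "coords (vprod X Y) = (\<lambda>f. f \<circ> fst) ` coords X \<union> (\<lambda>f. f \<circ> snd) ` coords Y"
  by (simp_all add: vprod_def)

lemma morphism_fst: "morphism (vprod X Y) X fst"
  unfolding morphism_def
proof (intro conjI ballI funcsetI)
  fix f assume "f \<in> coords X"
  then have "f \<circ> fst \<in> coords (vprod X Y)" by (auto simp: vprod_simps)
  then show "reg (vprod X Y) (\<lambda>x. f (fst x))" using reg_coord by (fastforce simp: comp_def)
qed (auto simp: vprod_simps)

lemma morphism_snd: "morphism (vprod X Y) Y snd"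
  unfolding morphism_def
proof (intro conjI ballI funcsetI)
  fix f assume "f \<in> coords Y"
  then have "f \<circ> snd \<in> coords (vprod X Y)" by (auto simp: vprod_simps)
  then show "reg (vprod X Y) (\<lambda>x. f (snd x))" using reg_coord by (fastforce simp: comp_def)
qed (auto simp: vprod_simps)

lemma morphism_pair:
  "morphism T X m \<Longrightarrow> morphism T Y n \<Longrightarrow> morphism T (vprod X Y) (\<lambda>t. (m t, n t))"
  by (auto simp: morphism_def vprod_simps)

lemma Hom_var_simps: "pts (Hom_var sA sB) = {f. Vector_Spaces.linear sA sB f}"
  "coords (Hom_var sA sB) = {(\<lambda>f. \<xi> (f a)) | \<xi> a. Vector_Spaces.linear sB (*) \<xi>}"
  by (simp_all add: Hom_var_def)

lemma morphism_Hom_iff: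
  "morphism T (Hom_var sA sB) m \<longleftrightarrow>
    (\<forall>t\<in>pts T. Vector_Spaces.linear sA sB (m t)) \<and> (\<forall>a. vreg sB T (\<lambda>t. m t a))"
  unfolding morphism_def Hom_var_simps vreg_def by auto

lemma GL_var_simps: "pts (GL_var sA) = {g. Vector_Spaces.linear sA sA g \<and> bij g}"
  by (simp add: GL_var_def)

lemma inv_linear:
  assumes "Vector_Spaces.linear sA sA g" "bij g"
  shows "Vector_Spaces.linear sA sA (inv_into UNIV g)"
proof -
  have "inv_into UNIV g (a + b) = inv_into UNIV g a + inv_into UNIV g b" for a b
    using lin_add[OF assms(1), of "inv_into UNIV g a" "inv_into UNIV g b"] assms(2)
    by (metis bij_inv_eq_iff)
  moreover have "inv_into UNIV g (sA r a) = sA r (inv_into UNIV g a)" for r a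
    using lin_scale[OF assms(1), of r "inv_into UNIV g a"] assms(2) by (metis bij_inv_eq_iff)
  ultimately show ?thesis using assms(1) by (simp add: Vector_Spaces.linear_iff)
qed

lemma morphism_GL_Hom: "morphism (GL_var sA) (Hom_var sA sA) (\<lambda>g. g)"
proof -
  have "(\<lambda>g. \<xi> (g a)) \<in> coords (GL_var sA)" if "Vector_Spaces.linear sA (*) \<xi>" for \<xi> a
    using that unfolding GL_var_def variety.simps by blast
  then show ?thesis unfolding morphism_Hom_iff vreg_def GL_var_simps using reg_coord by blast
qed

lemma morphism_GL_inv: "morphism (GL_var sA) (Hom_var sA sA) (inv_into UNIV)"
proof -
  have "(\<lambda>g. \<xi> (inv_into UNIV g a)) \<in> coords (GL_var sA)" if "Vector_Spaces.linear sA (*) \<xi>" for \<xi> a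
    using that unfolding GL_var_def variety.simps by blast
  then show ?thesis
    unfolding morphism_Hom_iff vreg_def GL_var_simps using reg_coord inv_linear by blast
qed

lemma (in finite_dimensional_vector_space) morphism_compose:
  assumes "morphism T (Hom_var sA scale) m" "morphism T (Hom_var scale sC) n"
  shows "morphism T (Hom_var sA sC) (\<lambda>t. n t \<circ> m t)"
proof -
  have m: "\<And>t. t \<in> pts T \<Longrightarrow> Vector_Spaces.linear sA scale (m t)" "\<And>a. vreg scale T (\<lambda>t. m t a)"
    and n: "\<And>t. t \<in> pts T \<Longrightarrow> Vector_Spaces.linear scale sC (n t)" "\<And>a. vreg sC T (\<lambda>t. n t a)"
    using assms unfolding morphism_Hom_iff by simp_all
  have "vreg sC T (\<lambda>t. (n t \<circ> m t) a)" for a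
    using vreg_apply[OF n m(2)] by simp
  then show ?thesis
    unfolding morphism_Hom_iff using Vector_Spaces.linear_compose[OF m(1) n(1)] by simp
qed

section \<open>Invariants agree along the graph of an endomorphism\<close>

lemma regular_curve_poly:
  fixes \<gamma> :: "'k::field \<Rightarrow> 'x"
  assumes "\<And>r. \<gamma> r \<in> pts X" "\<And>f. f \<in> coords X \<Longrightarrow> \<exists>P. \<forall>r. f (\<gamma> r) = poly P r"
    and "f \<in> regular X"
  shows "\<exists>P. \<forall>r. f (\<gamma> r) = poly P r"
  using assms(3)
proof (rule regular_induct)
  show "\<exists>P. \<forall>r. (\<lambda>x\<in>pts X. a) (\<gamma> r) = poly P r" for a
    using assms(1) by (intro exI[of _ "[:a:]"]) simp
  show "\<exists>P. \<forall>r. restrict f (pts X) (\<gamma> r) = poly P r" if "f \<in> coords X" for f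
    using assms(1,2) that by simp
  fix f g assume "\<exists>P. \<forall>r. f (\<gamma> r) = poly P r" "\<exists>P. \<forall>r. g (\<gamma> r) = poly P r"
  then obtain P Q where "\<forall>r. f (\<gamma> r) = poly P r" "\<forall>r. g (\<gamma> r) = poly Q r" by blast
  then show "\<exists>P. \<forall>r. (\<lambda>x\<in>pts X. f x + g x) (\<gamma> r) = poly P r"
    and "\<exists>P. \<forall>r. (\<lambda>x\<in>pts X. f x * g x) (\<gamma> r) = poly P r"
    using assms(1) by (intro exI[of _ "P + Q"], simp, intro exI[of _ "P * Q"], simp)
qed

text \<open>Characteristic zero enters through the infinitude of \<open>k\<close>: the difference
  would have every nonzero scalar as a root.\<close>

lemma poly_eq_of_punctured:
  fixes P Q :: "'k::field_char_0 poly"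
  assumes "\<And>r. r \<noteq> 0 \<Longrightarrow> poly P r = poly Q r"
  shows "P = Q"
proof (rule ccontr)
  assume "P \<noteq> Q"
  then have "finite {r. poly (P - Q) r = 0}" by (intro poly_roots_finite) simp
  moreover have "UNIV - {0} \<subseteq> {r. poly (P - Q) r = 0}" using assms by auto
  ultimately have "finite (UNIV - {0 :: 'k})" by (rule finite_subset[rotated])
  then show False using infinite_UNIV_char_0[where 'a = 'k] by simp
qed

context three_spaces
begin

lemma pts_Z: "z \<in> pts Z \<longleftrightarrow>
    Vector_Spaces.linear scaleV scaleW (fst z) \<and> Vector_Spaces.linear scaleW' scaleV (snd z)"
  by (cases z) (simp add: Z_def vprod_simps Hom_var_simps)

lemma pts_QZ: "y \<in> pts QZ \<longleftrightarrow> Vector_Spaces.linear scaleV scaleW (fst y) \<and>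
    Vector_Spaces.linear scaleW' scaleV (fst (snd y)) \<and> Vector_Spaces.linear scaleV scaleV (snd (snd y))"
  by (cases y) (auto simp: QZ_def vprod_simps Hom_var_simps)

lemma pts_G: "g \<in> pts G \<longleftrightarrow> Vector_Spaces.linear scaleV scaleV g \<and> bij g"
  by (simp add: G_def GL_var_simps)

lemma Z_phi: "morphism Z (Hom_var scaleV scaleW) fst"
  and Z_theta: "morphism Z (Hom_var scaleW' scaleV) snd"
  unfolding Z_def by (rule morphism_fst morphism_snd)+

lemma kernel_subspace: "Vector_Spaces.linear scaleV scaleV d \<Longrightarrow> V.subspace {v. d v = 0}"
  by (simp add: V.subspace_def lin_add lin_scale lin_zero)

lemma perturb_linear:
  assumes c: "Vector_Spaces.linear scaleV scaleV c" and n: "Vector_Spaces.linear scaleV scaleV n"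
  shows "Vector_Spaces.linear scaleV scaleV (\<lambda>v. c v + scaleV r (n v))"
  unfolding Vector_Spaces.linear_iff
  by (simp add: V.vector_space_axioms lin_add[OF c] lin_add[OF n] lin_scale[OF c] lin_scale[OF n]
      V.scale_right_distrib add_ac V.scale_left_commute)

text \<open>If \<open>v0 \<noteq> 0\<close> is in the kernel of \<open>c\<close> and \<open>w0\<close> is not in its image, then
  \<open>c + r (\<lambda> w0)\<close> with \<open>\<lambda> v0 \<noteq> 0\<close> has a smaller kernel for all \<open>r \<noteq> 0\<close>.\<close>

lemma shrink_kernel:
  assumes c: "Vector_Spaces.linear scaleV scaleV c" and "\<not> bij c"
  obtains n where "Vector_Spaces.linear scaleV scaleV n"
    "\<And>r. r \<noteq> 0 \<Longrightarrow> V.dim {v. c v + scaleV r (n v) = 0} < V.dim {v. c v = 0}"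
proof -
  interpret VV: finite_dimensional_vector_space_pair scaleV BV scaleV BV ..
  interpret c: Vector_Spaces.linear scaleV scaleV c by (rule c)
  \<comment> \<open>In finite dimension an endomorphism that is not bijective fails both conditions;
    the construction needs a kernel vector and a vector outside the image at once.\<close>
  have "\<not> inj c" "\<not> surj c"
    using assms VV.linear_injective_imp_surjective[OF c] VV.linear_surjective_imp_injective[OF c]
    by (auto simp: bij_def)
  then obtain v0 w0 where v0: "c v0 = 0" "v0 \<noteq> 0" and w0: "w0 \<notin> range c"
    by (auto simp: c.inj_iff_eq_0)
  have "\<exists>b. V.crd v0 b \<noteq> 0"
  proof (rule ccontr)
    assume "\<not> ?thesis"
    then show False using V.crd_sum[of v0] v0(2) by simp
  qed
  then obtain b where b: "V.crd v0 b \<noteq> 0" by blast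
  define n where "n v = scaleV (V.crd v b) w0" for v
  note crd = lin_add[OF V.crd_linear] lin_scale[OF V.crd_linear]
  have n: "Vector_Spaces.linear scaleV scaleV n"
    unfolding Vector_Spaces.linear_iff n_def
    by (simp add: V.vector_space_axioms crd V.scale_left_distrib)
  show thesis
  proof (rule that[OF n])
    fix r :: 'k assume r: "r \<noteq> 0"
    let ?K = "{v. c v = 0}" and ?K' = "{v. c v + scaleV r (n v) = 0}"
    \<comment> \<open>If the coordinate of \<open>v\<close> at \<open>b\<close> were nonzero,
      \<open>w0\<close> would be a multiple of \<open>c v\<close> and so in the image. Hence the
      perturbation vanishes on \<open>v\<close>, and \<open>c v = 0\<close>; the vector
      \<open>v0\<close>, whose coordinate is nonzero, makes the inclusion strict.\<close>
    have sub: "?K' \<subseteq> {v \<in> ?K. V.crd v b = 0}"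
    proof
      fix v assume "v \<in> ?K'"
      then have eq: "c v = - scaleV (r * V.crd v b) w0" by (simp add: n_def eq_neg_iff_add_eq_0)
      have "V.crd v b = 0"
      proof (rule ccontr)
        assume k: "V.crd v b \<noteq> 0"
        have "c (scaleV (- 1 / (r * V.crd v b)) v) = w0"
          using r k by (simp add: c.scale c.neg eq)
        then show False using w0 by (metis rangeI)
      qed
      then show "v \<in> {v \<in> ?K. V.crd v b = 0}" using eq by simp
    qed
    have "V.subspace ?K" "V.subspace ?K'"
      by (rule kernel_subspace, rule c) (rule kernel_subspace, rule perturb_linear[OF c n])
    then have "V.span ?K = ?K" "V.span ?K' = ?K'" by (simp_all only: V.span_eq_iff)
    moreover have "v0 \<notin> ?K'" using sub b by blast
    moreover have "v0 \<in> ?K" "?K' \<subseteq> ?K" using sub v0(1) by auto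
    ultimately have "V.span ?K' \<subset> V.span ?K" by blast
    then show "V.dim ?K' < V.dim ?K" by (rule V.dim_psubset)
  qed
qed

text \<open>Induction on the dimension of the kernel takes the place of the density of GL(V) in
  End(V), so that only polynomials in one variable are involved.\<close>

lemma invariant_graph:
  assumes f: "f \<in> invariants"
    and "Vector_Spaces.linear scaleV scaleW \<phi>" "Vector_Spaces.linear scaleW' scaleV \<theta>"
    and "Vector_Spaces.linear scaleV scaleV c"
  shows "f (\<phi>, c \<circ> \<theta>) = f (\<phi> \<circ> c, \<theta>)"
  using assms(4)
proof (induction "V.dim {v. c v = 0}" arbitrary: c rule: less_induct)
  case less
  note c = less.prems
  have \<phi>\<theta>: "Vector_Spaces.linear scaleV scaleW (\<phi> \<circ> c)" "Vector_Spaces.linear scaleW' scaleV (c \<circ> \<theta>)"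
    if "Vector_Spaces.linear scaleV scaleV c" for c
    using assms(2,3) that by (auto intro: Vector_Spaces.linear_compose)
  show ?case
  proof (cases "bij c")
    case True
    \<comment> \<open>For bijective \<open>c\<close> the two pairs lie in the same orbit:
      \<open>c\<close> itself carries one to the other.\<close>
    then have "f (actZ c (\<phi> \<circ> c, \<theta>)) = f (\<phi> \<circ> c, \<theta>)"
      using f c assms(3) \<phi>\<theta>[OF c] by (simp add: invariants_def pts_G pts_Z)
    moreover have "actZ c (\<phi> \<circ> c, \<theta>) = (\<phi>, c \<circ> \<theta>)"
      using True by (auto simp: actZ_def fun_eq_iff bij_is_surj surj_f_inv_f)
    ultimately show ?thesis by simp
  next
    case False
    from shrink_kernel[OF c False] obtain n where n: "Vector_Spaces.linear scaleV scaleV n"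
      "\<And>r. r \<noteq> 0 \<Longrightarrow> V.dim {v. c v + scaleV r (n v) = 0} < V.dim {v. c v = 0}" by metis
    define d where "d r v = c v + scaleV r (n v)" for r v
    have d: "Vector_Spaces.linear scaleV scaleV (d r)" for r
      unfolding d_def[abs_def] by (rule perturb_linear[OF c n(1)])
    have fZ: "f \<in> regular Z" using f by (simp add: invariants_def)
    have "\<exists>P. \<forall>r. f (\<phi>, d r \<circ> \<theta>) = poly P r"
    proof (rule regular_curve_poly[OF _ _ fZ])
      show "(\<phi>, d r \<circ> \<theta>) \<in> pts Z" for r using assms(2) \<phi>\<theta>[OF d] by (simp add: pts_Z)
      fix f assume "f \<in> coords Z"
      then consider a \<xi> where "f = (\<lambda>x. \<xi> (fst x a))"
        | a \<xi> where "f = (\<lambda>x. \<xi> (snd x a))" "Vector_Spaces.linear scaleV (*) \<xi>"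
        by (auto simp: Z_def vprod_simps Hom_var_simps comp_def)
      then show "\<exists>P. \<forall>r. f (\<phi>, d r \<circ> \<theta>) = poly P r"
      proof cases
        case (1 a \<xi>)
        then show ?thesis by (intro exI[of _ "[:\<xi> (\<phi> a):]"]) simp
      next
        case (2 a \<xi>)
        then show ?thesis
          by (intro exI[of _ "[:\<xi> (c (\<theta> a)), \<xi> (n (\<theta> a)):]"])
            (simp add: d_def lin_add[OF 2(2)] lin_scale[OF 2(2)])
      qed
    qed
    then obtain P where P: "\<And>r. f (\<phi>, d r \<circ> \<theta>) = poly P r" by blast
    have "\<exists>P. \<forall>r. f (\<phi> \<circ> d r, \<theta>) = poly P r"
    proof (rule regular_curve_poly[OF _ _ fZ])
      show "(\<phi> \<circ> d r, \<theta>) \<in> pts Z" for r using assms(3) \<phi>\<theta>[OF d] by (simp add: pts_Z)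
      fix f assume "f \<in> coords Z"
      then consider a \<xi> where "f = (\<lambda>x. \<xi> (snd x a))"
        | a \<xi> where "f = (\<lambda>x. \<xi> (fst x a))" "Vector_Spaces.linear scaleW (*) \<xi>"
        by (auto simp: Z_def vprod_simps Hom_var_simps comp_def)
      then show "\<exists>P. \<forall>r. f (\<phi> \<circ> d r, \<theta>) = poly P r"
      proof cases
        case (1 a \<xi>)
        then show ?thesis by (intro exI[of _ "[:\<xi> (\<theta> a):]"]) simp
      next
        case (2 a \<xi>)
        then show ?thesis
          by (intro exI[of _ "[:\<xi> (\<phi> (c a)), \<xi> (\<phi> (n a)):]"])
            (simp add: d_def lin_add[OF 2(2)] lin_scale[OF 2(2)] lin_add[OF assms(2)] lin_scale[OF assms(2)])
      qed
    qed
    then obtain Q where Q: "\<And>r. f (\<phi> \<circ> d r, \<theta>) = poly Q r" by blast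
    have "P = Q"
    proof (rule poly_eq_of_punctured)
      fix r :: 'k assume "r \<noteq> 0"
      then have "f (\<phi>, d r \<circ> \<theta>) = f (\<phi> \<circ> d r, \<theta>)"
        using less.hyps[OF _ d, of r] n(2) by (simp add: d_def)
      then show "poly P r = poly Q r" by (simp add: P Q)
    qed
    moreover have "d 0 = c" by (simp add: d_def fun_eq_iff)
    ultimately show ?thesis using P[of 0] Q[of 0] by simp
  qed
qed

end

section \<open>Inverses on the loci of full rank\<close>

lemma indep_cols_at_columns:
  assumes "finite S" "\<And>i j. M i j \<in> regular X" "indep_cols_at (coord_ring X) x I M S"
  shows "indep_columns X x I S M"
  unfolding indep_columns_def
proof (intro allI impI ballI)
  fix a j assume a: "\<forall>j. reg X (a j)"
    and rel: "\<forall>i\<in>I. in_ideal X x (\<lambda>z. \<Sum>j\<in>S. M i j z * a j z)" and j: "j \<in> S"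
  define a' where "a' j = restrict (a j) (pts X)" for j
  have a': "a' \<in> S \<rightarrow> carrier (coord_ring X)" using a by (simp add: a'_def)
  have "(\<Oplus>\<^bsub>coord_ring X\<^esub>j\<in>S. M i j \<otimes>\<^bsub>coord_ring X\<^esub> a' j) \<in> x" if "i \<in> I" for i
  proof -
    have "(\<Oplus>\<^bsub>coord_ring X\<^esub>j\<in>S. M i j \<otimes>\<^bsub>coord_ring X\<^esub> a' j)
        = (\<lambda>z\<in>pts X. \<Sum>j\<in>S. (M i j \<otimes>\<^bsub>coord_ring X\<^esub> a' j) z)"
    proof (rule coord_ring_finsum[OF assms(1)])
      show "M i j \<otimes>\<^bsub>coord_ring X\<^esub> a' j \<in> regular X" for j
        using reg_mult[OF reg_regular[OF assms(2)[of i j]], of "a' j"] a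
        by (simp add: a'_def reg_regular)
    qed
    also have "\<dots> = (\<lambda>z\<in>pts X. \<Sum>j\<in>S. M i j z * a j z)"
      by (rule extensionalityI[where A = "pts X"]) (simp_all add: a'_def)
    finally show ?thesis using rel that by (simp add: in_ideal_def)
  qed
  with assms(3) a' have "\<forall>j\<in>S. a' j \<in> x" unfolding indep_cols_at_def by blast
  then show "in_ideal X x (a j)" using j by (simp add: a'_def in_ideal_def)
qed

lemma rank_at_columns:
  assumes J: "finite J" and "\<And>i j. M i j \<in> regular X" and rank: "rank_at (coord_ring X) x I J M = n"
  obtains S where "S \<subseteq> J" "card S = n" "indep_columns X x I S M"
proof -
  let ?C = "{card S | S. S \<subseteq> J \<and> indep_cols_at (coord_ring X) x I M S}"
  have "?C \<subseteq> card ` Pow J" by auto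
  then have "finite ?C" by (rule finite_subset) (simp add: J)
  moreover have "card {} \<in> ?C" by (auto simp: indep_cols_at_def intro!: exI[of _ "{}"])
  ultimately have "Max ?C \<in> ?C" by (intro Max_in) auto
  then obtain S where S: "S \<subseteq> J" "indep_cols_at (coord_ring X) x I M S" "card S = n"
    using rank unfolding rank_at_def by auto
  then show thesis using that indep_cols_at_columns[OF finite_subset[OF S(1) J] assms(2) S(2)] by blast
qed

context three_spaces
begin

text \<open>The family \<open>\<phi>\<close> is split injective over the local ring at
  \<open>x\<close>, with \<open>N\<close> / \<open>\<Delta>\<close> as left inverse. With the
  denominator cleared, the witness is defined on all of \<open>T\<close> and can be pulled back
  along morphisms.\<close>

definition left_inv where
  "left_inv T x \<phi> \<longleftrightarrow> (\<exists>N \<Delta>. morphism T (Hom_var scaleW scaleV) N \<and>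
     (\<forall>t\<in>pts T. \<forall>v. N t (\<phi> t v) = scaleV (\<Delta> t) v) \<and> reg T \<Delta> \<and> \<not> in_ideal T x \<Delta>)"

definition right_inv where
  "right_inv T x \<theta> \<longleftrightarrow> (\<exists>R \<Delta>. morphism T (Hom_var scaleV scaleW') R \<and>
     (\<forall>t\<in>pts T. \<forall>v. \<theta> t (R t v) = scaleV (\<Delta> t) v) \<and> reg T \<Delta> \<and> \<not> in_ideal T x \<Delta>)"

lemma not_in_ideal_pullback:
  assumes "morphism T Y m" "reg Y \<Delta>" "\<not> in_ideal Y (spec_map (coord_ring Y) (comap T m) x) \<Delta>"
  shows "\<not> in_ideal T x (\<lambda>t. \<Delta> (m t))"
proof -
  have "comap T m (restrict \<Delta> (pts Y)) = (\<lambda>t\<in>pts T. \<Delta> (m t))"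
    by (rule extensionalityI[where A = "pts T"]) (simp_all add: comap_def morphism_pts[OF assms(1)])
  then show ?thesis using assms(2,3) by (simp add: in_ideal_def spec_map_def)
qed

lemma left_inv_pullback:
  assumes m: "morphism T Y m" and "left_inv Y (spec_map (coord_ring Y) (comap T m) x) \<phi>"
  shows "left_inv T x (\<lambda>t. \<phi> (m t))"
proof -
  obtain N \<Delta> where N: "morphism Y (Hom_var scaleW scaleV) N"
    "\<forall>t\<in>pts Y. \<forall>v. N t (\<phi> t v) = scaleV (\<Delta> t) v" "reg Y \<Delta>"
    "\<not> in_ideal Y (spec_map (coord_ring Y) (comap T m) x) \<Delta>"
    using assms(2) unfolding left_inv_def by blast
  then show ?thesis
    unfolding left_inv_def
    using morphism_comp[OF m N(1)] morphism_reg[OF m N(3)] not_in_ideal_pullback[OF m N(3,4)]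
      morphism_pts[OF m]
    by (intro exI[of _ "\<lambda>t. N (m t)"] exI[of _ "\<lambda>t. \<Delta> (m t)"]) simp
qed

lemma right_inv_pullback:
  assumes m: "morphism T Y m" and "right_inv Y (spec_map (coord_ring Y) (comap T m) x) \<theta>"
  shows "right_inv T x (\<lambda>t. \<theta> (m t))"
proof -
  obtain R \<Delta> where R: "morphism Y (Hom_var scaleV scaleW') R"
    "\<forall>t\<in>pts Y. \<forall>v. \<theta> t (R t v) = scaleV (\<Delta> t) v" "reg Y \<Delta>"
    "\<not> in_ideal Y (spec_map (coord_ring Y) (comap T m) x) \<Delta>"
    using assms(2) unfolding right_inv_def by blast
  then show ?thesis
    unfolding right_inv_def
    using morphism_comp[OF m R(1)] morphism_reg[OF m R(3)] not_in_ideal_pullback[OF m R(3,4)]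
      morphism_pts[OF m]
    by (intro exI[of _ "\<lambda>t. R (m t)"] exI[of _ "\<lambda>t. \<Delta> (m t)"]) simp
qed

text \<open>At a prime that the action sends into the locus, full rank is known only of the
  translated map. Since the group element is invertible, composing \<open>N\<close> with its inverse
  gives a left inverse of the original map with the same denominator.\<close>

lemma left_inv_translate:
  assumes g: "morphism T G g" and "left_inv T x (\<lambda>t. \<phi> t \<circ> inv_into UNIV (g t))"
  shows "left_inv T x \<phi>"
proof -
  obtain N \<Delta> where N: "morphism T (Hom_var scaleW scaleV) N"
    "\<forall>t\<in>pts T. \<forall>v. N t (\<phi> t (inv_into UNIV (g t) v)) = scaleV (\<Delta> t) v" "reg T \<Delta>" "\<not> in_ideal T x \<Delta>"
    using assms(2) unfolding left_inv_def by auto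
  have inv: "morphism T (Hom_var scaleV scaleV) (\<lambda>t. inv_into UNIV (g t))"
    using morphism_comp[OF g[unfolded G_def] morphism_GL_inv] .
  have "(inv_into UNIV (g t) \<circ> N t) (\<phi> t v) = scaleV (\<Delta> t) v" if t: "t \<in> pts T" for t v
  proof -
    have gt: "Vector_Spaces.linear scaleV scaleV (g t)" "bij (g t)"
      using morphism_pts[OF g t] by (simp_all add: pts_G)
    have "N t (\<phi> t v) = N t (\<phi> t (inv_into UNIV (g t) (g t v)))"
      using gt(2) by (simp add: bij_is_inj)
    also have "\<dots> = scaleV (\<Delta> t) (g t v)" using N(2) t by blast
    also have "\<dots> = g t (scaleV (\<Delta> t) v)" by (simp add: lin_scale[OF gt(1)])
    finally show ?thesis using gt(2) by (simp add: bij_is_inj)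
  qed
  then show ?thesis
    unfolding left_inv_def
    using V.morphism_compose[OF N(1) inv] N(3,4)
    by (intro exI[of _ "\<lambda>t. inv_into UNIV (g t) \<circ> N t"] exI[of _ \<Delta>]) blast
qed

text \<open>Here the correction is on the other side: the right inverse of the translated map is
  precomposed with the group element.\<close>

lemma right_inv_translate:
  assumes g: "morphism T G g" and "right_inv T x (\<lambda>t. g t \<circ> \<theta> t)"
  shows "right_inv T x \<theta>"
proof -
  obtain R \<Delta> where R: "morphism T (Hom_var scaleV scaleW') R"
    "\<forall>t\<in>pts T. \<forall>v. g t (\<theta> t (R t v)) = scaleV (\<Delta> t) v" "reg T \<Delta>" "\<not> in_ideal T x \<Delta>"
    using assms(2) unfolding right_inv_def by auto
  have g': "morphism T (Hom_var scaleV scaleV) g"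
    using morphism_comp[OF g[unfolded G_def] morphism_GL_Hom] .
  have "\<theta> t ((R t \<circ> g t) v) = scaleV (\<Delta> t) v" if t: "t \<in> pts T" for t v
  proof -
    have gt: "Vector_Spaces.linear scaleV scaleV (g t)" "bij (g t)"
      using morphism_pts[OF g t] by (simp_all add: pts_G)
    have "g t (\<theta> t (R t (g t v))) = scaleV (\<Delta> t) (g t v)" using R(2) t by blast
    also have "\<dots> = g t (scaleV (\<Delta> t) v)" by (simp add: lin_scale[OF gt(1)])
    finally show ?thesis using injD[OF bij_is_inj[OF gt(2)]] by simp
  qed
  then show ?thesis
    unfolding right_inv_def
    using V.morphism_compose[OF g' R(1)] R(3,4)
    by (intro exI[of _ "\<lambda>t. R t \<circ> g t"] exI[of _ \<Delta>]) blast
qed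

lemma mat_phi_regular: "mat_phi w v \<in> regular Z"
  and mat_theta_regular: "mat_theta v u \<in> regular Z"
proof -
  have "vreg scaleW Z (\<lambda>z. fst z v)" "vreg scaleV Z (\<lambda>z. snd z u)"
    using Z_phi Z_theta unfolding morphism_Hom_iff by simp_all
  from vregD[OF this(1) W.crd_linear[of w]] vregD[OF this(2) V.crd_linear[of v]]
  show "mat_phi w v \<in> regular Z" "mat_theta v u \<in> regular Z"
    by (simp_all add: mat_phi_def mat_theta_def)
qed

text \<open>The matrix of \<open>\<phi>\<close> has as many columns as the rank, so the elimination
  applied to all columns gives a left inverse. It is assembled into a linear map by means of the
  bases.\<close>

lemma Uplus_left_inv:
  assumes "x \<in> Uplus"
  shows "left_inv Z x fst"
proof -
  have x: "x \<in> Spec (coord_ring Z)" "rank_at (coord_ring Z) x BW BV mat_phi = V.dim UNIV"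
    using assms by (auto simp: Uplus_def)
  from rank_at_columns[OF V.finite_Basis mat_phi_regular x(2)] obtain S
    where S: "S \<subseteq> BV" "card S = V.dim UNIV" "indep_columns Z x BW S mat_phi" .
  have SBV: "S = BV" using S(1,2) V.finite_Basis by (simp add: card_subset_eq)
  have "\<exists>N t. (\<forall>j i. reg Z (N j i)) \<and> reg Z t \<and> \<not> in_ideal Z x t \<and>
    (\<forall>j\<in>BV. \<forall>j'\<in>BV. \<forall>z. (\<Sum>i\<in>BW. N j i z * mat_phi i j' z) = (if j = j' then t z else 0))"
    by (rule indep_columns_left_inverse[OF x(1) V.finite_Basis W.finite_Basis
          reg_regular[OF mat_phi_regular] S(3)[unfolded SBV]])
  then obtain M \<Delta> where M: "\<And>j i. reg Z (M j i)" "reg Z \<Delta>" "\<not> in_ideal Z x \<Delta>"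
    "\<And>j j' z. j \<in> BV \<Longrightarrow> j' \<in> BV \<Longrightarrow> (\<Sum>i\<in>BW. M j i z * mat_phi i j' z) = (if j = j' then \<Delta> z else 0)"
    by blast
  define N where "N z w = (\<Sum>j\<in>BV. scaleV (\<Sum>i\<in>BW. M j i z * W.crd w i) j)" for z w
  have N_lin: "Vector_Spaces.linear scaleW scaleV (N z)" for z
    unfolding Vector_Spaces.linear_iff N_def
    by (simp add: V.vector_space_axioms W.vector_space_axioms lin_add[OF W.crd_linear]
        lin_scale[OF W.crd_linear] distrib_left sum.distrib V.scale_left_distrib
        V.scale_sum_right sum_distrib_left mult.left_commute)
  have "morphism Z (Hom_var scaleW scaleV) N"
    unfolding morphism_Hom_iff N_def
  proof (intro conjI ballI allI)
    show "vreg scaleV Z (\<lambda>z. \<Sum>j\<in>BV. scaleV (\<Sum>i\<in>BW. M j i z * W.crd w i) j)" for w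
      by (intro vreg_sum vreg_scale vreg_const reg_sum reg_mult M(1) reg_const)
  qed (use N_lin in \<open>simp add: N_def[abs_def]\<close>)
  moreover have "N z (fst z v) = scaleV (\<Delta> z) v" if z: "z \<in> pts Z" for z v
  proof -
    have lin: "Vector_Spaces.linear scaleV scaleV (\<lambda>v. N z (fst z v))"
      using Vector_Spaces.linear_compose[OF _ N_lin, of scaleV "fst z" z] z by (simp add: pts_Z comp_def)
    have "N z (fst z b) = scaleV (\<Delta> z) b" if b: "b \<in> BV" for b
    proof -
      have "N z (fst z b) = (\<Sum>j\<in>BV. scaleV (if j = b then \<Delta> z else 0) j)"
        unfolding N_def using M(4)[OF _ b, of _ z] z by (intro sum.cong) (simp_all add: mat_phi_def)
      also have "\<dots> = (\<Sum>j\<in>BV. if j = b then scaleV (\<Delta> z) j else 0)"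
        by (intro sum.cong) auto
      finally show ?thesis using b V.finite_Basis by simp
    qed
    then have "N z (fst z v) = (\<Sum>b\<in>BV. scaleV (\<Delta> z) (scaleV (V.crd v b) b))"
      by (subst V.linear_expand[OF lin]) (simp add: mult.commute)
    then show ?thesis by (simp only: V.scale_sum_right[symmetric] V.crd_sum)
  qed
  ultimately show ?thesis unfolding left_inv_def using M(2,3) by blast
qed

text \<open>Full rank selects as many columns of \<open>\<theta>\<close> as V has dimensions.
  Elimination provides only a left inverse of this square block, which has to be turned into a right
  inverse; this is done point by point, by a dimension count where \<open>\<Delta>\<close> is
  nonzero.\<close>

lemma Uminus_right_inv:
  assumes "x \<in> Uminus"
  shows "right_inv Z x snd"
proof -
  have x: "x \<in> Spec (coord_ring Z)" "rank_at (coord_ring Z) x BV BW' mat_theta = V.dim UNIV"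
    using assms by (auto simp: Uminus_def)
  from rank_at_columns[OF W'.finite_Basis mat_theta_regular x(2)] obtain S
    where S: "S \<subseteq> BW'" "card S = V.dim UNIV" "indep_columns Z x BV S mat_theta" .
  have finS: "finite S" using S(1) W'.finite_Basis by (rule finite_subset)
  have "\<exists>N t. (\<forall>j i. reg Z (N j i)) \<and> reg Z t \<and> \<not> in_ideal Z x t \<and>
    (\<forall>j\<in>S. \<forall>j'\<in>S. \<forall>z. (\<Sum>i\<in>BV. N j i z * mat_theta i j' z) = (if j = j' then t z else 0))"
    by (rule indep_columns_left_inverse[OF x(1) finS V.finite_Basis
          reg_regular[OF mat_theta_regular] S(3)])
  then obtain M \<Delta> where M: "\<And>j i. reg Z (M j i)" "reg Z \<Delta>" "\<not> in_ideal Z x \<Delta>"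
    "\<And>j j' z. j \<in> S \<Longrightarrow> j' \<in> S \<Longrightarrow> (\<Sum>i\<in>BV. M j i z * mat_theta i j' z) = (if j = j' then \<Delta> z else 0)"
    by blast
  define K where "K z j v = (\<Sum>i\<in>BV. M j i z * V.crd v i)" for z j v
  have K_lin: "Vector_Spaces.linear scaleV (*) (K z j)" for z j
    using V.crd_linear unfolding Vector_Spaces.linear_iff K_def
    by (simp add: distrib_left sum.distrib sum_distrib_left mult.left_commute)
  have K_theta: "K z j (snd z u) = (if j = u then \<Delta> z else 0)" if "z \<in> pts Z" "j \<in> S" "u \<in> S" for z j u
    using M(4)[OF that(2,3), of z] that(1) by (simp add: K_def mat_theta_def)
  text \<open>The extra factor \<open>\<Delta>\<close> makes the right inverse relation hold also where \<open>\<Delta>\<close> vanishes.\<close>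
  define R where "R z v = scaleW' (\<Delta> z) (\<Sum>j\<in>S. scaleW' (K z j v) j)" for z v
  have R_lin: "Vector_Spaces.linear scaleV scaleW' (R z)" for z
    unfolding Vector_Spaces.linear_iff R_def
    by (simp add: V.vector_space_axioms W'.vector_space_axioms lin_add[OF K_lin]
        lin_scale[OF K_lin] sum.distrib W'.scale_left_distrib W'.scale_right_distrib
        W'.scale_sum_right mult.left_commute)
  have "morphism Z (Hom_var scaleV scaleW') R"
    unfolding morphism_Hom_iff R_def K_def
  proof (intro conjI ballI allI)
    show "vreg scaleW' Z (\<lambda>z. scaleW' (\<Delta> z) (\<Sum>j\<in>S. scaleW' (\<Sum>i\<in>BV. M j i z * V.crd v i) j))" for v
      by (intro vreg_sum vreg_scale vreg_const reg_sum reg_mult M(1,2) reg_const)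
  qed (use R_lin in \<open>simp add: R_def[abs_def] K_def[abs_def]\<close>)
  moreover have "snd z (R z v) = scaleV (\<Delta> z * \<Delta> z) v" if z: "z \<in> pts Z" for z v
  proof (cases "\<Delta> z = 0")
    case True
    have "Vector_Spaces.linear scaleW' scaleV (snd z)" using z by (simp add: pts_Z)
    then show ?thesis by (simp add: R_def True lin_zero)
  next
    case False
    have \<theta>: "Vector_Spaces.linear scaleW' scaleV (snd z)" using z by (simp add: pts_Z)
    have inj: "inj_on (snd z) S"
    proof (rule inj_onI)
      fix u u' assume u: "u \<in> S" "u' \<in> S" "snd z u = snd z u'"
      then have "K z u (snd z u') = \<Delta> z" using K_theta[OF z u(1,1)] by simp
      then show "u = u'" using K_theta[OF z u(1,2)] False by (auto split: if_splits)
    qed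
    \<comment> \<open>Up to the nonzero scalar \<open>\<Delta>\<close>, the forms
      \<open>K z j\<close> are dual to the selected columns. So these are independent, and being dim
      V in number they span V; expanding \<open>v\<close> in them computes
      \<open>R z v\<close>.\<close>
    have "V.independent (snd z ` S)"
    proof
      assume "V.dependent (snd z ` S)"
      then obtain r where r: "\<exists>v\<in>snd z ` S. r v \<noteq> 0" "(\<Sum>v\<in>snd z ` S. scaleV (r v) v) = 0"
        unfolding V.dependent_finite[OF finite_imageI[OF finS]] by blast
      then obtain u where u: "u \<in> S" "r (snd z u) \<noteq> 0" by auto
      have "0 = K z u (\<Sum>j\<in>S. scaleV (r (snd z j)) (snd z j))"
        using r(2) inj by (simp add: sum.reindex lin_zero[OF K_lin])
      also have "\<dots> = (\<Sum>j\<in>S. if j = u then r (snd z u) * \<Delta> z else 0)"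
        unfolding lin_sum[OF K_lin] lin_scale[OF K_lin]
        using u(1) by (intro sum.cong) (auto simp: K_theta[OF z])
      also have "\<dots> = r (snd z u) * \<Delta> z" using u(1) finS by simp
      finally show False using u(2) False by simp
    qed
    then have "UNIV \<subseteq> V.span (snd z ` S)"
      by (intro V.card_ge_dim_independent) (simp_all only: card_image[OF inj] S(2), simp_all)
    then have "v \<in> V.span (snd z ` S)" by blast
    then obtain r where "v = (\<Sum>y\<in>snd z ` S. scaleV (r y) y)"
      unfolding V.span_finite[OF finite_imageI[OF finS]] by blast
    then have v: "v = (\<Sum>j\<in>S. scaleV (r (snd z j)) (snd z j))"
      using inj by (simp add: sum.reindex)
    have "K z j v = r (snd z j) * \<Delta> z" if "j \<in> S" for j
    proof -
      have "K z j v = (\<Sum>j'\<in>S. if j' = j then r (snd z j) * \<Delta> z else 0)"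
        unfolding v lin_sum[OF K_lin] lin_scale[OF K_lin]
        using that by (intro sum.cong) (auto simp: K_theta[OF z])
      then show ?thesis using that finS by simp
    qed
    then have "snd z (R z v) = scaleV (\<Delta> z) (\<Sum>j\<in>S. scaleV (r (snd z j) * \<Delta> z) (snd z j))"
      by (simp add: R_def lin_scale[OF \<theta>] lin_sum[OF \<theta>])
    also have "\<dots> = scaleV (\<Delta> z * \<Delta> z) v"
      by (simp add: v V.scale_sum_right mult_ac)
    finally show ?thesis .
  qed
  moreover have "\<not> in_ideal Z x (\<lambda>z. \<Delta> z * \<Delta> z)"
  proof
    assume "in_ideal Z x (\<lambda>z. \<Delta> z * \<Delta> z)"
    then have "restrict \<Delta> (pts Z) \<otimes>\<^bsub>coord_ring Z\<^esub> restrict \<Delta> (pts Z) \<in> x"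
      unfolding in_ideal_def by (simp cong: restrict_cong)
    moreover have "restrict \<Delta> (pts Z) \<otimes>\<^bsub>coord_ring Z\<^esub> restrict \<Delta> (pts Z) \<in> x
        \<longleftrightarrow> restrict \<Delta> (pts Z) \<in> x \<or> restrict \<Delta> (pts Z) \<in> x"
      by (rule cring.Spec_mult_iff[OF coord_ring_cring x(1)]) (use M(2) in simp_all)
    ultimately show False using M(3) unfolding in_ideal_def by blast
  qed
  ultimately show ?thesis
    unfolding right_inv_def using reg_mult[OF M(2,2)]
    by (intro exI[of _ R] exI[of _ "\<lambda>z. \<Delta> z * \<Delta> z"]) blast
qed

end

lemma (in graph_family) stalk_iso_of_inverses:
  assumes g: "ring_hom_cring (coord_ring X Quot I) (coord_ring X') g"
      "\<And>a. a \<in> regular X \<Longrightarrow> g (I +>\<^bsub>coord_ring X\<^esub> a) = comap X' \<pi> a"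
    and q: "q \<in> Spec (coord_ring X Quot I)"
    and "left_inv X (spec_map (coord_ring X) (\<lambda>f. I +>\<^bsub>coord_ring X\<^esub> f) q) \<phi>1"
    and "right_inv X (spec_map (coord_ring X) (\<lambda>f. I +>\<^bsub>coord_ring X\<^esub> f) q) \<theta>2"
  shows "stalk_iso (coord_ring X Quot I) (coord_ring X') g q"
proof -
  obtain N \<Delta> where N: "morphism X (Hom_var scaleW scaleV) N"
    "\<forall>x\<in>pts X. \<forall>v. N x (\<phi>1 x v) = scaleV (\<Delta> x) v" "reg X \<Delta>"
    "\<not> in_ideal X (spec_map (coord_ring X) (\<lambda>f. I +>\<^bsub>coord_ring X\<^esub> f) q) \<Delta>"
    using assms(4) unfolding left_inv_def by blast
  obtain R \<Delta>' where R: "morphism X (Hom_var scaleV scaleW') R"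
    "\<forall>x\<in>pts X. \<forall>v. \<theta>2 x (R x v) = scaleV (\<Delta>' x) v" "reg X \<Delta>'"
    "\<not> in_ideal X (spec_map (coord_ring X) (\<lambda>f. I +>\<^bsub>coord_ring X\<^esub> f) q) \<Delta>'"
    using assms(5) unfolding right_inv_def by blast
  have N': "\<And>x. x \<in> pts X \<Longrightarrow> Vector_Spaces.linear scaleW scaleV (N x)" "\<And>w. vreg scaleV X (\<lambda>x. N x w)"
      "\<And>x v. x \<in> pts X \<Longrightarrow> N x (\<phi>1 x v) = scaleV (\<Delta> x) v"
    and R': "\<And>v. vreg scaleW' X (\<lambda>x. R x v)"
      "\<And>x v. x \<in> pts X \<Longrightarrow> \<theta>2 x (R x v) = scaleV (\<Delta>' x) v"
    using N R unfolding morphism_Hom_iff by simp_all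
  show ?thesis
    by (rule graph_stalk_iso[OF N' R' N(3) R(3) g q refl N(4) R(4)])
qed

section \<open>The two equivariant pushforwards\<close>

lemma genideal_vimage:
  assumes "ring_hom_cring R S h" "ideal J S" "G \<subseteq> carrier R" "\<And>a. a \<in> G \<Longrightarrow> h a \<in> J"
    and "a \<in> genideal R G"
  shows "h a \<in> J"
proof -
  interpret ring_hom_cring R S h by fact
  have "ring_hom_ring R S h" ..
  from ring_hom_ring.ideal_vimage[OF this assms(2)]
  have "ideal {r \<in> carrier R. h r \<in> J} R" .
  then have "genideal R G \<subseteq> {r \<in> carrier R. h r \<in> J}"
    by (rule R.genideal_minimal) (use assms(3,4) in auto)
  then show ?thesis using assms(5) by blast
qed

lemma genideal_kernel:
  assumes "ring_hom_cring R S h" "G \<subseteq> carrier R" "\<And>a. a \<in> G \<Longrightarrow> h a = \<zero>\<^bsub>S\<^esub>" "a \<in> genideal R G"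
  shows "h a = \<zero>\<^bsub>S\<^esub>"
proof -
  interpret ring_hom_cring R S h by fact
  show ?thesis
    using genideal_vimage[OF assms(1) S.zeroideal assms(2) _ assms(4)] assms(3) by simp
qed

context three_spaces
begin

lemma ps_eq: "ps y = ((fst y, snd (snd y) \<circ> fst (snd y)), (fst y \<circ> snd (snd y), fst (snd y)))"
  by (cases y) (simp add: ps_def p_def s_def)

lemma actZZ_eq: "actZZ h z = ((fst (fst z) \<circ> inv_into UNIV (fst h), fst h \<circ> snd (fst z)),
    (fst (snd z) \<circ> inv_into UNIV (snd h), snd h \<circ> snd (snd z)))"
  by (cases h; cases z) (auto simp: actZZ_def actZ_def split: prod.splits)

lemma actQ_eq: "actQ h y = (fst y \<circ> inv_into UNIV (fst h), snd h \<circ> fst (snd y),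
    fst h \<circ> snd (snd y) \<circ> inv_into UNIV (snd h))"
  by (cases h; cases y) (simp add: actQ_def)

abbreviation "act_map \<equiv> (\<lambda>(h, z). actZZ h z)"
abbreviation "actQ_map \<equiv> (\<lambda>(h, y). actQ h y)"
abbreviation "ps1 \<equiv> (\<lambda>(h, y). (h, ps y))"

section \<open>The structure maps as morphisms of varieties\<close>

lemma QZ_phi: "morphism QZ (Hom_var scaleV scaleW) fst"
  and QZ_theta: "morphism QZ (Hom_var scaleW' scaleV) (\<lambda>y. fst (snd y))"
  and QZ_end: "morphism QZ (Hom_var scaleV scaleV) (\<lambda>y. snd (snd y))"
  unfolding QZ_def
  by (rule morphism_fst, rule morphism_comp[OF morphism_snd morphism_fst],
      rule morphism_comp[OF morphism_snd morphism_snd])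

lemma ZZ_phi1: "morphism ZZ (Hom_var scaleV scaleW) (\<lambda>z. fst (fst z))"
  and ZZ_theta1: "morphism ZZ (Hom_var scaleW' scaleV) (\<lambda>z. snd (fst z))"
  and ZZ_phi2: "morphism ZZ (Hom_var scaleV scaleW) (\<lambda>z. fst (snd z))"
  and ZZ_theta2: "morphism ZZ (Hom_var scaleW' scaleV) (\<lambda>z. snd (snd z))"
  by (rule morphism_comp[OF morphism_fst Z_phi] morphism_comp[OF morphism_fst Z_theta]
      morphism_comp[OF morphism_snd Z_phi] morphism_comp[OF morphism_snd Z_theta])+

lemma ps_morphism: "morphism QZ ZZ ps"
proof -
  have "morphism QZ ZZ (\<lambda>y. ((fst y, snd (snd y) \<circ> fst (snd y)), (fst y \<circ> snd (snd y), fst (snd y))))"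
    unfolding Z_def
    by (rule morphism_pair[OF morphism_pair[OF QZ_phi V.morphism_compose[OF QZ_theta QZ_end]]
          morphism_pair[OF V.morphism_compose[OF QZ_end QZ_phi] QZ_theta]])
  then show ?thesis by (rule morphism_cong) (simp add: ps_eq)
qed

lemma ps1_morphism: "morphism GGQ GGZZ ps1"
proof -
  have "morphism GGQ GGZZ (\<lambda>t. (fst t, ps (snd t)))"
    by (rule morphism_pair[OF morphism_fst morphism_comp[OF morphism_snd ps_morphism]])
  then show ?thesis by (rule morphism_cong) (simp add: case_prod_beta)
qed

lemma G_hom: "morphism G (Hom_var scaleV scaleV) (\<lambda>g. g)"
  and G_inv: "morphism G (Hom_var scaleV scaleV) (inv_into UNIV)"
  unfolding G_def by (rule morphism_GL_Hom morphism_GL_inv)+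

lemma GG_comps:
  shows "morphism (vprod GG Y) G (\<lambda>t. fst (fst t))" "morphism (vprod GG Y) G (\<lambda>t. snd (fst t))"
  by (rule morphism_comp[OF morphism_fst morphism_fst] morphism_comp[OF morphism_fst morphism_snd])+

lemma act_map_morphism: "morphism GGZZ ZZ act_map"
proof -
  let ?g1 = "\<lambda>t. fst (fst t)" and ?g2 = "\<lambda>t. snd (fst t)"
  note h = morphism_comp[OF GG_comps(1) G_hom] morphism_comp[OF GG_comps(2) G_hom]
  note i = morphism_comp[OF GG_comps(1) G_inv] morphism_comp[OF GG_comps(2) G_inv]
  note z = morphism_comp[OF morphism_snd ZZ_phi1] morphism_comp[OF morphism_snd ZZ_theta1]
    morphism_comp[OF morphism_snd ZZ_phi2] morphism_comp[OF morphism_snd ZZ_theta2]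
  have "morphism GGZZ ZZ (\<lambda>t. ((fst (fst (snd t)) \<circ> inv_into UNIV (?g1 t), ?g1 t \<circ> snd (fst (snd t))),
      (fst (snd (snd t)) \<circ> inv_into UNIV (?g2 t), ?g2 t \<circ> snd (snd (snd t)))))"
    by (rule morphism_pair[of _ Z _ Z, OF morphism_pair[of _ "Hom_var scaleV scaleW" _ "Hom_var scaleW' scaleV",
            OF V.morphism_compose[OF i(1) z(1)] V.morphism_compose[OF z(2) h(1)], folded Z_def]
          morphism_pair[of _ "Hom_var scaleV scaleW" _ "Hom_var scaleW' scaleV",
            OF V.morphism_compose[OF i(2) z(3)] V.morphism_compose[OF z(4) h(2)], folded Z_def]])
  then show ?thesis by (rule morphism_cong) (simp add: case_prod_beta actZZ_eq)
qed

lemma actQ_map_morphism: "morphism GGQ QZ actQ_map"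
proof -
  let ?g1 = "\<lambda>t. fst (fst t)" and ?g2 = "\<lambda>t. snd (fst t)"
  note h = morphism_comp[OF GG_comps(1) G_hom] morphism_comp[OF GG_comps(2) G_hom]
  note i = morphism_comp[OF GG_comps(1) G_inv] morphism_comp[OF GG_comps(2) G_inv]
  note y = morphism_comp[OF morphism_snd QZ_phi] morphism_comp[OF morphism_snd QZ_theta]
    morphism_comp[OF morphism_snd QZ_end]
  have "morphism GGQ QZ (\<lambda>t. (fst (snd t) \<circ> inv_into UNIV (?g1 t), ?g2 t \<circ> fst (snd (snd t)),
      ?g1 t \<circ> (snd (snd (snd t)) \<circ> inv_into UNIV (?g2 t))))"
    by (rule morphism_pair[of _ "Hom_var scaleV scaleW" _ "vprod (Hom_var scaleW' scaleV) (Hom_var scaleV scaleV)",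
          OF V.morphism_compose[OF i(1) y(1)]
            morphism_pair[OF V.morphism_compose[OF y(2) h(2)]
              V.morphism_compose[OF V.morphism_compose[OF i(2) y(3)] h(1)]], folded QZ_def])
  then show ?thesis by (rule morphism_cong) (simp add: case_prod_beta actQ_eq comp_assoc)
qed

section \<open>The fibre ideal: generators, vanishing on Q, behaviour under the action\<close>

lemma fib_gens_subset: "fib_gens \<subseteq> carrier (coord_ring ZZ)"
proof -
  have "reg ZZ (\<lambda>z. f (fst z) - f (snd z))" if "f \<in> invariants" for f
    using that morphism_regular[OF morphism_fst, of f Z Z] morphism_regular[OF morphism_snd, of f Z Z]
    by (intro reg_diff) (simp_all add: invariants_def)
  then show ?thesis by (auto simp: fib_gens_def)
qed

lemma fib_gens1_subset: "comap GGZZ snd ` fib_gens \<subseteq> carrier (coord_ring GGZZ)"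
proof -
  interpret ring_hom_cring "coord_ring ZZ" "coord_ring GGZZ" "comap GGZZ snd"
    by (rule comap_hom[OF morphism_snd])
  show ?thesis using fib_gens_subset hom_closed by blast
qed

lemma fib_ideal: "ideal fib_ideal (coord_ring ZZ)"
  unfolding fib_ideal_def by (rule ring.genideal_ideal[OF cring.axioms(1)[OF coord_ring_cring] fib_gens_subset])

lemma GG_fib_ideal: "ideal GG_fib_ideal (coord_ring GGZZ)"
  unfolding GG_fib_ideal_def
  by (rule ring.genideal_ideal[OF cring.axioms(1)[OF coord_ring_cring] fib_gens1_subset])

lemma fib_gens_mem: "a \<in> fib_gens \<Longrightarrow> a \<in> fib_ideal" "a \<in> fib_gens \<Longrightarrow> comap GGZZ snd a \<in> GG_fib_ideal"
  unfolding fib_ideal_def GG_fib_ideal_def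
  using ring.genideal_self[OF cring.axioms(1)[OF coord_ring_cring] fib_gens_subset]
    ring.genideal_self[OF cring.axioms(1)[OF coord_ring_cring] fib_gens1_subset] by blast+

lemma fib_gens_ps:
  assumes "a \<in> fib_gens" "y \<in> pts QZ"
  shows "a (ps y) = 0"
proof -
  obtain f where f: "f \<in> invariants" "a = (\<lambda>z \<in> pts ZZ. f (fst z) - f (snd z))"
    using assms(1) unfolding fib_gens_def by blast
  have "f (fst y, snd (snd y) \<circ> fst (snd y)) = f (fst y \<circ> snd (snd y), fst (snd y))"
    using assms(2) by (intro invariant_graph[OF f(1)]) (simp_all add: pts_QZ)
  then show ?thesis
    using morphism_pts[OF ps_morphism assms(2)] by (simp add: f(2) ps_eq)
qed

lemma fib_ideal_ps: "a \<in> fib_ideal \<Longrightarrow> comap QZ ps a = \<zero>\<^bsub>coord_ring QZ\<^esub>"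
  unfolding fib_ideal_def
proof (rule genideal_kernel[OF comap_hom[OF ps_morphism] fib_gens_subset])
  fix a assume "a \<in> fib_gens"
  then show "comap QZ ps a = \<zero>\<^bsub>coord_ring QZ\<^esub>"
    by (intro extensionalityI[where A = "pts QZ"]) (simp_all add: comap_def fib_gens_ps)
qed

lemma GG_fib_ideal_ps1: "a \<in> GG_fib_ideal \<Longrightarrow> comap GGQ ps1 a = \<zero>\<^bsub>coord_ring GGQ\<^esub>"
  unfolding GG_fib_ideal_def
proof (rule genideal_kernel[OF comap_hom[OF ps1_morphism] fib_gens1_subset])
  fix b assume "b \<in> comap GGZZ snd ` fib_gens"
  then obtain a where a: "a \<in> fib_gens" "b = comap GGZZ snd a" by blast
  have "comap GGZZ snd a (ps1 t) = 0" if "t \<in> pts GGQ" for t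
  proof -
    have "snd t \<in> pts QZ" by (rule morphism_pts[OF morphism_snd that])
    then show ?thesis
      using morphism_pts[OF ps1_morphism that] fib_gens_ps[OF a(1)]
      unfolding comap_def by (simp add: case_prod_beta)
  qed
  then show "comap GGQ ps1 b = \<zero>\<^bsub>coord_ring GGQ\<^esub>"
    unfolding a(2) by (intro extensionalityI[where A = "pts GGQ"]) (simp_all add: comap_def[of GGQ])
qed

text \<open>Each of the two terms of a generator is invariant under its own factor of G x G.
  Therefore \<open>GG_fib_ideal\<close>, generated by pullbacks along the projection, also contains
  the pullbacks along the action, and the action induces a map of quotient rings.\<close>

lemma act_fib_gens:
  assumes "a \<in> fib_gens"
  shows "comap GGZZ act_map a = comap GGZZ snd a"
proof -
  obtain f where f: "f \<in> invariants" "a = (\<lambda>z \<in> pts ZZ. f (fst z) - f (snd z))"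
    using assms unfolding fib_gens_def by blast
  have "a (act_map t) = a (snd t)" if t: "t \<in> pts GGZZ" for t
  proof -
    obtain g1 g2 z1 z2 where eq: "t = ((g1, g2), (z1, z2))" by (metis prod.exhaust)
    then have m: "g1 \<in> pts G" "g2 \<in> pts G" "z1 \<in> pts Z" "z2 \<in> pts Z"
      using t by (simp_all add: vprod_simps)
    have "(actZ g1 z1, actZ g2 z2) \<in> pts ZZ"
      using morphism_pts[OF act_map_morphism t] by (simp add: eq actZZ_def)
    then show ?thesis
      using f(1) m by (simp add: f(2) eq actZZ_def vprod_simps invariants_def)
  qed
  then show ?thesis by (intro extensionalityI[where A = "pts GGZZ"]) (simp_all add: comap_def)
qed

lemma invariant_relation:
  assumes \<xi>: "Vector_Spaces.linear scaleW (*) \<xi>"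
  shows "in_ideal ZZ fib_ideal (\<lambda>z. \<xi> (fst (fst z) (snd (fst z) u)) - \<xi> (fst (snd z) (snd (snd z) u)))"
    and "in_ideal GGZZ GG_fib_ideal (\<lambda>t. \<xi> (fst (fst (snd t)) (snd (fst (snd t)) u)) -
      \<xi> (fst (snd (snd t)) (snd (snd (snd t)) u)))"
proof -
  \<comment> \<open>An entry of the product of phi and theta; it is invariant because g cancels
    against its inverse. The generator of the fibre ideal that comes from it is the relation to be
    shown.\<close>
  define f where "f = (\<lambda>z\<in>pts Z. \<xi> (fst z (snd z u)))"
  have "morphism Z (Hom_var scaleW' scaleW) (\<lambda>z. fst z \<circ> snd z)"
    by (rule V.morphism_compose[OF Z_theta Z_phi])
  then have "reg Z (\<lambda>z. \<xi> ((fst z \<circ> snd z) u))"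
    using \<xi> unfolding morphism_Hom_iff vreg_def by blast
  then have "f \<in> carrier (coord_ring Z)" by (simp add: f_def)
  moreover have "f (actZ g z) = f z" if "g \<in> pts G" "z \<in> pts Z" for g z
  proof -
    have gz: "Vector_Spaces.linear scaleV scaleV g" "bij g"
      "Vector_Spaces.linear scaleV scaleW (fst z)" "Vector_Spaces.linear scaleW' scaleV (snd z)"
      using that by (simp_all add: pts_G pts_Z)
    have "actZ g z \<in> pts Z"
      using gz inv_linear[OF gz(1,2)]
      by (cases z) (auto simp: actZ_def pts_Z intro: Vector_Spaces.linear_compose)
    then show ?thesis using that(2) gz(2) by (cases z) (simp add: f_def actZ_def bij_is_inj)
  qed
  ultimately have f: "f \<in> invariants" by (simp add: invariants_def)
  define a where "a = (\<lambda>z \<in> pts ZZ. f (fst z) - f (snd z))"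
  have a: "a \<in> fib_gens" using f unfolding a_def fib_gens_def by blast
  show "in_ideal ZZ fib_ideal (\<lambda>z. \<xi> (fst (fst z) (snd (fst z) u)) - \<xi> (fst (snd z) (snd (snd z) u)))"
    by (rule in_ideal_cong[OF in_ideal_mem[OF fib_ideal fib_gens_mem(1)[OF a]]])
      (auto simp: a_def f_def vprod_simps)
  show "in_ideal GGZZ GG_fib_ideal (\<lambda>t. \<xi> (fst (fst (snd t)) (snd (fst (snd t)) u)) -
      \<xi> (fst (snd (snd t)) (snd (snd (snd t)) u)))"
    by (rule in_ideal_cong[OF in_ideal_mem[OF GG_fib_ideal fib_gens_mem(2)[OF a]]])
      (auto simp: a_def f_def comap_def vprod_simps)
qed

lemma coords_ZZ_cases:
  assumes "f \<in> coords ZZ"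
  obtains \<xi> a where "f = (\<lambda>z. \<xi> (fst (fst z) a))"
  | \<xi> a where "f = (\<lambda>z. \<xi> (snd (snd z) a))"
  | \<xi> a where "Vector_Spaces.linear scaleW (*) \<xi>" "f = (\<lambda>z. \<xi> (fst (snd z) a))"
  | \<xi> a where "Vector_Spaces.linear scaleV (*) \<xi>" "f = (\<lambda>z. \<xi> (snd (fst z) a))"
  using assms by (auto simp: vprod_simps Z_def Hom_var_simps comp_def)

lemma coords_QZ_cases:
  assumes "f \<in> coords QZ"
  obtains \<xi> a where "Vector_Spaces.linear scaleW (*) \<xi>" "f = (\<lambda>y. \<xi> (fst y a))"
  | \<xi> a where "Vector_Spaces.linear scaleV (*) \<xi>" "f = (\<lambda>y. \<xi> (fst (snd y) a))"
  | \<xi> a where "Vector_Spaces.linear scaleV (*) \<xi>" "f = (\<lambda>y. \<xi> (snd (snd y) a))"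
  using assms by (auto simp: vprod_simps QZ_def Hom_var_simps comp_def)

text \<open>A point of Q is its phi, its theta and c, that is, the phi of the first and the theta of
  the second component of its image under (p, s), together with c. Accordingly the coordinates of
  these two components are kept by the reconstruction, while the other two are the ones expressed
  through c.\<close>

lemma graph_family0:
  "graph_family scaleV BV scaleW BW scaleW' BW' ZZ QZ ps fib_ideal
    (\<lambda>z. fst (fst z)) (\<lambda>z. fst (snd z)) (\<lambda>z. snd (fst z)) (\<lambda>z. snd (snd z))
    (\<lambda>y. snd (snd y)) (\<lambda>z c. (fst (fst z), snd (snd z), c))"
proof (intro graph_family.intro graph_family_axioms.intro three_spaces_axioms)
  fix f assume "f \<in> coords ZZ"
  then show "(\<forall>x\<in>pts ZZ. \<forall>c. Vector_Spaces.linear scaleV scaleV c \<longrightarrow>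
        f (ps (fst (fst x), snd (snd x), c)) = f x) \<or>
      (\<exists>\<xi> v. Vector_Spaces.linear scaleW (*) \<xi> \<and> f = (\<lambda>x. \<xi> (fst (snd x) v))) \<or>
      (\<exists>\<xi> u. Vector_Spaces.linear scaleV (*) \<xi> \<and> f = (\<lambda>x. \<xi> (snd (fst x) u)))"
    by (cases rule: coords_ZZ_cases) (simp add: ps_eq, simp add: ps_eq, blast, blast)
next
  fix f assume "f \<in> coords QZ"
  then show "(\<exists>b. reg ZZ b \<and> (\<forall>y\<in>pts QZ. f y = b (ps y))) \<or>
      (\<exists>\<xi> v. Vector_Spaces.linear scaleV (*) \<xi> \<and> f = (\<lambda>y. \<xi> (snd (snd y) v)))"
  proof (cases rule: coords_QZ_cases)
    case (1 \<xi> a)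
    then have "reg ZZ (\<lambda>z. \<xi> (fst (fst z) a))" using ZZ_phi1 unfolding morphism_Hom_iff vreg_def by blast
    then show ?thesis using 1 by (intro disjI1 exI[of _ "\<lambda>z. \<xi> (fst (fst z) a)"]) (simp add: ps_eq)
  next
    case (2 \<xi> a)
    then have "reg ZZ (\<lambda>z. \<xi> (snd (snd z) a))" using ZZ_theta2 unfolding morphism_Hom_iff vreg_def by blast
    then show ?thesis using 2 by (intro disjI1 exI[of _ "\<lambda>z. \<xi> (snd (snd z) a)"]) (simp add: ps_eq)
  qed blast
next
  show "in_ideal_vec scaleW ZZ fib_ideal (\<lambda>x. fst (fst x) (snd (fst x) u) - fst (snd x) (snd (snd x) u))" for u
    unfolding in_ideal_vec_def using invariant_relation(1) by (auto simp: lin_diff)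
qed (use ZZ_phi1 ZZ_theta1 ZZ_phi2 ZZ_theta2 in \<open>auto simp: ps_morphism fib_ideal morphism_Hom_iff
    ps_eq pts_QZ pts_Z vprod_simps\<close>)

text \<open>The same family with parameters in G x G, which are carried along unchanged by
  \<open>ps1\<close> and by the reconstruction; their coordinates belong to the kept ones.\<close>

lemma graph_family1:
  "graph_family scaleV BV scaleW BW scaleW' BW' GGZZ GGQ ps1 GG_fib_ideal
    (\<lambda>t. fst (fst (snd t))) (\<lambda>t. fst (snd (snd t))) (\<lambda>t. snd (fst (snd t))) (\<lambda>t. snd (snd (snd t)))
    (\<lambda>y. snd (snd (snd y))) (\<lambda>t c. (fst t, fst (fst (snd t)), snd (snd (snd t)), c))"
proof (intro graph_family.intro graph_family_axioms.intro three_spaces_axioms)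
  fix f assume "f \<in> coords GGZZ"
  then consider f' where "f = (\<lambda>t. f' (fst t))" | f' where "f' \<in> coords ZZ" "f = (\<lambda>t. f' (snd t))"
    by (auto simp: vprod_simps(2)[of GG] comp_def)
  then show "(\<forall>x\<in>pts GGZZ. \<forall>c. Vector_Spaces.linear scaleV scaleV c \<longrightarrow>
        f (ps1 (fst x, fst (fst (snd x)), snd (snd (snd x)), c)) = f x) \<or>
      (\<exists>\<xi> v. Vector_Spaces.linear scaleW (*) \<xi> \<and> f = (\<lambda>x. \<xi> (fst (snd (snd x)) v))) \<or>
      (\<exists>\<xi> u. Vector_Spaces.linear scaleV (*) \<xi> \<and> f = (\<lambda>x. \<xi> (snd (fst (snd x)) u)))"
  proof cases
    case (2 f')
    from 2(1) show ?thesis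
      by (cases rule: coords_ZZ_cases) (simp add: 2(2) ps_eq, simp add: 2(2) ps_eq, unfold 2(2), blast, blast)
  qed simp
next
  fix f assume f: "f \<in> coords GGQ"
  consider f' where "f' \<in> coords GG" "f = (\<lambda>t. f' (fst t))" | f' where "f' \<in> coords QZ" "f = (\<lambda>t. f' (snd t))"
    using f by (auto simp: vprod_simps(2)[of GG QZ] comp_def)
  then show "(\<exists>b. reg GGZZ b \<and> (\<forall>y\<in>pts GGQ. f y = b (ps1 y))) \<or>
      (\<exists>\<xi> v. Vector_Spaces.linear scaleV (*) \<xi> \<and> f = (\<lambda>y. \<xi> (snd (snd (snd y)) v)))"
  proof cases
    case (1 f')
    have "reg GGZZ (\<lambda>t. f' (fst t))" by (rule morphism_reg[OF morphism_fst reg_coord[OF 1(1)]])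
    then show ?thesis
      using 1(2) by (intro disjI1 exI[of _ "\<lambda>t. f' (fst t)"]) (simp add: case_prod_beta)
  next
    case (2 f')
    from 2(1) show ?thesis
    proof (cases rule: coords_QZ_cases)
      case (1 \<xi> a)
      then have "reg ZZ (\<lambda>z. \<xi> (fst (fst z) a))" using ZZ_phi1 unfolding morphism_Hom_iff vreg_def by blast
      from morphism_reg[OF morphism_snd this] show ?thesis
        using 1 2(2) by (intro disjI1 exI[of _ "\<lambda>t. \<xi> (fst (fst (snd t)) a)"]) (simp add: case_prod_beta ps_eq)
    next
      case (2 \<xi> a)
      then have "reg ZZ (\<lambda>z. \<xi> (snd (snd z) a))" using ZZ_theta2 unfolding morphism_Hom_iff vreg_def by blast
      from morphism_reg[OF morphism_snd this] show ?thesis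
        using 2 \<open>f = (\<lambda>t. f' (snd t))\<close>
        by (intro disjI1 exI[of _ "\<lambda>t. \<xi> (snd (snd (snd t)) a)"]) (simp add: case_prod_beta ps_eq)
    next
      case (3 \<xi> a)
      then show ?thesis unfolding \<open>f = (\<lambda>t. f' (snd t))\<close> by blast
    qed
  qed
next
  show "in_ideal_vec scaleW GGZZ GG_fib_ideal
      (\<lambda>x. fst (fst (snd x)) (snd (fst (snd x)) u) - fst (snd (snd x)) (snd (snd (snd x)) u))" for u
    unfolding in_ideal_vec_def using invariant_relation(2) by (auto simp: lin_diff)
next
  show "morphism GGQ GGZZ ps1" by (rule ps1_morphism)
  have ZZ: "vreg scaleW ZZ (\<lambda>z. fst (fst z) v)" "vreg scaleW ZZ (\<lambda>z. fst (snd z) v)"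
    "vreg scaleV ZZ (\<lambda>z. snd (fst z) u)" "vreg scaleV ZZ (\<lambda>z. snd (snd z) u)" for v u
    using ZZ_phi1 ZZ_phi2 ZZ_theta1 ZZ_theta2 unfolding morphism_Hom_iff by simp_all
  show "vreg scaleW GGZZ (\<lambda>x. fst (fst (snd x)) v)" "vreg scaleW GGZZ (\<lambda>x. fst (snd (snd x)) v)"
    "vreg scaleV GGZZ (\<lambda>x. snd (fst (snd x)) u)" "vreg scaleV GGZZ (\<lambda>x. snd (snd (snd x)) u)" for v u
    by (rule vreg_morphism[OF morphism_snd ZZ(1)] vreg_morphism[OF morphism_snd ZZ(2)]
        vreg_morphism[OF morphism_snd ZZ(3)] vreg_morphism[OF morphism_snd ZZ(4)])+
qed (auto simp: GG_fib_ideal ps_eq pts_QZ pts_Z vprod_simps)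

section \<open>The triangles of rings on both levels and the maps between the levels\<close>

abbreviation "F0 \<equiv> coord_ring ZZ Quot fib_ideal"
abbreviation "F1 \<equiv> coord_ring GGZZ Quot GG_fib_ideal"
abbreviation "\<pi>0 \<equiv> (\<lambda>f. fib_ideal +>\<^bsub>coord_ring ZZ\<^esub> f)"
abbreviation "\<pi>1 \<equiv> (\<lambda>f. GG_fib_ideal +>\<^bsub>coord_ring GGZZ\<^esub> f)"
abbreviation "\<rho>0 \<equiv> quot_map (comap QZ ps)"
abbreviation "\<rho>1 \<equiv> quot_map (comap GGQ ps1)"

lemma triangle0:
  "affine_triangle (coord_ring ZZ) F0 (coord_ring QZ)
    \<pi>0 \<rho>0 (comap QZ ps)"
  and quot_ps: "a \<in> regular ZZ \<Longrightarrow> \<rho>0 (fib_ideal +>\<^bsub>coord_ring ZZ\<^esub> a) = comap QZ ps a"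
proof -
  note hom = comap_hom[OF ps_morphism]
  have *: "\<rho>0 (fib_ideal +>\<^bsub>coord_ring ZZ\<^esub> a) = comap QZ ps a"
    if "a \<in> carrier (coord_ring ZZ)" for a
    by (rule quot_map_coset[OF hom fib_ideal fib_ideal_ps that])
  then show "a \<in> regular ZZ \<Longrightarrow> \<rho>0 (fib_ideal +>\<^bsub>coord_ring ZZ\<^esub> a) = comap QZ ps a"
    by simp
  show "affine_triangle (coord_ring ZZ) F0 (coord_ring QZ)
    \<pi>0 \<rho>0 (comap QZ ps)"
  proof (rule affine_triangle.intro)
    show "ring_hom_cring (coord_ring ZZ) F0 \<pi>0"
      by (rule ideal.rcos_ring_hom_cring[OF fib_ideal coord_ring_cring])
    show "ring_hom_cring F0 (coord_ring QZ) \<rho>0"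
      by (rule Quot_hom[OF coord_ring_cring fib_ideal coord_ring_cring ring_hom_cring.homh[OF hom] *])
  qed (simp add: *)
qed

lemma triangle1:
  "affine_triangle (coord_ring GGZZ) F1 (coord_ring GGQ)
    \<pi>1 \<rho>1 (comap GGQ ps1)"
  and quot_ps1: "a \<in> regular GGZZ \<Longrightarrow>
    \<rho>1 (GG_fib_ideal +>\<^bsub>coord_ring GGZZ\<^esub> a) = comap GGQ ps1 a"
proof -
  note hom = comap_hom[OF ps1_morphism]
  have *: "\<rho>1 (GG_fib_ideal +>\<^bsub>coord_ring GGZZ\<^esub> a) = comap GGQ ps1 a"
    if "a \<in> carrier (coord_ring GGZZ)" for a
    by (rule quot_map_coset[OF hom GG_fib_ideal GG_fib_ideal_ps1 that])
  then show "a \<in> regular GGZZ \<Longrightarrow>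
      \<rho>1 (GG_fib_ideal +>\<^bsub>coord_ring GGZZ\<^esub> a) = comap GGQ ps1 a"
    by simp
  show "affine_triangle (coord_ring GGZZ) F1 (coord_ring GGQ)
    \<pi>1 \<rho>1 (comap GGQ ps1)"
  proof (rule affine_triangle.intro)
    show "ring_hom_cring (coord_ring GGZZ) F1
        \<pi>1"
      by (rule ideal.rcos_ring_hom_cring[OF GG_fib_ideal coord_ring_cring])
    show "ring_hom_cring F1 (coord_ring GGQ) \<rho>1"
      by (rule Quot_hom[OF coord_ring_cring GG_fib_ideal coord_ring_cring ring_hom_cring.homh[OF hom] *])
  qed (simp add: *)
qed

text \<open>Two representatives differ by an element of \<open>fib_ideal\<close>, which pullback
  along \<open>m\<close> carries into \<open>GG_fib_ideal\<close>; for this it is enough to look at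
  the generators. So the union in \<open>induced\<close> collapses to one coset.\<close>

lemma induced_coset:
  assumes m: "morphism GGZZ ZZ m" and "\<And>a. a \<in> fib_gens \<Longrightarrow> comap GGZZ m a \<in> GG_fib_ideal"
    and a: "a \<in> regular ZZ"
  shows "induced (comap GGZZ m) (fib_ideal +>\<^bsub>coord_ring ZZ\<^esub> a) = GG_fib_ideal +>\<^bsub>coord_ring GGZZ\<^esub> comap GGZZ m a"
proof -
  interpret h: ring_hom_cring "coord_ring ZZ" "coord_ring GGZZ" "comap GGZZ m" by (rule comap_hom[OF m])
  interpret J: ideal GG_fib_ideal "coord_ring GGZZ" by (rule GG_fib_ideal)
  interpret I: ideal fib_ideal "coord_ring ZZ" by (rule fib_ideal)
  have a': "a \<in> carrier (coord_ring ZZ)" using a by simp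
  have eq: "GG_fib_ideal +>\<^bsub>coord_ring GGZZ\<^esub> comap GGZZ m b = GG_fib_ideal +>\<^bsub>coord_ring GGZZ\<^esub> comap GGZZ m a"
    if "b \<in> fib_ideal +>\<^bsub>coord_ring ZZ\<^esub> a" for b
  proof -
    have "\<exists>i\<in>fib_ideal. b = i \<oplus>\<^bsub>coord_ring ZZ\<^esub> a"
      using that by (simp only: a_r_coset_def' UN_iff singleton_iff)
    then obtain i where i: "i \<in> fib_ideal" "b = i \<oplus>\<^bsub>coord_ring ZZ\<^esub> a" by (elim bexE)
    have mi: "comap GGZZ m i \<in> GG_fib_ideal"
      by (rule genideal_vimage[OF h.ring_hom_cring_axioms GG_fib_ideal fib_gens_subset assms(2)])
        (use i(1) in \<open>simp_all add: fib_ideal_def\<close>)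
    have "comap GGZZ m b = comap GGZZ m i \<oplus>\<^bsub>coord_ring GGZZ\<^esub> comap GGZZ m a"
      unfolding i(2) by (rule h.hom_add[OF I.Icarr[OF i(1)] a'])
    then have "comap GGZZ m b \<ominus>\<^bsub>coord_ring GGZZ\<^esub> comap GGZZ m a = comap GGZZ m i"
      using J.Icarr[OF mi] h.hom_closed[OF a'] by (simp only: h.S.minus_eq h.S.a_assoc h.S.r_neg h.S.a_inv_closed h.S.r_zero)
    then show ?thesis
      using J.coset_eq_iff[of "comap GGZZ m b" "comap GGZZ m a"] mi h.hom_closed a'
        I.Icarr[OF i(1)] i(2) by (simp only: h.R.a_closed)
  qed
  have "a \<in> fib_ideal +>\<^bsub>coord_ring ZZ\<^esub> a" by (rule I.a_rcos_self[OF a'])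
  then show ?thesis unfolding induced_def using eq by blast
qed

lemma induced_hom:
  assumes m: "morphism GGZZ ZZ m" and "\<And>a. a \<in> fib_gens \<Longrightarrow> comap GGZZ m a \<in> GG_fib_ideal"
  shows "ring_hom_cring F0 F1 (induced (comap GGZZ m))"
proof (rule Quot_hom[OF coord_ring_cring fib_ideal ideal.quotient_is_cring[OF GG_fib_ideal coord_ring_cring]])
  have "\<pi>1 \<circ> comap GGZZ m
      \<in> ring_hom (coord_ring ZZ) F1"
    by (rule ring_hom_trans[OF ring_hom_cring.homh[OF comap_hom[OF m]] ideal.rcos_ring_hom[OF GG_fib_ideal]])
  then show "(\<lambda>a. GG_fib_ideal +>\<^bsub>coord_ring GGZZ\<^esub> comap GGZZ m a)
      \<in> ring_hom (coord_ring ZZ) F1"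
    by (simp add: comp_def)
qed (simp add: induced_coset[OF assms])

lemma fib_gens_proj_act:
  "a \<in> fib_gens \<Longrightarrow> comap GGZZ snd a \<in> GG_fib_ideal"
  "a \<in> fib_gens \<Longrightarrow> comap GGZZ act_map a \<in> GG_fib_ideal"
  by (simp_all add: act_fib_gens fib_gens_mem(2))

text \<open>On a representative, both sides pull a function back along the same composite map to Z x
  Z. For the projection the hypothesis on points is immediate; for the action it is the equivariance
  of (p, s).\<close>

lemma induced_quot_map:
  assumes m: "morphism GGZZ ZZ m" "\<And>a. a \<in> fib_gens \<Longrightarrow> comap GGZZ m a \<in> GG_fib_ideal"
    and m': "morphism GGQ QZ m'" "\<And>t. t \<in> pts GGQ \<Longrightarrow> m (ps1 t) = ps (m' t)"
    and b: "b \<in> carrier F0"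
  shows "\<rho>1 (induced (comap GGZZ m) b) = comap GGQ m' (\<rho>0 b)"
proof -
  obtain a where a: "a \<in> regular ZZ" "b = fib_ideal +>\<^bsub>coord_ring ZZ\<^esub> a"
    using b by (auto simp: Quot_carrier)
  have "comap GGZZ m a \<in> regular GGZZ"
    using ring_hom_closed[OF ring_hom_cring.homh[OF comap_hom[OF m(1)]], of a] a(1) by simp
  then have "\<rho>1 (induced (comap GGZZ m) b) = comap GGQ ps1 (comap GGZZ m a)"
    by (simp add: a(2) induced_coset[OF m a(1)] quot_ps1)
  also have "\<dots> = comap GGQ (\<lambda>t. m (ps1 t)) a" by (rule comap_comap[OF ps1_morphism a(1)])
  also have "\<dots> = comap GGQ (\<lambda>t. ps (m' t)) a"
    by (rule extensionalityI[where A = "pts GGQ"]) (simp_all add: comap_def m'(2))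
  also have "\<dots> = comap GGQ m' (comap QZ ps a)" by (rule comap_comap[OF m'(1) a(1), symmetric])
  finally show ?thesis by (simp add: a(2) quot_ps[OF a(1)])
qed

text \<open>Stated for an arbitrary morphism \<open>m\<close> so that it serves the identity of Z x
  Z as well as the projection and the action from the groupoid.\<close>

lemma locus_inverses:
  assumes m: "morphism T ZZ m" and x: "spec_map (coord_ring ZZ) (comap T m) x \<in> locus ZplusZminus"
  shows "left_inv T x (\<lambda>t. fst (fst (m t)))" and "right_inv T x (\<lambda>t. snd (snd (m t)))"
proof -
  let ?x = "spec_map (coord_ring ZZ) (comap T m) x"
  have "spec_map (coord_ring Z) (comap ZZ fst) ?x \<in> Uplus" "spec_map (coord_ring Z) (comap ZZ snd) ?x \<in> Uminus"
    using x by (auto simp: ZplusZminus_def spec_preim_def)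
  note l = left_inv_pullback[OF morphism_fst Uplus_left_inv[OF this(1)]]
    and r = right_inv_pullback[OF morphism_snd Uminus_right_inv[OF this(2)]]
  show "left_inv T x (\<lambda>t. fst (fst (m t)))" by (rule left_inv_pullback[OF m l])
  show "right_inv T x (\<lambda>t. snd (snd (m t)))" by (rule right_inv_pullback[OF m r])
qed

lemma stalk_iso0:
  assumes "q \<in> spec_preim (coord_ring ZZ) F0
    \<pi>0 (locus ZplusZminus)"
  shows "stalk_iso F0 (coord_ring QZ) \<rho>0 q"
proof -
  interpret t: affine_triangle "coord_ring ZZ" F0 "coord_ring QZ"
    \<pi>0 \<rho>0 "comap QZ ps" by (rule triangle0)
  let ?x = "spec_map (coord_ring ZZ) \<pi>0 q"
  have q: "q \<in> Spec F0" "?x \<in> locus ZplusZminus"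
    using assms by (auto simp: spec_preim_def)
  \<comment> \<open>Pullback along the identity fixes the functions on Z x Z, so
    \<open>locus_inverses\<close> applies with the identity as morphism.\<close>
  have id: "comap ZZ (\<lambda>z. z) a = a" if "a \<in> carrier (coord_ring ZZ)" for a
    using that by (simp add: comap_def regular_restrict)
  have "spec_map (coord_ring ZZ) (comap ZZ (\<lambda>z. z)) ?x = spec_map (coord_ring ZZ) (\<lambda>a. a) ?x"
    by (rule spec_map_cong) (rule id)
  also have "\<dots> = ?x" using Spec_subset[OF spec_map_Spec[OF t.f q(1)]] by (auto simp: spec_map_def)
  finally have x: "spec_map (coord_ring ZZ) (comap ZZ (\<lambda>z. z)) ?x \<in> locus ZplusZminus" using q(2) by simp
  show ?thesis
    by (rule graph_family.stalk_iso_of_inverses[OF graph_family0 t.g quot_ps q(1)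
          locus_inverses[OF morphism_id x]])
qed

lemma stalk_iso1:
  assumes "q \<in> spec_preim (coord_ring GGZZ) F1
    \<pi>1
    (spec_preim (coord_ring ZZ) (coord_ring GGZZ) (comap GGZZ m) (locus ZplusZminus))"
    and "m = snd \<or> m = act_map"
  shows "stalk_iso F1 (coord_ring GGQ) \<rho>1 q"
proof -
  interpret t: affine_triangle "coord_ring GGZZ" F1 "coord_ring GGQ"
    \<pi>1 \<rho>1 "comap GGQ ps1" by (rule triangle1)
  let ?x = "spec_map (coord_ring GGZZ) \<pi>1 q"
  have q: "q \<in> Spec F1"
    and x: "spec_map (coord_ring ZZ) (comap GGZZ m) ?x \<in> locus ZplusZminus"
    using assms(1) by (auto simp: spec_preim_def)
  have "left_inv GGZZ ?x (\<lambda>t. fst (fst (snd t))) \<and> right_inv GGZZ ?x (\<lambda>t. snd (snd (snd t)))"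
    using assms(2)
  proof
    assume m: "m = snd"
    show ?thesis using locus_inverses[OF morphism_snd x[unfolded m]] by simp
  next
    assume m: "m = act_map"
    \<comment> \<open>Here the inverses belong to the translated maps \<open>\<phi>1 g1^-1\<close>
      and \<open>g2 \<theta>2\<close>; the translation is removed afterwards.\<close>
    note l = locus_inverses(1)[OF act_map_morphism x[unfolded m]]
      and r = locus_inverses(2)[OF act_map_morphism x[unfolded m]]
    have l': "left_inv GGZZ ?x (\<lambda>t. fst (fst (snd t)) \<circ> inv_into UNIV (fst (fst t)))"
      using l by (simp add: case_prod_beta actZZ_eq)
    have r': "right_inv GGZZ ?x (\<lambda>t. snd (fst t) \<circ> snd (snd (snd t)))"
      using r by (simp add: case_prod_beta actZZ_eq)
    show ?thesis
      by (rule conjI[OF left_inv_translate[OF GG_comps(1) l'] right_inv_translate[OF GG_comps(2) r']])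
  qed
  then show ?thesis
    by (intro graph_family.stalk_iso_of_inverses[OF graph_family1 t.g quot_ps1 q]) simp_all
qed

lemma P_isomorphic_O_fib: "stack_sheaf_isomorphic ZplusZminus P O_fib"
  unfolding P_def O_fib_def
proof (rule equivariant_pushforward_isomorphic)
  have \<Gamma>: "base ZplusZminus = coord_ring ZZ" "total ZplusZminus = coord_ring GGZZ"
    "proj ZplusZminus = comap GGZZ snd" "act ZplusZminus = comap GGZZ act_map"
    by (simp_all add: ZplusZminus_def)
  show "affine_triangle (base ZplusZminus) F0 (coord_ring QZ)
      \<pi>0 \<rho>0 (comap QZ ps)"
    unfolding \<Gamma> by (rule triangle0)
  show "affine_triangle (total ZplusZminus) F1 (coord_ring GGQ)
      \<pi>1 \<rho>1 (comap GGQ ps1)"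
    unfolding \<Gamma> by (rule triangle1)
  show "ring_hom_cring (base ZplusZminus) (total ZplusZminus) (proj ZplusZminus)"
    "ring_hom_cring (base ZplusZminus) (total ZplusZminus) (act ZplusZminus)"
    unfolding \<Gamma> by (rule comap_hom[OF morphism_snd] comap_hom[OF act_map_morphism])+
  show "ring_hom_cring F0 F1 (induced (proj ZplusZminus))"
    "ring_hom_cring F0 F1 (induced (act ZplusZminus))"
    unfolding \<Gamma> by (rule induced_hom[OF morphism_snd] induced_hom[OF act_map_morphism], erule fib_gens_proj_act)+
  show "ring_hom_cring (coord_ring QZ) (coord_ring GGQ) (comap GGQ snd)"
    "ring_hom_cring (coord_ring QZ) (coord_ring GGQ) (comap GGQ actQ_map)"
    by (rule comap_hom[OF morphism_snd] comap_hom[OF actQ_map_morphism])+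
  show "GG_fib_ideal +>\<^bsub>coord_ring GGZZ\<^esub> proj ZplusZminus a
      = induced (proj ZplusZminus) (fib_ideal +>\<^bsub>coord_ring ZZ\<^esub> a)"
    "GG_fib_ideal +>\<^bsub>coord_ring GGZZ\<^esub> act ZplusZminus a
      = induced (act ZplusZminus) (fib_ideal +>\<^bsub>coord_ring ZZ\<^esub> a)"
    if "a \<in> carrier (base ZplusZminus)" for a
    using that induced_coset[OF morphism_snd fib_gens_proj_act(1)]
      induced_coset[OF act_map_morphism fib_gens_proj_act(2)] unfolding \<Gamma> by simp_all
  show "\<rho>1 (induced (proj ZplusZminus) b) = comap GGQ snd (\<rho>0 b)"
    if "b \<in> carrier F0" for b
    unfolding \<Gamma>
    by (rule induced_quot_map[OF morphism_snd fib_gens_proj_act(1) morphism_snd _ that])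
      (simp_all add: case_prod_beta)
  show "\<rho>1 (induced (act ZplusZminus) b) = comap GGQ actQ_map (\<rho>0 b)"
    if "b \<in> carrier F0" for b
    unfolding \<Gamma>
  proof (rule induced_quot_map[OF act_map_morphism fib_gens_proj_act(2) actQ_map_morphism _ that])
    fix t assume t: "t \<in> pts GGQ"
    \<comment> \<open>Equivariance of (p, s): \<open>g2\<close> cancels in (g1 c g2^-1) (g2 theta),
      and \<open>g1\<close> cancels in (phi g1^-1) (g1 c g2^-1).\<close>
    have "bij (snd (fst t))" using morphism_pts[OF GG_comps(2) t] by (simp add: pts_G)
    then show "act_map (ps1 t) = ps (actQ_map t)"
      by (simp add: case_prod_beta actZZ_eq actQ_eq ps_eq fun_eq_iff bij_is_inj)
        (use morphism_pts[OF GG_comps(1) t] in \<open>simp add: pts_G bij_is_inj\<close>)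
  qed
  show "stalk_iso F0 (coord_ring QZ) \<rho>0 x"
    if "x \<in> spec_preim (base ZplusZminus) F0
      \<pi>0 (locus ZplusZminus)" for x
    using stalk_iso0 that unfolding \<Gamma> .
  show "stalk_iso F1 (coord_ring GGQ) \<rho>1 x"
    if "x \<in> spec_preim (total ZplusZminus) F1
      \<pi>1
      (spec_preim (base ZplusZminus) (total ZplusZminus) (proj ZplusZminus) (locus ZplusZminus))" for x
    using stalk_iso1[of x snd] that unfolding \<Gamma> by simp
  show "stalk_iso F1 (coord_ring GGQ) \<rho>1 x"
    if "x \<in> spec_preim (total ZplusZminus) F1
      \<pi>1
      (spec_preim (base ZplusZminus) (total ZplusZminus) (act ZplusZminus) (locus ZplusZminus))" for x
    using stalk_iso1[of x act_map] that unfolding \<Gamma> by simp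
qed

end

theorem theorem3p2p21:
  fixes scaleV :: "'k::field_char_0 \<Rightarrow> 'v::ab_group_add \<Rightarrow> 'v" and BV :: "'v set"
    and scaleW :: "'k \<Rightarrow> 'w::ab_group_add \<Rightarrow> 'w" and BW :: "'w set"
    and scaleW' :: "'k \<Rightarrow> 'u::ab_group_add \<Rightarrow> 'u" and BW' :: "'u set"
  assumes "finite_dimensional_vector_space scaleV BV"
    and "finite_dimensional_vector_space scaleW BW"
    and "finite_dimensional_vector_space scaleW' BW'"
    and "vector_space.dim scaleV (UNIV :: 'v set) \<le> vector_space.dim scaleW (UNIV :: 'w set)"
    and "vector_space.dim scaleV (UNIV :: 'v set) \<le> vector_space.dim scaleW' (UNIV :: 'u set)"
  shows "stack_sheaf_isomorphic
    (three_spaces.ZplusZminus scaleV BV scaleW BW scaleW' BW')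
    (three_spaces.P scaleV BV scaleW BW scaleW' BW')
    (three_spaces.O_fib scaleV BV scaleW BW scaleW' BW')"
proof -
  interpret three_spaces scaleV BV scaleW BW scaleW' BW'
    by (rule three_spaces.intro[OF assms(1-3)])
  show ?thesis by (rule P_isomorphic_O_fib)
qed

end
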